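(* For $k>4$, every simple topological graph on $n\ge 2$ vertices with no $(k,1)$-crossing family has $O(n\log^{2k+2}n)$ edges. For $k\in\{2,3,4\}$, every simple topological graph on $n\ge 2$ vertices with no $(k,1)$-crossing family has $O(n\log^{6}n)$ edges.
   Context: A topological graph is a graph drawn in the plane with vertices as points and edges as non-self-intersecting arcs joining their endpoints, not passing through other vertices, with no tangencies; no parallel edges or loops. It is simple if every pair of edges has at most one point in common. Two edges cross if their interiors share a point; they are disjoint if they share no point (including endpoints). A $(k,1)$-crossing family consists of $k$ pairwise crossing edges together with one further edge disjoint from each of these $k$ edges. The implicit constants may depend on $k$. *)

theory Defs
  imports "HOL-Analysis.Analysis"
begin

text \<open>A topological graph: vertices are points of the plane (complex numbers), edges are
  2-element sets of vertices (so no loops, no parallel edges), and each edge e is drawn as an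
  arc (injective continuous path on [0,1]) curve e joining its two endpoints.\<close>

definition edge_interior :: "(complex set \<Rightarrow> real \<Rightarrow> complex) \<Rightarrow> complex set \<Rightarrow> complex set" where
  "edge_interior curve e = path_image (curve e) - e"

definition proper_crossing_at :: "complex set \<Rightarrow> complex set \<Rightarrow> complex \<Rightarrow> bool" where
  "proper_crossing_at A B p \<longleftrightarrow>
     (\<exists>U h h'. open U \<and> p \<in> U \<and> homeomorphism U (ball 0 1) h h' \<and> h p = 0 \<and>
        h ` (A \<inter> U) = {z \<in> ball 0 1. Im z = 0} \<and>
        h ` (B \<inter> U) = {z \<in> ball 0 1. Re z = 0})"

definition topological_graph :: "complex set \<Rightarrow> complex set set \<Rightarrow> (complex set \<Rightarrow> real \<Rightarrow> complex) \<Rightarrow> bool" where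
  "topological_graph V E curve \<longleftrightarrow>
     finite V \<and>
     (\<forall>e\<in>E. e \<subseteq> V \<and> card e = 2 \<and> arc (curve e) \<and>
        {pathstart (curve e), pathfinish (curve e)} = e \<and>
        path_image (curve e) \<inter> V = e) \<and>
     (\<forall>e\<in>E. \<forall>f\<in>E. e \<noteq> f \<longrightarrow>
        (\<forall>p \<in> edge_interior curve e \<inter> edge_interior curve f.
           proper_crossing_at (path_image (curve e)) (path_image (curve f)) p))"

definition simple_topological_graph :: "complex set \<Rightarrow> complex set set \<Rightarrow> (complex set \<Rightarrow> real \<Rightarrow> complex) \<Rightarrow> bool" where
  "simple_topological_graph V E curve \<longleftrightarrow>
     topological_graph V E curve \<and>
     (\<forall>e\<in>E. \<forall>f\<in>E. e \<noteq> f \<longrightarrow>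
        (\<forall>x y. x \<in> path_image (curve e) \<inter> path_image (curve f) \<longrightarrow>
               y \<in> path_image (curve e) \<inter> path_image (curve f) \<longrightarrow> x = y))"

definition edges_cross :: "(complex set \<Rightarrow> real \<Rightarrow> complex) \<Rightarrow> complex set \<Rightarrow> complex set \<Rightarrow> bool" where
  "edges_cross curve e f \<longleftrightarrow> edge_interior curve e \<inter> edge_interior curve f \<noteq> {}"

definition edges_disjoint :: "(complex set \<Rightarrow> real \<Rightarrow> complex) \<Rightarrow> complex set \<Rightarrow> complex set \<Rightarrow> bool" where
  "edges_disjoint curve e f \<longleftrightarrow> path_image (curve e) \<inter> path_image (curve f) = {}"

definition has_k1_crossing_family :: "nat \<Rightarrow> complex set set \<Rightarrow> (complex set \<Rightarrow> real \<Rightarrow> complex) \<Rightarrow> bool" where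
  "has_k1_crossing_family k E curve \<longleftrightarrow>
     (\<exists>F g. F \<subseteq> E \<and> card F = k \<and>
        (\<forall>e\<in>F. \<forall>f\<in>F. e \<noteq> f \<longrightarrow> edges_cross curve e f) \<and>
        g \<in> E \<and> (\<forall>e\<in>F. edges_disjoint curve e g))"

end

theory Submission
  imports Defs "HOL-Complex_Analysis.Complex_Analysis" "HOL-Probability.Probability"
begin

text \<open>
  Write \<open>\<Lambda>(n) = 1 + ln n\<close>. The bound obtained is \<open>O(n \<Lambda>(n)^(k + 2))\<close> for every \<open>k \<ge> 2\<close>.

  A graph without \<open>k\<close> pairwise crossing edges has \<open>O(n \<Lambda>(n)^(k - 2))\<close> edges, by induction on \<open>k\<close>. On a shortest
  path of the crossing relation, the neighbours of every fourth vertex span no \<open>k - 1\<close> pairwise crossing edges, so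
  shortest paths are cheap barriers in the plane. A winding number argument shows that four barriers meet every
  connected piece containing more than half of the edges, which yields balanced separators of the crossing relation.
  The vertex counts of mutually non-crossing connected pieces add up to \<open>O(n)\<close>, because such pieces form a plane
  structure without large complete minors, so each of the \<open>O(\<Lambda>(n))\<close> rounds of halving all pieces removes few edges.
  Hence, without a \<open>(k,1)\<close>-crossing family, every edge is disjoint from at most \<open>\<zeta> = O(n \<Lambda>(n)^(k - 2))\<close> others.

  A subgraph of a bipartite half that maximises \<open>m / (n \<Lambda>(n)^(k + 2))\<close> expands: the flow out of a set of stationary
  measure \<open>p \<le> 1/2\<close> is at least a constant times \<open>p (1 + ln (1/p)) / \<Lambda>\<close>. Therefore the lazy random walk mixes in
  \<open>O(\<Lambda>\<^sup>2)\<close> steps, and random walks of that length joining three random vertices on one side to three on the other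
  have, on average, fewer than one common vertex or pair of disjoint edges among nonadjacent walks once \<open>m\<close> exceeds a
  constant times \<open>\<Lambda>\<^sup>4 (n + \<zeta>)\<close>. A drawing of \<open>K\<^sub>3\<^sub>,\<^sub>3\<close> whose nonadjacent walks are vertex-disjoint, and in which edges
  from nonadjacent walks always cross, contradicts a parity identity for winding numbers.
\<close>

section \<open>The crossing index of two paths\<close>

lemma winding_number_eq_log_change:
  assumes "path l" and g: "\<And>t. t \<in> {0..1} \<Longrightarrow> g t = w + exp (l t)"
  shows "pathfinish l - pathstart l = 2 * of_real pi * \<i> * winding_number g w"
proof -
  have "winding_number g w = winding_number (\<lambda>t. g t - w) 0"
    by (rule winding_number_offset)
  also have "\<dots> = winding_number (exp \<circ> l) 0"
    by (rule winding_number_cong) (simp add: g)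
  finally show ?thesis
    using winding_number_compose_exp[OF assms(1)] by simp
qed

lemma constant_on_of_exp_constant:
  fixes d :: "'a::topological_space \<Rightarrow> complex"
  assumes "connected S" "continuous_on S d" and exp_d: "\<And>x. x \<in> S \<Longrightarrow> exp (d x) = c"
  shows "d constant_on S"
proof (rule continuous_discrete_range_constant[OF assms(1,2)])
  fix x assume "x \<in> S"
  show "\<exists>e>0. \<forall>y. y \<in> S \<and> d y \<noteq> d x \<longrightarrow> e \<le> norm (d y - d x)"
  proof (intro exI[of _ "2 * pi"] conjI allI impI)
    fix y assume y: "y \<in> S \<and> d y \<noteq> d x"
    then have "exp (d y) = exp (d x)"
      using exp_d \<open>x \<in> S\<close> by simp
    then obtain n :: int where n: "d y = d x + (of_int (2 * n) * pi) * \<i>"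
      by (auto simp: exp_eq)
    then have "1 \<le> \<bar>real_of_int n\<bar>"
      using y by fastforce
    then have "2 * pi \<le> 2 * pi * \<bar>real_of_int n\<bar>"
      by simp
    also have "\<dots> = norm (d y - d x)"
      by (simp add: n norm_mult)
    finally show "2 * pi \<le> norm (d y - d x)" .
  qed simp
qed

text \<open>\<open>2 \<pi> \<i>\<close> times the index is the change of \<open>log (g s - h t)\<close> once around the boundary of the unit square.\<close>

definition pair_index :: "(real \<Rightarrow> complex) \<Rightarrow> (real \<Rightarrow> complex) \<Rightarrow> complex" where
  "pair_index g h = winding_number g (pathstart h) - winding_number g (pathfinish h)
     + winding_number h (pathfinish g) - winding_number h (pathstart g)"

definition odd_index :: "(real \<Rightarrow> complex) \<Rightarrow> (real \<Rightarrow> complex) \<Rightarrow> bool" where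
  "odd_index g h \<longleftrightarrow> (\<exists>n::int. odd n \<and> pair_index g h = of_int n)"

definition ends_apart :: "(real \<Rightarrow> complex) \<Rightarrow> (real \<Rightarrow> complex) \<Rightarrow> bool" where
  "ends_apart g h \<longleftrightarrow> path g \<and> path h \<and> {pathstart g, pathfinish g} \<inter> path_image h = {}
     \<and> {pathstart h, pathfinish h} \<inter> path_image g = {}"

lemma pair_index_commute: "pair_index h g = - pair_index g h"
  by (simp add: pair_index_def)

lemma odd_index_commute: "odd_index h g \<longleftrightarrow> odd_index g h"
proof -
  have "odd_index g h" if "odd_index h g" for g h
    using that pair_index_commute[of g h] unfolding odd_index_def by (metis even_minus of_int_minus)
  then show ?thesis
    by blast
qed

lemma pair_index_reversepath_left:
  assumes "ends_apart g h"
  shows "pair_index (reversepath g) h = - pair_index g h"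
  using assms by (simp add: pair_index_def ends_apart_def winding_number_reversepath)

lemma odd_index_reversepath_left:
  assumes "ends_apart g h"
  shows "odd_index (reversepath g) h \<longleftrightarrow> odd_index g h"
  unfolding odd_index_def pair_index_reversepath_left[OF assms]
  by (metis even_minus of_int_minus minus_minus)

lemma pair_index_join_left:
  assumes "path g" "path g'" "pathfinish g = pathstart g'"
    and "{pathstart h, pathfinish h} \<inter> (path_image g \<union> path_image g') = {}"
  shows "pair_index (g +++ g') h = pair_index g h + pair_index g' h"
  using assms by (simp add: pair_index_def winding_number_join)

lemma pair_index_eq_log_change:
  assumes "path l0" "path l1" "path r0" "path r1"
    and l: "\<And>s. s \<in> {0..1} \<Longrightarrow> g s - h 0 = exp (l0 s)" "\<And>s. s \<in> {0..1} \<Longrightarrow> g s - h 1 = exp (l1 s)"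
    and r: "\<And>t. t \<in> {0..1} \<Longrightarrow> g 0 - h t = exp (r0 t)" "\<And>t. t \<in> {0..1} \<Longrightarrow> g 1 - h t = exp (r1 t)"
  shows "2 * of_real pi * \<i> * pair_index g h = (l0 1 - l0 0) - (l1 1 - l1 0) + (r1 1 - r1 0) - (r0 1 - r0 0)"
proof -
  have change_g: "k 1 - k 0 = 2 * of_real pi * \<i> * winding_number g w"
    if "path k" "\<And>s. s \<in> {0..1} \<Longrightarrow> g s - w = exp (k s)" for k w
    using winding_number_eq_log_change[of k g w] that
    by (simp add: pathstart_def pathfinish_def algebra_simps)
  have change_h: "k 1 - k 0 = 2 * of_real pi * \<i> * winding_number h z"
    if k: "path k" "\<And>t. t \<in> {0..1} \<Longrightarrow> z - h t = exp (k t)" for k z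
  proof -
    have "path (\<lambda>t. k t + of_real pi * \<i>)"
      using k(1) unfolding path_def by (intro continuous_intros)
    moreover have "h t = z + exp (k t + of_real pi * \<i>)" if "t \<in> {0..1}" for t
      using k(2)[OF that] by (simp add: exp_add algebra_simps)
    ultimately show ?thesis
      using winding_number_eq_log_change[of "\<lambda>t. k t + of_real pi * \<i>" h z]
      by (simp add: pathstart_def pathfinish_def)
  qed
  show ?thesis
    using change_g[OF assms(1) l(1)] change_g[OF assms(2) l(2)]
      change_h[OF assms(3) r(1)] change_h[OF assms(4) r(2)]
    by (simp add: pair_index_def pathstart_def pathfinish_def algebra_simps)
qed

lemma pair_index_disjoint:
  assumes "path g" "path h" "path_image g \<inter> path_image h = {}"
  shows "pair_index g h = 0"
proof -
  let ?S = "{0..1::real} \<times> {0..1::real}" and ?F = "\<lambda>x. g (fst x) - h (snd x)"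
  have "continuous_on ?S (\<lambda>x. g (fst x))" "continuous_on ?S (\<lambda>x. h (snd x))"
    using assms(1,2) unfolding path_def
    by (auto elim!: continuous_on_compose2 intro!: continuous_on_fst continuous_on_snd continuous_on_id)
  then have cont: "continuous_on ?S ?F"
    by (intro continuous_intros)
  have nz: "?F x \<noteq> 0" if "x \<in> ?S" for x
    using that assms(3) by (auto simp: path_image_def)
  have "contractible ?S"
    by (intro convex_imp_contractible convex_Times) simp_all
  then obtain l where l: "continuous_on ?S l" "\<And>x. x \<in> ?S \<Longrightarrow> ?F x = exp (l x)"
    using continuous_logarithm_on_contractible[OF cont _ nz] by metis
  have "path (\<lambda>s. l (s, t))" "path (\<lambda>s. l (t, s))" if "t \<in> {0..1}" for t
    unfolding path_def
    by (rule continuous_on_compose2[OF l(1)]; use that in \<open>auto intro!: continuous_intros\<close>)+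
  then have "2 * of_real pi * \<i> * pair_index g h = (l (1,0) - l (0,0)) - (l (1,1) - l (0,1))
      + (l (1,1) - l (1,0)) - (l (0,1) - l (0,0))"
    using l(2) by (intro pair_index_eq_log_change) auto
  then show ?thesis
    by simp
qed

lemma pair_index_subpath_left:
  assumes "ends_apart g h" "0 \<le> s" "s \<le> s'" "s' \<le> 1"
    and off: "\<And>t. t \<in> {0..s} \<union> {s'..1} \<Longrightarrow> g t \<notin> path_image h"
  shows "pair_index (subpath s s' g) h = pair_index g h"
proof -
  have sub: "winding_number (subpath 0 s g) z + winding_number (subpath s s' g) z
      + winding_number (subpath s' 1 g) z
      = winding_number g z" if "z \<notin> path_image g" for z
    using assms that winding_number_subpath_combine[of g z 0 s s'] winding_number_subpath_combine[of g z 0 s' 1]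
    by (simp add: ends_apart_def)
  have "path_image (subpath 0 s g) \<inter> path_image h = {}" "path_image (subpath s' 1 g) \<inter> path_image h = {}"
    using assms off by (auto simp: path_image_subpath)
  then have "pair_index (subpath 0 s g) h = 0" "pair_index (subpath s' 1 g) h = 0"
    using assms by (auto intro!: pair_index_disjoint path_subpath simp: ends_apart_def)
  moreover have "pair_index g h
      = pair_index (subpath 0 s g) h + pair_index (subpath s s' g) h + pair_index (subpath s' 1 g) h"
    using sub[of "pathstart h"] sub[of "pathfinish h"] assms(1)
    by (simp add: pair_index_def ends_apart_def pathstart_def pathfinish_def subpath_def algebra_simps)
  ultimately show ?thesis
    by simp
qed

text \<open>In the coordinates \<open>m = (z + w) / 2\<close> and \<open>e\<^sup>\<zeta> = (z - w) / 2\<close> the function \<open>k z - k w\<close> lives on a convex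
  set and so has a continuous logarithm \<open>L\<close>. Exchanging \<open>z\<close> and \<open>w\<close> translates \<open>\<zeta>\<close> by \<open>\<pi> \<i>\<close> and negates the
  function, so \<open>L\<close> grows by \<open>c = (2 n + 1) \<pi> \<i>\<close> under this translation, hence by \<open>2 c\<close> under a full turn of \<open>z - w\<close>.\<close>

lemma continuous_log_of_injective_difference:
  fixes k :: "complex \<Rightarrow> complex"
  assumes "continuous_on UNIV k" "inj k"
  obtains L :: "complex \<times> complex \<Rightarrow> complex" and n :: int
  where "continuous_on UNIV L" "\<And>m \<zeta>. exp (L (m, \<zeta>)) = k (m + exp \<zeta>) - k (m - exp \<zeta>)"
    and "\<And>m \<zeta>. L (m, \<zeta> + \<i> * of_real pi) = L (m, \<zeta>) + of_int (2 * n + 1) * of_real pi * \<i>"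
proof -
  let ?F = "\<lambda>x. k (fst x + exp (snd x)) - k (fst x - exp (snd x))"
  have "continuous_on UNIV ?F"
    by (intro continuous_intros continuous_on_compose2[OF assms(1)]) auto
  moreover have "contractible (UNIV :: (complex \<times> complex) set)"
    by (intro convex_imp_contractible convex_UNIV)
  moreover have "?F x \<noteq> 0" for x
    using injD[OF assms(2), of "fst x + exp (snd x)" "fst x - exp (snd x)"] by auto
  ultimately obtain L where L: "continuous_on UNIV L" "\<And>x. ?F x = exp (L x)"
    using continuous_logarithm_on_contractible[of UNIV ?F] by auto
  let ?d = "\<lambda>x. L (fst x, snd x + \<i> * of_real pi) - L x"
  have exp_d: "exp (?d x) = -1" for x
  proof -
    have "exp (L (fst x, snd x + \<i> * of_real pi)) = - exp (L x)"
      by (simp add: L(2)[symmetric] exp_add)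
    then show ?thesis
      by (simp add: exp_diff)
  qed
  have "?d constant_on UNIV"
    by (rule constant_on_of_exp_constant[OF connected_UNIV _ exp_d])
       (intro continuous_intros continuous_on_compose2[OF L(1)]; simp)
  then obtain c where d_const: "\<And>x. ?d x = c"
    by (auto simp: constant_on_def)
  have "exp c = exp (\<i> * of_real pi)"
    using exp_d[of "(0, 0)"] unfolding d_const by simp
  then obtain n :: int where "c = \<i> * of_real pi + (of_int (2 * n) * pi) * \<i>"
    unfolding exp_eq by blast
  then have "L (m, \<zeta> + \<i> * of_real pi) = L (m, \<zeta>) + of_int (2 * n + 1) * of_real pi * \<i>" for m \<zeta>
    using d_const[of "(m, \<zeta>)"] by (simp add: algebra_simps)
  then show thesis
    using L by (intro that[of L n]) (simp_all add: L(2)[symmetric])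
qed

lemma odd_index_axes:
  fixes k :: "complex \<Rightarrow> complex" and \<alpha> \<beta> :: "real \<Rightarrow> real"
  assumes k: "continuous_on UNIV k" "inj k"
    and \<alpha>: "continuous_on {0..1} \<alpha>" "\<alpha> 0 < 0" "0 < \<alpha> 1"
    and \<beta>: "continuous_on {0..1} \<beta>" "\<beta> 0 < 0" "0 < \<beta> 1"
    and g: "\<And>s. s \<in> {0..1} \<Longrightarrow> g s = k (of_real (\<alpha> s))"
    and h: "\<And>t. t \<in> {0..1} \<Longrightarrow> h t = k (\<i> * of_real (\<beta> t))"
  shows "odd_index g h"
proof -
  obtain L n where L: "continuous_on UNIV L" "\<And>m \<zeta>. exp (L (m, \<zeta>)) = k (m + exp \<zeta>) - k (m - exp \<zeta>)"
    and turn: "\<And>m \<zeta>. L (m, \<zeta> + \<i> * of_real pi) = L (m, \<zeta>) + of_int (2 * n + 1) * of_real pi * \<i>"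
    using continuous_log_of_injective_difference[OF k] by metis
  define m where "m s t = (of_real (\<alpha> s) + \<i> * of_real (\<beta> t)) / 2" for s t
  define d where "d s t = (of_real (\<alpha> s) - \<i> * of_real (\<beta> t)) / 2" for s t
  define \<Lambda> where "\<Lambda> s t = L (m s t, Ln (d s t))" for s t
  define left where "left t = L (m 0 t, Ln (- d 0 t) + \<i> * of_real pi)" for t
  have md: "m s t + d s t = of_real (\<alpha> s)" "m s t - d s t = \<i> * of_real (\<beta> t)" for s t
    by (simp_all add: m_def d_def field_simps)
  have log: "g s - h t = exp (\<Lambda> s t)" if "s \<in> {0..1}" "t \<in> {0..1}" "d s t \<noteq> 0" for s t
    using that by (simp add: \<Lambda>_def L(2) md g h)
  have cut: "d s 0 \<notin> \<real>\<^sub>\<le>\<^sub>0" "d s 1 \<notin> \<real>\<^sub>\<le>\<^sub>0" "d 1 t \<notin> \<real>\<^sub>\<le>\<^sub>0" "- d 0 t \<notin> \<real>\<^sub>\<le>\<^sub>0" for s t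
    using \<alpha> \<beta> by (auto simp: d_def complex_nonpos_Reals_iff)
  then have nz: "d s 0 \<noteq> 0" "d s 1 \<noteq> 0" "d 1 t \<noteq> 0" "d 0 t \<noteq> 0" for s t
    by (metis minus_zero nonpos_Reals_zero_I)+
  have log_left: "g 0 - h t = exp (left t)" if "t \<in> {0..1}" for t
    using that nz by (simp add: left_def L(2) exp_add md g h)
  have "left 0 = \<Lambda> 0 0"
    using Ln_minus[OF nz(4), of 0] \<alpha> \<beta> by (auto simp: left_def \<Lambda>_def d_def)
  moreover have "left 1 = \<Lambda> 0 1 + 2 * (of_int (2 * n + 1) * of_real pi * \<i>)"
  proof -
    have "Ln (- d 0 1) = Ln (d 0 1) + \<i> * of_real pi"
      using Ln_minus[OF nz(4), of 1] \<alpha> \<beta> by (auto simp: d_def)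
    then show ?thesis
      using turn[of "m 0 1" "Ln (d 0 1)"] turn[of "m 0 1" "Ln (d 0 1) + \<i> * of_real pi"]
      by (simp add: left_def \<Lambda>_def)
  qed
  moreover have "2 * of_real pi * \<i> * pair_index g h
      = (\<Lambda> 1 0 - \<Lambda> 0 0) - (\<Lambda> 1 1 - \<Lambda> 0 1) + (\<Lambda> 1 1 - \<Lambda> 1 0) - (left 1 - left 0)"
  proof (rule pair_index_eq_log_change)
    show "path (\<lambda>s. \<Lambda> s 0)" "path (\<lambda>s. \<Lambda> s 1)" "path left" "path (\<Lambda> 1)"
      unfolding path_def \<Lambda>_def left_def
      by (intro continuous_on_compose2[OF L(1)] continuous_intros continuous_on_Ln;
          use cut \<alpha> \<beta> in \<open>auto simp: m_def d_def intro!: continuous_intros\<close>)+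
  qed (use log log_left nz in auto)
  ultimately have "2 * of_real pi * \<i> * pair_index g h = 2 * of_real pi * \<i> * of_int (- (2 * n + 1))"
    by (simp add: algebra_simps)
  then show ?thesis
    unfolding odd_index_def by (intro exI[of _ "- (2 * n + 1)"]) simp
qed

lemma odd_index_orient:
  assumes "ends_apart g h" "g' \<in> {g, reversepath g}" "h' \<in> {h, reversepath h}"
  shows "odd_index g' h' \<longleftrightarrow> odd_index g h"
proof -
  have "odd_index g' h \<longleftrightarrow> odd_index g h"
    using assms(1,2) odd_index_reversepath_left by auto
  moreover have "ends_apart h g'"
    using assms(1,2) by (auto simp: ends_apart_def)
  then have "odd_index h' g' \<longleftrightarrow> odd_index h g'"
    using assms(3) odd_index_reversepath_left by auto
  ultimately show ?thesis
    by (simp add: odd_index_commute)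
qed

lemma arc_orient:
  fixes f :: "'a::topological_space \<Rightarrow> real"
  assumes "arc q" and f: "continuous_on (path_image q) f" "inj_on f (path_image q)"
    and t: "0 < t" "t < 1" "f (q t) = 0"
  obtains q' where "q' \<in> {q, reversepath q}" "path q'" "path_image q' = path_image q"
    "continuous_on {0..1} (\<lambda>x. f (q' x))" "f (q' 0) < 0" "0 < f (q' 1)"
proof -
  have q: "continuous_on {0..1} q" "inj_on q {0..1}"
    using assms(1) by (auto simp: arc_def path_def)
  have "continuous_on {0..1} (\<lambda>x. f (q x))"
    using q f(1) by (intro continuous_on_compose2[OF f(1)]) (auto simp: path_image_def)
  moreover have "inj_on (\<lambda>x. f (q x)) {0..1}"
    using comp_inj_on[OF q(2)] f(2) by (simp add: path_image_def o_def)
  ultimately have "f (q 0) < 0 \<and> 0 < f (q 1) \<or> f (q 1) < 0 \<and> 0 < f (q 0)"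
    using continuous_inj_imp_mono[OF t(1,2), of "\<lambda>x. f (q x)"] t(3) by auto
  moreover have "continuous_on {0..1} (\<lambda>x. f (q' x))" if "path q'" "path_image q' = path_image q" for q'
    using that by (intro continuous_on_compose2[OF f(1)]) (auto simp: path_def path_image_def)
  moreover have "reversepath q 0 = q 1" "reversepath q 1 = q 0"
    by (simp_all add: reversepath_def)
  ultimately show thesis
    using arc_imp_path[OF assms(1)] by (elim disjE; intro that[of q] that[of "reversepath q"]) auto
qed

lemma odd_index_chart:
  assumes hom: "homeomorphism U UNIV k k'" and arcs: "arc g" "arc h"
    and g: "path_image g \<subseteq> U" "\<And>z. z \<in> path_image g \<Longrightarrow> Im (k z) = 0"
    and h: "path_image h \<subseteq> U" "\<And>z. z \<in> path_image h \<Longrightarrow> Re (k z) = 0"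
    and s: "0 < s" "s < 1" "k (g s) = 0" and t: "0 < t" "t < 1" "k (h t) = 0"
  shows "odd_index g h"
proof -
  have k'k: "k' (k z) = z" if "z \<in> U" for z
    using hom that by (auto simp: homeomorphism_def)
  then have k_inj: "x = y" if "x \<in> U" "y \<in> U" "k x = k y" for x y
    using that by metis
  have conts: "continuous_on U k" "continuous_on UNIV k'" and inj_k': "inj k'"
    using hom by (auto simp: homeomorphism_def intro: inj_on_inverseI[of _ k])
  have inj: "inj_on (\<lambda>z. Re (k z)) (path_image g)" "inj_on (\<lambda>z. Im (k z)) (path_image h)"
    by (rule inj_onI, rule k_inj, use g h in \<open>auto intro: complex_eqI\<close>)+
  have cont: "continuous_on (path_image g) (\<lambda>z. Re (k z))" "continuous_on (path_image h) (\<lambda>z. Im (k z))"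
    using g(1) h(1) conts(1) by (auto intro!: continuous_intros intro: continuous_on_subset)
  obtain g' where g': "g' \<in> {g, reversepath g}" "path g'" "path_image g' = path_image g"
      "continuous_on {0..1} (\<lambda>x. Re (k (g' x)))" "Re (k (g' 0)) < 0" "0 < Re (k (g' 1))"
    by (rule arc_orient[OF arcs(1) cont(1) inj(1) s(1,2)]) (simp_all add: s(3))
  obtain h' where h': "h' \<in> {h, reversepath h}" "path h'" "path_image h' = path_image h"
      "continuous_on {0..1} (\<lambda>x. Im (k (h' x)))" "Im (k (h' 0)) < 0" "0 < Im (k (h' 1))"
    by (rule arc_orient[OF arcs(2) cont(2) inj(2) t(1,2)]) (simp_all add: t(3))
  have "odd_index g' h'"
  proof (rule odd_index_axes[OF conts(2) inj_k' g'(4-6) h'(4-6)])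
    fix x :: real assume "x \<in> {0..1}"
    then have "g' x \<in> path_image g" "h' x \<in> path_image h"
      using g'(3) h'(3) by (auto simp: path_image_def)
    moreover from this have "of_real (Re (k (g' x))) = k (g' x)" "\<i> * of_real (Im (k (h' x))) = k (h' x)"
      using g(2) h(2) by (auto simp: complex_eq_iff)
    ultimately show "g' x = k' (of_real (Re (k (g' x))))" "h' x = k' (\<i> * of_real (Im (k (h' x))))"
      using k'k g(1) h(1) by auto
  qed
  moreover have "ends_apart g' h'"
    using g' h' g(2) h(2) by (force simp: ends_apart_def pathstart_def pathfinish_def)
  then have "ends_apart g h"
    using g'(1) h'(1) arcs by (auto simp: ends_apart_def arc_imp_path)
  ultimately show ?thesis
    using odd_index_orient g'(1) h'(1) by metis
qed

lemma homeomorphism_unit_ball_UNIV: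
  "homeomorphism (ball 0 1) (UNIV :: 'a::real_normed_vector set)
     (\<lambda>x. x /\<^sub>R (1 - norm x)) (\<lambda>y. y /\<^sub>R (1 + norm y))"
proof (rule homeomorphismI)
  have pos: "0 < 1 + norm y" for y :: 'a
    using norm_ge_zero[of y] by linarith
  show "continuous_on (ball 0 1) (\<lambda>x::'a. x /\<^sub>R (1 - norm x))"
    by (intro continuous_intros) auto
  show "continuous_on UNIV (\<lambda>y::'a. y /\<^sub>R (1 + norm y))"
    using pos by (intro continuous_intros) (metis less_irrefl)
  show "(\<lambda>y::'a. y /\<^sub>R (1 + norm y)) ` UNIV \<subseteq> ball 0 1"
    using pos by (auto simp: divide_simps)
  show "(x /\<^sub>R (1 - norm x)) /\<^sub>R (1 + norm (x /\<^sub>R (1 - norm x))) = x" if "x \<in> ball 0 1" for x :: 'a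
  proof -
    have "1 + norm (x /\<^sub>R (1 - norm x)) = 1 / (1 - norm x)"
      using that by (simp add: field_simps)
    then show ?thesis
      using that by simp
  qed
  show "(y /\<^sub>R (1 + norm y)) /\<^sub>R (1 - norm (y /\<^sub>R (1 + norm y))) = y" for y :: 'a
  proof -
    have "1 - norm (y /\<^sub>R (1 + norm y)) = 1 / (1 + norm y)"
      using pos[of y] by (simp add: field_simps)
    then show ?thesis
      using pos[of y] by simp
  qed
qed simp

lemma proper_crossing_at_chart:
  assumes "proper_crossing_at A B p"
  obtains U k k' where "open U" "p \<in> U" "homeomorphism U UNIV k k'" "k p = 0"
    "\<And>z. z \<in> A \<inter> U \<Longrightarrow> Im (k z) = 0" "\<And>z. z \<in> B \<inter> U \<Longrightarrow> Re (k z) = 0"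
proof -
  obtain U h h' where U: "open U" "p \<in> U" "homeomorphism U (ball 0 1) h h'" "h p = 0"
    and axes: "h ` (A \<inter> U) = {z \<in> ball 0 1. Im z = 0}" "h ` (B \<inter> U) = {z \<in> ball 0 1. Re z = 0}"
    using assms unfolding proper_crossing_at_def by blast
  show thesis
  proof (rule that[OF U(1,2) homeomorphism_compose[OF U(3) homeomorphism_unit_ball_UNIV]])
    show "((\<lambda>x. x /\<^sub>R (1 - norm x)) \<circ> h) p = 0"
      by (simp add: U(4))
    show "Im (((\<lambda>x. x /\<^sub>R (1 - norm x)) \<circ> h) z) = 0" if "z \<in> A \<inter> U" for z
      using axes(1) that by auto
    show "Re (((\<lambda>x. x /\<^sub>R (1 - norm x)) \<circ> h) z) = 0" if "z \<in> B \<inter> U" for z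
      using axes(2) that by auto
  qed
qed

lemma subpath_within_open:
  assumes "path q" "0 < t" "t < 1" "open U" "q t \<in> U"
  obtains s s' where "0 \<le> s" "s < t" "t < s'" "s' \<le> 1" "path_image (subpath s s' q) \<subseteq> U"
proof -
  have "openin (top_of_set {0..1}) ({0..1} \<inter> q -` U)"
    using assms(1,4) unfolding path_def by (rule continuous_openin_preimage_gen)
  moreover have "t \<in> {0..1} \<inter> q -` U"
    using assms by simp
  ultimately obtain e where e: "0 < e" "cball t e \<inter> {0..1} \<subseteq> {0..1} \<inter> q -` U"
    unfolding openin_contains_cball by blast
  define d where "d = Min {e, t, 1 - t}"
  have d: "0 < d" "d \<le> e" "d \<le> t" "d \<le> 1 - t"
    using e(1) assms(2,3) by (auto simp: d_def)
  then have "{t - d..t + d} \<subseteq> cball t e \<inter> {0..1}"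
    by (auto simp: dist_real_def)
  then have "path_image (subpath (t - d) (t + d) q) \<subseteq> U"
    using e(2) d(1) by (auto simp: path_image_subpath)
  then show thesis
    using d by (intro that[of "t - d" "t + d"]) auto
qed

lemma arc_localize_intersection:
  assumes "arc q" "path_image q \<inter> Q = {p}" "p \<notin> {pathstart q, pathfinish q}" "open U" "p \<in> U"
  obtains s s' t where "0 \<le> s" "s < s'" "s' \<le> 1" "arc (subpath s s' q)"
    "path_image (subpath s s' q) \<subseteq> U \<inter> path_image q" "\<And>x. x \<in> {0..s} \<union> {s'..1} \<Longrightarrow> q x \<notin> Q"
    "0 < t" "t < 1" "subpath s s' q t = p"
proof -
  have "p \<in> path_image q"
    using assms(2) by blast
  then obtain u where "0 \<le> u" "u \<le> 1" "q u = p"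
    by (auto simp: path_image_def)
  moreover from this have "u \<noteq> 0" "u \<noteq> 1"
    using assms(3) by (auto simp: pathstart_def pathfinish_def)
  ultimately have u: "0 < u" "u < 1" "q u = p"
    by auto
  obtain s s' where s: "0 \<le> s" "s < u" "u < s'" "s' \<le> 1" "path_image (subpath s s' q) \<subseteq> U"
    using subpath_within_open[OF arc_imp_path[OF assms(1)] u(1,2) assms(4)] u(3) assms(5) by metis
  show thesis
  proof (rule that[of s s' "(u - s) / (s' - s)"])
    show "q x \<notin> Q" if x: "x \<in> {0..s} \<union> {s'..1}" for x
    proof -
      have "x \<in> {0..1}" "x \<noteq> u"
        using x s by auto
      then have "q x \<in> path_image q" "q x \<noteq> q u"
        using assms(1) u by (auto simp: path_image_def arc_def dest: inj_onD)
      then show ?thesis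
        using assms(2) u(3) by blast
    qed
    show "arc (subpath s s' q)"
      using s assms(1) by (intro arc_subpath_arc) auto
    show "path_image (subpath s s' q) \<subseteq> U \<inter> path_image q"
      using s path_image_subpath_subset[of s s' q] by simp
  qed (use s u in \<open>auto simp: subpath_def\<close>)
qed

lemma odd_index_crossing:
  assumes arcs: "arc g" "arc h" and meet: "path_image g \<inter> path_image h = {p}"
    and inner: "p \<notin> {pathstart g, pathfinish g, pathstart h, pathfinish h}"
    and "proper_crossing_at (path_image g) (path_image h) p"
  shows "odd_index g h"
proof -
  obtain U k k' where U: "open U" "p \<in> U" "homeomorphism U UNIV k k'" "k p = 0"
    and axes: "\<And>z. z \<in> path_image g \<inter> U \<Longrightarrow> Im (k z) = 0" "\<And>z. z \<in> path_image h \<inter> U \<Longrightarrow> Re (k z) = 0"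
    using proper_crossing_at_chart[OF assms(5)] by metis
  obtain s s' t where s: "0 \<le> s" "s < s'" "s' \<le> 1" "arc (subpath s s' g)"
      "path_image (subpath s s' g) \<subseteq> U \<inter> path_image g" "\<And>x. x \<in> {0..s} \<union> {s'..1} \<Longrightarrow> g x \<notin> path_image h"
    and t: "0 < t" "t < 1" "subpath s s' g t = p"
    using arc_localize_intersection[OF arcs(1) meet _ U(1,2)] inner by auto
  obtain r r' u where r: "0 \<le> r" "r < r'" "r' \<le> 1" "arc (subpath r r' h)"
      "path_image (subpath r r' h) \<subseteq> U \<inter> path_image h" "\<And>x. x \<in> {0..r} \<union> {r'..1} \<Longrightarrow> h x \<notin> path_image g"
    and u: "0 < u" "u < 1" "subpath r r' h u = p"
    using arc_localize_intersection[OF arcs(2) _ _ U(1,2), of "path_image g"] meet inner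
    by (auto simp: Int_commute)
  let ?g = "subpath s s' g" and ?h = "subpath r r' h"
  have "ends_apart g h"
    using arcs s(1,3) s(6)[of 0] s(6)[of 1] r(1,3) r(6)[of 0] r(6)[of 1]
    by (auto simp: ends_apart_def arc_imp_path pathstart_def pathfinish_def)
  then have "pair_index ?g h = pair_index g h"
    using s by (intro pair_index_subpath_left) auto
  moreover have "ends_apart h ?g"
    using \<open>ends_apart g h\<close> s s(6)[of s] s(6)[of s'] by (auto simp: ends_apart_def arc_imp_path)
  then have "pair_index ?h ?g = pair_index h ?g"
  proof (rule pair_index_subpath_left)
    show "h x \<notin> path_image ?g" if "x \<in> {0..r} \<union> {r'..1}" for x
      using r(6)[OF that] s(5) by blast
  qed (use r in auto)
  moreover have "odd_index ?g ?h"
  proof (rule odd_index_chart[OF U(3) s(4) r(4) _ _ _ _ t(1,2) _ u(1,2)])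
    show "Im (k z) = 0" if "z \<in> path_image ?g" for z
      using axes(1) s(5) that by blast
    show "Re (k z) = 0" if "z \<in> path_image ?h" for z
      using axes(2) r(5) that by blast
  qed (use s(5) r(5) t u U(4) in auto)
  ultimately show ?thesis
    unfolding odd_index_def by (metis pair_index_commute minus_equation_iff)
qed

text \<open>Modulo 2 the index is determined by integers attached to the individual pairs (path, end point) and
  (end point, end point): \<open>turn_number g w\<close> compares the winding of \<open>g\<close> around \<open>w\<close> with the principal
  logarithm, and \<open>above\<close> records the branch of the logarithm.\<close>

definition turn_number :: "(real \<Rightarrow> complex) \<Rightarrow> complex \<Rightarrow> int" where
  "turn_number g w = (SOME n. winding_number g w =
     (Ln (pathfinish g - w) - Ln (pathstart g - w)) / (2 * of_real pi * \<i>) + of_int n)"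

lemma winding_number_turn_number:
  assumes "path g" "w \<notin> path_image g"
  shows "winding_number g w
    = (Ln (pathfinish g - w) - Ln (pathstart g - w)) / (2 * of_real pi * \<i>) + of_int (turn_number g w)"
proof -
  have nz: "pathstart g - w \<noteq> 0" "pathfinish g - w \<noteq> 0"
    using assms by auto
  have "exp (2 * of_real pi * \<i> * winding_number g w) = exp (Ln (pathfinish g - w) - Ln (pathstart g - w))"
    using winding_number_exp_2pi[OF assms] nz by (simp add: exp_diff field_simps)
  then obtain n :: int where "2 * of_real pi * \<i> * winding_number g w
      = Ln (pathfinish g - w) - Ln (pathstart g - w) + (of_int (2 * n) * pi) * \<i>"
    by (metis exp_eq)
  then have "winding_number g w
      = (Ln (pathfinish g - w) - Ln (pathstart g - w)) / (2 * of_real pi * \<i>) + of_int n"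
    by (simp add: field_simps)
  then show ?thesis
    unfolding turn_number_def by (rule someI)
qed

definition above :: "complex \<Rightarrow> complex \<Rightarrow> int" where
  "above p q = of_bool (Im (p - q) > 0 \<or> Im (p - q) = 0 \<and> Re (p - q) < 0)"

lemma above_add: "p \<noteq> q \<Longrightarrow> above p q + above q p = 1"
  by (auto simp: above_def complex_eq_iff)

lemma Ln_diff_above:
  assumes "p \<noteq> q"
  shows "Ln (p - q) - Ln (q - p) = of_real pi * \<i> * (2 * of_int (above p q) - 1)"
  using Ln_minus[of "p - q"] assms by (auto simp: above_def algebra_simps)

lemma pair_index_eq_of_int:
  assumes "ends_apart g h" "pathstart g = a" "pathfinish g = b" "pathstart h = c" "pathfinish h = d"
  shows "pair_index g h = of_int (turn_number g c - turn_number g d + turn_number h b - turn_number h a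
      + above b c - above a c - above b d + above a d)"
proof -
  have ne: "a \<noteq> c" "a \<noteq> d" "b \<noteq> c" "b \<noteq> d"
    using assms by (auto simp: ends_apart_def)
  have "pair_index g h = ((Ln (b - c) - Ln (c - b)) - (Ln (a - c) - Ln (c - a))
       - (Ln (b - d) - Ln (d - b)) + (Ln (a - d) - Ln (d - a))) / (2 * of_real pi * \<i>)
     + of_int (turn_number g c - turn_number g d + turn_number h b - turn_number h a)"
    using assms
    by (simp add: pair_index_def ends_apart_def winding_number_turn_number diff_divide_distrib add_divide_distrib)
  also have "((Ln (b - c) - Ln (c - b)) - (Ln (a - c) - Ln (c - a))
       - (Ln (b - d) - Ln (d - b)) + (Ln (a - d) - Ln (d - a))) / (2 * of_real pi * \<i>)
     = of_int (above b c - above a c - above b d + above a d)"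
    using ne by (simp add: Ln_diff_above field_simps)
  finally show ?thesis
    by simp
qed

section \<open>The parity obstruction for \<open>K\<^sub>3\<^sub>,\<^sub>3\<close>\<close>

text \<open>The pairs of vertex-disjoint edges of \<open>K\<^sub>3\<^sub>,\<^sub>3\<close>, where \<open>(i, j)\<close> is the edge joining the \<open>i\<close>-th vertex on
  one side to the \<open>j\<close>-th vertex on the other; each unordered pair is listed once.\<close>

definition independent_pairs :: "((nat \<times> nat) \<times> (nat \<times> nat)) set" where
  "independent_pairs = {((i, j), (k, l)). i < k \<and> k < 3 \<and> j < 3 \<and> l < 3 \<and> j \<noteq> l}"

lemma independent_pairs_eq:
  "independent_pairs = (\<lambda>((i, k), (j, l)). ((i, j), (k, l))) `
    ({(0,1),(0,2),(1,2)} \<times> {(0,1),(0,2),(1,0),(1,2),(2,0),(2,1)})"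
proof -
  have "{(i, k). i < k \<and> k < (3::nat)} = {(0,1),(0,2),(1,2)}"
    by (auto simp: numeral_eq_Suc less_Suc_eq)
  moreover have "{(j, l). j < 3 \<and> l < 3 \<and> j \<noteq> (l::nat)} = {(0,1),(0,2),(1,0),(1,2),(2,0),(2,1)}"
    by (auto simp: numeral_eq_Suc less_Suc_eq)
  moreover have "independent_pairs = (\<lambda>((i, k), (j, l)). ((i, j), (k, l))) `
      ({(i, k). i < k \<and> k < 3} \<times> {(j, l). j < 3 \<and> l < 3 \<and> j \<noteq> l})"
    by (force simp: independent_pairs_def)
  ultimately show ?thesis
    by simp
qed

lemma sum_independent_pairs:
  "(\<Sum>((i, j), (k, l))\<in>independent_pairs. f i j k l)
    = (\<Sum>(i, k)\<leftarrow>[(0,1),(0,2),(1,2)]. \<Sum>(j, l)\<leftarrow>[(0,1),(0,2),(1,0),(1,2),(2,0),(2,1)]. f i j k l)"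
proof -
  let ?I = "{(0,1),(0,2),(1,2)} :: (nat \<times> nat) set"
    and ?J = "{(0,1),(0,2),(1,0),(1,2),(2,0),(2,1)} :: (nat \<times> nat) set"
  have "inj_on (\<lambda>((i, k), (j, l)). ((i, j), (k, l))) (?I \<times> ?J)"
    by (auto simp: inj_on_def)
  then have "(\<Sum>((i, j), (k, l))\<in>independent_pairs. f i j k l)
      = (\<Sum>(x, y)\<in>?I \<times> ?J. f (fst x) (fst y) (snd x) (snd y))"
    unfolding independent_pairs_eq by (simp only: sum.reindex) (simp only: o_def split_def fst_conv snd_conv)
  also have "\<dots> = (\<Sum>x\<in>?I. \<Sum>y\<in>?J. f (fst x) (fst y) (snd x) (snd y))"
    by (simp only: sum.cartesian_product)
  finally show ?thesis
    by (simp add: add.assoc)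
qed

lemma card_independent_pairs: "card independent_pairs = 18"
proof -
  have "card independent_pairs = (\<Sum>((i, j), (k, l))\<in>independent_pairs. 1)"
    by (simp add: case_prod_beta)
  also have "\<dots> = 18"
    unfolding sum_independent_pairs by simp
  finally show ?thesis .
qed

lemma finite_independent_pairs: "finite independent_pairs"
  using card_independent_pairs by (intro card_ge_0_finite) simp

lemma K33_parity:
  fixes I :: "nat \<Rightarrow> nat \<Rightarrow> nat \<Rightarrow> nat \<Rightarrow> int" and \<phi> :: "nat \<Rightarrow> nat \<Rightarrow> 'v \<Rightarrow> int" and \<omega> :: "'v \<Rightarrow> 'v \<Rightarrow> int"
  assumes I: "\<And>i j k l. ((i, j), (k, l)) \<in> independent_pairs \<Longrightarrow>
      even (I i j k l - (\<phi> i j (a k) + \<phi> i j (b l) + \<phi> k l (a i) + \<phi> k l (b j)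
        + \<omega> (a i) (a k) + \<omega> (a i) (b l) + \<omega> (b j) (a k) + \<omega> (b j) (b l)))"
    and ba: "\<And>i j. \<lbrakk>i < 3; j < 3\<rbrakk> \<Longrightarrow> \<omega> (b j) (a i) = 1 - \<omega> (a i) (b j)"
    and bb: "\<And>j l. \<lbrakk>j < l; l < 3\<rbrakk> \<Longrightarrow> \<omega> (b l) (b j) = 1 - \<omega> (b j) (b l)"
  shows "odd (\<Sum>((i, j), (k, l))\<in>independent_pairs. I i j k l)"
proof -
  let ?R = "\<lambda>i j k l. \<phi> i j (a k) + \<phi> i j (b l) + \<phi> k l (a i) + \<phi> k l (b j)
        + \<omega> (a i) (a k) + \<omega> (a i) (b l) + \<omega> (b j) (a k) + \<omega> (b j) (b l)"
  have "even (\<Sum>((i, j), (k, l))\<in>independent_pairs. I i j k l - ?R i j k l)"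
    using I by (intro dvd_sum) (auto simp only: split: prod.splits)
  then have "even ((\<Sum>((i, j), (k, l))\<in>independent_pairs. I i j k l)
      - (\<Sum>((i, j), (k, l))\<in>independent_pairs. ?R i j k l))"
    by (simp only: split_def flip: sum_subtractf)
  moreover have "odd (\<Sum>((i, j), (k, l))\<in>independent_pairs. ?R i j k l)"
  proof -
    let ?S = "\<Sum>(i, i', i'')\<leftarrow>[(0,1,2),(1,2,0),(2,0,1)]. \<Sum>(j, j', j'')\<leftarrow>[(0,1,2),(1,2,0),(2,0,1)].
      \<phi> i j (a i') + \<phi> i j (a i'') + \<phi> i j (b j') + \<phi> i j (b j'')"
    let ?A = "\<omega> (a 0) (a 1) + \<omega> (a 0) (a 2) + \<omega> (a 1) (a 2)"
      and ?B = "\<lambda>i. \<omega> (a i) (b 0) + \<omega> (a i) (b 1) + \<omega> (a i) (b 2)"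
    have "\<omega> (b 0) (a i) = 1 - \<omega> (a i) (b 0)" "\<omega> (b 1) (a i) = 1 - \<omega> (a i) (b 1)"
        "\<omega> (b 2) (a i) = 1 - \<omega> (a i) (b 2)" if "i \<in> {1, 2}" for i
      using that ba by auto
    note ba_instances = this[of 1] this[of 2]
    have bb_instances: "\<omega> (b 1) (b 0) = 1 - \<omega> (b 0) (b 1)" "\<omega> (b 2) (b 0) = 1 - \<omega> (b 0) (b 2)"
        "\<omega> (b 2) (b 1) = 1 - \<omega> (b 1) (b 2)"
      using bb by auto
    have "(\<Sum>((i, j), (k, l))\<in>independent_pairs. ?R i j k l)
        = 2 * (?S + 3 * ?A + 2 * ?B 0 + 9 - 2 * ?B 2) + 9"
      unfolding sum_independent_pairs using ba_instances bb_instances by simp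
    also have "odd \<dots>"
      by (simp only: even_add even_mult_iff) simp
    finally show ?thesis .
  qed
  ultimately show ?thesis
    by (simp only: even_diff even_add) simp
qed

lemma K33_ends_distinct:
  assumes X: "\<And>i j. \<lbrakk>i < 3; j < 3\<rbrakk> \<Longrightarrow> a i \<in> X i j \<and> b j \<in> X i j"
    and apart: "\<And>i j k l. ((i, j), (k, l)) \<in> independent_pairs \<Longrightarrow>
      {a i, b j} \<inter> X k l = {} \<and> {a k, b l} \<inter> X i j = {}"
  shows "\<lbrakk>i < 3; j < 3\<rbrakk> \<Longrightarrow> a i \<noteq> b j" and "\<lbrakk>j < l; l < 3\<rbrakk> \<Longrightarrow> b j \<noteq> b l"
proof -
  show "a i \<noteq> b j" if ij: "i < 3" "j < 3"
  proof -
    obtain k l :: nat where kl: "k < 3" "k \<noteq> i" "l < 3" "l \<noteq> j"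
      by (metis One_nat_def Suc_lessI zero_neq_one numeral_3_eq_3 zero_less_Suc less_Suc_eq)
    then have "((i, l), (k, j)) \<in> independent_pairs \<or> ((k, j), (i, l)) \<in> independent_pairs"
      using ij by (auto simp: independent_pairs_def)
    then have "a i \<notin> X k j"
      using apart by blast
    then show ?thesis
      using X[of k j] kl ij by auto
  qed
  show "b j \<noteq> b l" if jl: "j < l" "l < 3"
  proof -
    have "b j \<notin> X 1 l"
      using apart[of 0 j 1 l] jl by (auto simp: independent_pairs_def)
    then show ?thesis
      using X[of 1 l] jl by auto
  qed
qed

theorem K33_pair_index_odd:
  fixes g :: "nat \<Rightarrow> nat \<Rightarrow> real \<Rightarrow> complex" and I :: "nat \<Rightarrow> nat \<Rightarrow> nat \<Rightarrow> nat \<Rightarrow> int"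
  assumes g: "\<And>i j. \<lbrakk>i < 3; j < 3\<rbrakk> \<Longrightarrow> pathstart (g i j) = a i \<and> pathfinish (g i j) = b j"
    and apart: "\<And>i j k l. ((i, j), (k, l)) \<in> independent_pairs \<Longrightarrow> ends_apart (g i j) (g k l)"
    and I: "\<And>i j k l. ((i, j), (k, l)) \<in> independent_pairs \<Longrightarrow> pair_index (g i j) (g k l) = of_int (I i j k l)"
  shows "odd (\<Sum>((i, j), (k, l))\<in>independent_pairs. I i j k l)"
proof -
  have ends: "a i \<in> path_image (g i j) \<and> b j \<in> path_image (g i j)" if "i < 3" "j < 3" for i j
    using g[OF that] pathstart_in_path_image pathfinish_in_path_image by metis
  have avoid: "{a i, b j} \<inter> path_image (g k l) = {} \<and> {a k, b l} \<inter> path_image (g i j) = {}"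
    if "((i, j), (k, l)) \<in> independent_pairs" for i j k l
    using apart[OF that] g[of i j] g[of k l] that by (auto simp: ends_apart_def independent_pairs_def)
  have ab: "a i \<noteq> b j" if "i < 3" "j < 3" for i j
    using K33_ends_distinct(1)[of a "\<lambda>i j. path_image (g i j)" b] ends avoid that by metis
  have bb: "b j \<noteq> b l" if "j < l" "l < 3" for j l
    using K33_ends_distinct(2)[of a "\<lambda>i j. path_image (g i j)" b] ends avoid that by metis
  show ?thesis
  proof (rule K33_parity[where a = a and b = b and \<phi> = "\<lambda>i j. turn_number (g i j)" and \<omega> = above])
    fix i j k l assume ijkl: "((i, j), (k, l)) \<in> independent_pairs"
    then have "i < 3" "j < 3" "k < 3" "l < 3"
      by (auto simp: independent_pairs_def)
    then have "of_int (I i j k l) = (of_int (turn_number (g i j) (a k) - turn_number (g i j) (b l)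
        + turn_number (g k l) (b j) - turn_number (g k l) (a i)
        + above (b j) (a k) - above (a i) (a k) - above (b j) (b l) + above (a i) (b l)) :: complex)"
      using pair_index_eq_of_int[OF apart[OF ijkl]] g unfolding I[OF ijkl] by blast
    then have "I i j k l = turn_number (g i j) (a k) - turn_number (g i j) (b l)
        + turn_number (g k l) (b j) - turn_number (g k l) (a i)
        + above (b j) (a k) - above (a i) (a k) - above (b j) (b l) + above (a i) (b l)"
      by (simp only: of_int_eq_iff)
    then show "even (I i j k l - (turn_number (g i j) (a k) + turn_number (g i j) (b l)
        + turn_number (g k l) (a i) + turn_number (g k l) (b j)
        + above (a i) (a k) + above (a i) (b l) + above (b j) (a k) + above (b j) (b l)))"
      by presburger
  next
    show "above (b j) (a i) = 1 - above (a i) (b j)" if "i < 3" "j < 3" for i j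
      using above_add[of "a i" "b j"] ab[OF that] by simp
    show "above (b l) (b j) = 1 - above (b j) (b l)" if "j < l" "l < 3" for j l
      using above_add[of "b j" "b l"] bb[OF that] by simp
  qed
qed

corollary K33_paths_meet:
  fixes g :: "nat \<Rightarrow> nat \<Rightarrow> real \<Rightarrow> complex"
  assumes g: "\<And>i j. \<lbrakk>i < 3; j < 3\<rbrakk> \<Longrightarrow> path (g i j) \<and> pathstart (g i j) = a i \<and> pathfinish (g i j) = b j"
  shows "\<exists>i j k l. ((i, j), (k, l)) \<in> independent_pairs \<and> path_image (g i j) \<inter> path_image (g k l) \<noteq> {}"
proof (rule ccontr)
  assume "\<not> ?thesis"
  then have disj: "path_image (g i j) \<inter> path_image (g k l) = {}"
    if "((i, j), (k, l)) \<in> independent_pairs" for i j k l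
    using that by blast
  have paths: "path (g i j)" "path (g k l)" if "((i, j), (k, l)) \<in> independent_pairs" for i j k l
    using g that by (auto simp: independent_pairs_def)
  have "odd (\<Sum>((i, j), (k, l))\<in>independent_pairs. 0::int)"
  proof (rule K33_pair_index_odd)
    show "ends_apart (g i j) (g k l)" if "((i, j), (k, l)) \<in> independent_pairs" for i j k l
      using disj[OF that] paths[OF that] pathstart_in_path_image pathfinish_in_path_image
      unfolding ends_apart_def by fast
    show "pair_index (g i j) (g k l) = of_int 0" if "((i, j), (k, l)) \<in> independent_pairs" for i j k l
      using pair_index_disjoint[OF paths[OF that] disj[OF that]] by simp
  qed (use g in auto)
  then show False
    by (simp add: case_prod_beta)
qed

section \<open>Walks in simple topological graphs\<close>

fun walk_edges :: "'a list \<Rightarrow> 'a set list" where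
  "walk_edges (x # y # xs) = {x, y} # walk_edges (y # xs)"
| "walk_edges _ = []"

lemma length_walk_edges: "length (walk_edges xs) = length xs - 1"
  by (induction xs rule: walk_edges.induct) auto

lemma walk_edges_subset: "e \<in> set (walk_edges xs) \<Longrightarrow> e \<subseteq> set xs"
  by (induction xs rule: walk_edges.induct) auto

lemma set_walk_subset_Union:
  assumes "2 \<le> length xs"
  shows "set xs \<subseteq> \<Union>(set (walk_edges xs))"
  using assms
proof (induction xs rule: walk_edges.induct)
  case (1 x y xs)
  then show ?case
    by (cases xs) auto
qed auto

text \<open>A vertex list of even length is a walk with an odd number of edges.\<close>

definition K33_walk_system :: "'a set set \<Rightarrow> (nat \<Rightarrow> 'a) \<Rightarrow> (nat \<Rightarrow> 'a) \<Rightarrow> (nat \<Rightarrow> nat \<Rightarrow> 'a list) \<Rightarrow> bool" where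
  "K33_walk_system E a b w \<longleftrightarrow>
     (\<forall>i<3. \<forall>j<3. w i j \<noteq> [] \<and> hd (w i j) = a i \<and> last (w i j) = b j \<and> even (length (w i j))
        \<and> set (walk_edges (w i j)) \<subseteq> E)
     \<and> (\<forall>i j k l. ((i, j), (k, l)) \<in> independent_pairs \<longrightarrow> set (w i j) \<inter> set (w k l) = {})"

locale simple_tg =
  fixes V :: "complex set" and E :: "complex set set" and curve :: "complex set \<Rightarrow> real \<Rightarrow> complex"
  assumes stg: "simple_topological_graph V E curve"
begin

abbreviation img :: "complex set \<Rightarrow> complex set" where "img e \<equiv> path_image (curve e)"
abbreviation crossing :: "complex set \<Rightarrow> complex set \<Rightarrow> bool" where "crossing \<equiv> edges_cross curve"

lemma finite_V: "finite V"
  using stg by (simp add: simple_topological_graph_def topological_graph_def)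

lemma edgeD:
  assumes "e \<in> E"
  shows "e \<subseteq> V" "card e = 2" "arc (curve e)" "{pathstart (curve e), pathfinish (curve e)} = e" "img e \<inter> V = e"
  using stg assms by (auto simp: simple_topological_graph_def topological_graph_def)

lemma finite_E: "finite E"
  using finite_V edgeD(1) by (meson Pow_iff finite_Pow_iff finite_subset subsetI)

lemma finite_edge: "e \<in> E \<Longrightarrow> finite e"
  using edgeD(1) finite_V by (meson finite_subset)

lemma img_Int_unique:
  assumes "e \<in> E" "f \<in> E" "e \<noteq> f" "x \<in> img e" "x \<in> img f" "y \<in> img e" "y \<in> img f"
  shows "x = y"
  using stg assms by (auto simp: simple_topological_graph_def)

lemma proper_crossing:
  assumes "e \<in> E" "f \<in> E" "e \<noteq> f" "p \<in> img e" "p \<in> img f" "p \<notin> V"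
  shows "proper_crossing_at (img e) (img f) p"
proof -
  have "p \<in> edge_interior curve e \<inter> edge_interior curve f"
    using assms edgeD(1) by (auto simp: edge_interior_def)
  then show ?thesis
    using stg assms(1-3) unfolding simple_topological_graph_def topological_graph_def by blast
qed

lemma crossing_iff:
  "e \<in> E \<Longrightarrow> f \<in> E \<Longrightarrow> crossing e f \<longleftrightarrow> (\<exists>p. p \<in> img e \<and> p \<in> img f \<and> p \<notin> V)"
  using edgeD(5)[of e] edgeD(5)[of f] unfolding edges_cross_def edge_interior_def by auto

lemma crossing_sym: "crossing e f \<longleftrightarrow> crossing f e"
  by (auto simp: edges_cross_def)

lemma subgraph:
  assumes F: "F \<subseteq> E" and W: "W \<subseteq> V" "\<Union>F \<subseteq> W"
  shows "simple_tg W F curve"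
proof
  show "simple_topological_graph W F curve"
    unfolding simple_topological_graph_def topological_graph_def
  proof (intro conjI ballI allI impI)
    show "finite W"
      using W(1) finite_V by (rule finite_subset)
    show "e \<subseteq> W" "card e = 2" "arc (curve e)" "{pathstart (curve e), pathfinish (curve e)} = e" "img e \<inter> W = e"
      if "e \<in> F" for e
      using that F W edgeD[of e] by blast+
    show "proper_crossing_at (img e) (img f) p"
      if ef: "e \<in> F" "f \<in> F" "e \<noteq> f" and p: "p \<in> edge_interior curve e \<inter> edge_interior curve f" for e f p
    proof (rule proper_crossing)
      show "e \<in> E" "f \<in> E"
        using ef F by auto
      then show "p \<in> img e" "p \<in> img f" "p \<notin> V"
        using p edgeD(5)[of e] by (auto simp: edge_interior_def)
    qed fact
    show "x = y" if "e \<in> F" "f \<in> F" "e \<noteq> f" "x \<in> img e \<inter> img f" "y \<in> img e \<inter> img f" for e f x y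
      using img_Int_unique[of e f x y] that F by auto
  qed
qed

lemma odd_index_crossing_edges:
  assumes ef: "e \<in> E" "f \<in> E" "e \<inter> f = {}" and "crossing e f"
  shows "odd_index (curve e) (curve f)"
proof -
  obtain p where p: "p \<in> img e" "p \<in> img f" "p \<notin> V"
    using assms crossing_iff by blast
  have "e \<noteq> f"
    using ef edgeD(2)[of e] by auto
  show ?thesis
  proof (rule odd_index_crossing)
    show "img e \<inter> img f = {p}"
      using p img_Int_unique[OF ef(1,2) \<open>e \<noteq> f\<close>] by blast
    show "proper_crossing_at (img e) (img f) p"
      using proper_crossing[OF ef(1,2) \<open>e \<noteq> f\<close> p] .
    show "p \<notin> {pathstart (curve e), pathfinish (curve e), pathstart (curve f), pathfinish (curve f)}"
      using p(3) edgeD(1,4)[OF ef(1)] edgeD(1,4)[OF ef(2)] by blast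
  qed (use ef edgeD(3) in auto)
qed

lemma ends_apart_edge:
  assumes "e \<in> E" "path h" "path_image h \<inter> V \<inter> e = {}" "{pathstart h, pathfinish h} \<subseteq> V"
  shows "ends_apart (curve e) h"
proof -
  have "{pathstart (curve e), pathfinish (curve e)} \<inter> path_image h = {}"
    using assms(3) edgeD(1,4)[OF assms(1)] by blast
  moreover have "{pathstart h, pathfinish h} \<inter> img e = {}"
    using assms(3,4) edgeD(5)[OF assms(1)] pathstart_in_path_image pathfinish_in_path_image by blast
  ultimately show ?thesis
    using assms(2) edgeD(3)[OF assms(1)] by (simp add: ends_apart_def arc_imp_path)
qed

definition edge_path :: "complex \<Rightarrow> complex \<Rightarrow> real \<Rightarrow> complex" where
  "edge_path x y = (if pathstart (curve {x, y}) = x then curve {x, y} else reversepath (curve {x, y}))"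

fun walk_path :: "complex list \<Rightarrow> real \<Rightarrow> complex" where
  "walk_path (x # y # zs) = edge_path x y +++ walk_path (y # zs)"
| "walk_path [x] = linepath x x"
| "walk_path [] = linepath 0 0"

lemma edge_path:
  assumes "{x, y} \<in> E"
  shows "path (edge_path x y)" "pathstart (edge_path x y) = x" "pathfinish (edge_path x y) = y"
    and "path_image (edge_path x y) = img {x, y}"
proof -
  have "path (curve {x, y})" "pathstart (curve {x, y}) \<noteq> pathfinish (curve {x, y})"
      "{pathstart (curve {x, y}), pathfinish (curve {x, y})} = {x, y}"
    using edgeD[OF assms] arc_distinct_ends by (auto simp: arc_imp_path)
  then show "path (edge_path x y)" "pathstart (edge_path x y) = x" "pathfinish (edge_path x y) = y"
      "path_image (edge_path x y) = img {x, y}"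
    by (auto simp: edge_path_def doubleton_eq_iff)
qed

lemma walk_path:
  assumes "w \<noteq> []" "set (walk_edges w) \<subseteq> E"
  shows "path (walk_path w) \<and> pathstart (walk_path w) = hd w \<and> pathfinish (walk_path w) = last w
    \<and> path_image (walk_path w) \<inter> V \<subseteq> set w"
  using assms
proof (induction w rule: walk_edges.induct)
  case (1 x y zs)
  then have "{x, y} \<in> E"
    by simp
  from 1 edge_path[OF this] edgeD(5)[OF this] show ?case
    by (auto simp: path_image_join)
qed auto

lemma pair_index_walk_path:
  assumes "w \<noteq> []" "set (walk_edges w) \<subseteq> E"
    and "\<And>e. e \<in> set (walk_edges w) \<Longrightarrow> ends_apart (curve e) h \<and> odd_index (curve e) h"
    and "{pathstart h, pathfinish h} \<inter> set w = {}" "{pathstart h, pathfinish h} \<subseteq> V"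
  shows "\<exists>n::int. pair_index (walk_path w) h = of_int n \<and> (even n \<longleftrightarrow> even (length (walk_edges w)))"
  using assms
proof (induction w rule: walk_edges.induct)
  case (1 x y zs)
  obtain n :: int where n: "pair_index (walk_path (y # zs)) h = of_int n"
      "even n \<longleftrightarrow> even (length (walk_edges (y # zs)))"
    using 1 by auto
  have xy: "{x, y} \<in> E" "ends_apart (curve {x, y}) h" "odd_index (curve {x, y}) h"
    using "1.prems" by auto
  have "odd_index (edge_path x y) h"
    using xy odd_index_reversepath_left by (simp add: edge_path_def)
  then obtain m :: int where m: "odd m" "pair_index (edge_path x y) h = of_int m"
    by (auto simp: odd_index_def)
  have yzs: "y # zs \<noteq> []" "set (walk_edges (y # zs)) \<subseteq> E"
    using "1.prems"(2) by auto
  have "path_image (walk_path (y # zs)) \<inter> {pathstart h, pathfinish h} = {}"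
    using walk_path[OF yzs] "1.prems"(4,5) by auto
  then have "pair_index (walk_path (x # y # zs)) h
      = pair_index (edge_path x y) h + pair_index (walk_path (y # zs)) h"
    unfolding walk_path.simps using edge_path[OF xy(1)] walk_path[OF yzs] xy(2)
    by (intro pair_index_join_left) (auto simp: ends_apart_def)
  then have "pair_index (walk_path (x # y # zs)) h = of_int (m + n)"
    by (simp add: m n)
  then show ?case
    using m(1) n(2) by (intro exI[of _ "m + n"]) auto
qed (auto simp: pair_index_def)

lemma odd_walk_path:
  assumes w: "set (walk_edges w) \<subseteq> E" "odd (length (walk_edges w))"
  shows "w \<noteq> []" "path (walk_path w)" "{pathstart (walk_path w), pathfinish (walk_path w)} \<subseteq> set w \<inter> V"
    "path_image (walk_path w) \<inter> V \<subseteq> set w"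
proof -
  have long: "2 \<le> length w"
    using w(2) unfolding length_walk_edges by (cases "length w < 2") auto
  then show "w \<noteq> []"
    by auto
  moreover have "set w \<subseteq> V"
    using set_walk_subset_Union[OF long] w(1) edgeD(1) by blast
  ultimately show "path (walk_path w)" "{pathstart (walk_path w), pathfinish (walk_path w)} \<subseteq> set w \<inter> V"
    "path_image (walk_path w) \<inter> V \<subseteq> set w"
    using walk_path[OF _ w(1)] hd_in_set last_in_set by auto
qed

lemma odd_index_walk_paths:
  assumes w: "set (walk_edges w) \<subseteq> E" "odd (length (walk_edges w))"
    and w': "set (walk_edges w') \<subseteq> E" "odd (length (walk_edges w'))"
    and disj: "set w \<inter> set w' = {}"
    and cross: "\<And>e f. \<lbrakk>e \<in> set (walk_edges w); f \<in> set (walk_edges w')\<rbrakk> \<Longrightarrow> crossing e f"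
  shows "ends_apart (walk_path w) (walk_path w')" "odd_index (walk_path w) (walk_path w')"
proof -
  note p = odd_walk_path(2-)[OF w] and p' = odd_walk_path(2-)[OF w']
  have "{pathstart (walk_path w), pathfinish (walk_path w)} \<inter> path_image (walk_path w') = {}"
      "{pathstart (walk_path w'), pathfinish (walk_path w')} \<inter> path_image (walk_path w) = {}"
    using p(2,3) p'(2,3) disj by blast+
  then show "ends_apart (walk_path w) (walk_path w')"
    using p(1) p'(1) by (simp add: ends_apart_def)
  have edge_w': "odd_index (curve e) (walk_path w')" if e: "e \<in> set (walk_edges w)" for e
  proof -
    have eE: "e \<in> E" and e_disj: "e \<inter> set w' = {}"
      using e w(1) walk_edges_subset[OF e] disj by blast+
    have "ends_apart (curve f) (curve e) \<and> odd_index (curve f) (curve e)" if f: "f \<in> set (walk_edges w')" for f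
    proof -
      have fE: "f \<in> E" and "e \<inter> f = {}"
        using f w'(1) walk_edges_subset[OF f] e_disj by blast+
      then show ?thesis
        using edgeD[OF eE] odd_index_crossing_edges[OF fE eE] cross[OF e f]
        by (intro conjI ends_apart_edge) (auto simp: arc_imp_path crossing_sym)
    qed
    then obtain n :: int where "pair_index (walk_path w') (curve e) = of_int n"
        "even n \<longleftrightarrow> even (length (walk_edges w'))"
      using pair_index_walk_path[OF odd_walk_path(1)[OF w'] w'(1), of "curve e"] edgeD(1,4)[OF eE] e_disj by auto
    then show ?thesis
      using w'(2) odd_index_commute unfolding odd_index_def by blast
  qed
  have "ends_apart (curve e) (walk_path w')" if e: "e \<in> set (walk_edges w)" for e
    using p' walk_edges_subset[OF e] e w(1) disj by (intro ends_apart_edge) auto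
  then obtain n :: int where "pair_index (walk_path w) (walk_path w') = of_int n"
      "even n \<longleftrightarrow> even (length (walk_edges w))"
    using pair_index_walk_path[OF odd_walk_path(1)[OF w] w(1), of "walk_path w'"] edge_w' p'(2) disj by blast
  then show "odd_index (walk_path w) (walk_path w')"
    using w(2) unfolding odd_index_def by blast
qed

theorem K33_walk_system_disjoint_edges:
  assumes "K33_walk_system E a b w"
  shows "\<exists>i j k l. ((i, j), (k, l)) \<in> independent_pairs \<and>
    (\<exists>e\<in>set (walk_edges (w i j)). \<exists>f\<in>set (walk_edges (w k l)). edges_disjoint curve e f)"
proof (rule ccontr)
  assume none: "\<not> ?thesis"
  have w: "w i j \<noteq> []" "hd (w i j) = a i" "last (w i j) = b j" "odd (length (walk_edges (w i j)))"
      "set (walk_edges (w i j)) \<subseteq> E" if "i < 3" "j < 3" for i j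
    using assms that by (auto simp: K33_walk_system_def length_walk_edges)
  have index: "ends_apart (walk_path (w i j)) (walk_path (w k l))"
    "odd_index (walk_path (w i j)) (walk_path (w k l))"
    if ijkl: "((i, j), (k, l)) \<in> independent_pairs" for i j k l
  proof -
    have bounds: "i < 3" "j < 3" "k < 3" "l < 3"
      using ijkl by (auto simp: independent_pairs_def)
    have disj: "set (w i j) \<inter> set (w k l) = {}"
      using assms ijkl by (auto simp: K33_walk_system_def)
    have "crossing e f" if e: "e \<in> set (walk_edges (w i j))" and f: "f \<in> set (walk_edges (w k l))" for e f
    proof -
      have ef: "e \<in> E" "f \<in> E"
        using e f w(5) bounds by blast+
      obtain p where p: "p \<in> img e" "p \<in> img f"
        using none ijkl e f unfolding edges_disjoint_def by blast
      have "p \<notin> V"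
        using p edgeD(5)[OF ef(1)] edgeD(5)[OF ef(2)] walk_edges_subset[OF e] walk_edges_subset[OF f] disj
        by blast
      then show ?thesis
        using crossing_iff[OF ef] p by blast
    qed
    then show "ends_apart (walk_path (w i j)) (walk_path (w k l))"
      "odd_index (walk_path (w i j)) (walk_path (w k l))"
      by (intro odd_index_walk_paths[OF w(5,4) w(5,4) disj]; use bounds in simp)+
  qed
  then obtain I :: "nat \<Rightarrow> nat \<Rightarrow> nat \<Rightarrow> nat \<Rightarrow> int" where I: "\<And>i j k l. ((i, j), (k, l)) \<in> independent_pairs
      \<Longrightarrow> odd (I i j k l) \<and> pair_index (walk_path (w i j)) (walk_path (w k l)) = of_int (I i j k l)"
    unfolding odd_index_def by metis
  let ?I = "\<lambda>((i, j), (k, l)). I i j k l"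
  have "odd (sum ?I independent_pairs)"
    using index(1) I walk_path w
    by (intro K33_pair_index_odd[where g = "\<lambda>i j. walk_path (w i j)" and a = a and b = b]) auto
  moreover have "{p \<in> independent_pairs. odd (?I p)} = independent_pairs"
    using I by auto
  ultimately show False
    unfolding even_sum_iff[OF finite_independent_pairs] by (simp only: card_independent_pairs) simp
qed

end

section \<open>Connectivity and complete minors\<close>

definition induced :: "('a \<Rightarrow> 'a \<Rightarrow> bool) \<Rightarrow> 'a set \<Rightarrow> 'a rel" where
  "induced r S = {(u, v). u \<in> S \<and> v \<in> S \<and> r u v}"

definition rel_connected :: "('a \<Rightarrow> 'a \<Rightarrow> bool) \<Rightarrow> 'a set \<Rightarrow> bool" where
  "rel_connected r S \<longleftrightarrow> S \<noteq> {} \<and> (\<forall>x\<in>S. \<forall>y\<in>S. (x, y) \<in> (induced r S)\<^sup>*)"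

definition rel_component :: "('a \<Rightarrow> 'a \<Rightarrow> bool) \<Rightarrow> 'a set \<Rightarrow> 'a \<Rightarrow> 'a set" where
  "rel_component r S x = {y. (x, y) \<in> (induced r S)\<^sup>*}"

lemma rtrancl_induced_mono: "(x, y) \<in> (induced r S)\<^sup>* \<Longrightarrow> S \<subseteq> T \<Longrightarrow> (x, y) \<in> (induced r T)\<^sup>*"
  by (rule subsetD[OF rtrancl_mono]) (auto simp: induced_def)

lemma rtrancl_induced_sym: "symp r \<Longrightarrow> (x, y) \<in> (induced r S)\<^sup>* \<Longrightarrow> (y, x) \<in> (induced r S)\<^sup>*"
  by (rule symD[OF sym_rtrancl]) (auto simp: induced_def sym_def dest: sympD)

lemma rel_connectedI:
  assumes "symp r" "x \<in> S" and reach: "\<And>y. y \<in> S \<Longrightarrow> (x, y) \<in> (induced r S)\<^sup>*"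
  shows "rel_connected r S"
  unfolding rel_connected_def
proof (intro conjI ballI)
  show "S \<noteq> {}"
    using assms(2) by blast
  show "(y, z) \<in> (induced r S)\<^sup>*" if "y \<in> S" "z \<in> S" for y z
    using rtrancl_induced_sym[OF assms(1) reach[OF that(1)]] reach[OF that(2)] by (rule rtrancl_trans)
qed

lemma rel_connected_singleton: "rel_connected r {x}"
  by (simp add: rel_connected_def)

lemma rel_connected_Un:
  assumes "symp r" "rel_connected r A" "rel_connected r B" "x \<in> A" "y \<in> B" "r x y"
  shows "rel_connected r (A \<union> B)"
proof (rule rel_connectedI[of r x])
  fix z assume "z \<in> A \<union> B"
  then consider (left) "z \<in> A" | (right) "z \<in> B"
    by blast
  then show "(x, z) \<in> (induced r (A \<union> B))\<^sup>*"
  proof cases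
    case left
    then have "(x, z) \<in> (induced r A)\<^sup>*"
      using assms(2,4) by (simp add: rel_connected_def)
    then show ?thesis
      by (rule rtrancl_induced_mono) blast
  next
    case right
    then have "(y, z) \<in> (induced r B)\<^sup>*"
      using assms(3,5) by (simp add: rel_connected_def)
    then have "(y, z) \<in> (induced r (A \<union> B))\<^sup>*"
      by (rule rtrancl_induced_mono) blast
    moreover have "(x, y) \<in> induced r (A \<union> B)"
      using assms(4-6) by (simp add: induced_def)
    ultimately show ?thesis
      by (rule converse_rtrancl_into_rtrancl[rotated])
  qed
qed (use assms in auto)

lemma rel_component_refl: "x \<in> rel_component r S x"
  by (simp add: rel_component_def)

lemma rel_component_subset:
  assumes "x \<in> S"
  shows "rel_component r S x \<subseteq> S"
proof
  fix y assume "y \<in> rel_component r S x"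
  then have "(x, y) \<in> (induced r S)\<^sup>*"
    by (simp add: rel_component_def)
  then show "y \<in> S"
    using assms by (induction rule: rtrancl_induct) (auto simp: induced_def)
qed

lemma rel_connected_rel_component:
  assumes "symp r"
  shows "rel_connected r (rel_component r S x)"
proof (rule rel_connectedI[OF assms rel_component_refl])
  fix y assume "y \<in> rel_component r S x"
  then have "(x, y) \<in> (induced r S)\<^sup>*"
    by (simp add: rel_component_def)
  then show "(x, y) \<in> (induced r (rel_component r S x))\<^sup>*"
  proof (induction rule: rtrancl_induct)
    case (step y z)
    have "(y, z) \<in> induced r (rel_component r S x)"
      using step(1,2) rtrancl_into_rtrancl[OF step(1,2)] by (simp add: rel_component_def induced_def)
    with step.IH show ?case
      by (rule rtrancl_into_rtrancl)
  qed simp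
qed

lemma subset_rel_component: "\<lbrakk>rel_connected r C; C \<subseteq> S; x \<in> C\<rbrakk> \<Longrightarrow> C \<subseteq> rel_component r S x"
  by (auto simp: rel_connected_def rel_component_def intro: rtrancl_induced_mono)

lemma rel_components_separated:
  assumes "symp r" "x \<in> S" "y \<in> S" "rel_component r S x \<noteq> rel_component r S y"
    and "u \<in> rel_component r S x" "v \<in> rel_component r S y"
  shows "\<not> r u v"
proof
  assume "r u v"
  have "(u, v) \<in> induced r S"
    using \<open>r u v\<close> assms(2,3,5,6) rel_component_subset by (fastforce simp: induced_def)
  then have "(x, y) \<in> (induced r S)\<^sup>*"
    using assms(5,6) rtrancl_induced_sym[OF assms(1), of y v S]
    by (auto simp: rel_component_def intro: rtrancl_into_rtrancl rtrancl_trans)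
  then have "rel_component r S x = rel_component r S y"
    using rtrancl_induced_sym[OF assms(1), of x y S] by (auto simp: rel_component_def intro: rtrancl_trans)
  then show False
    using assms(4) by simp
qed

definition touching :: "('a \<Rightarrow> 'a \<Rightarrow> bool) \<Rightarrow> 'a set \<Rightarrow> 'a set \<Rightarrow> bool" where
  "touching r A B \<longleftrightarrow> (\<exists>x\<in>A. \<exists>y\<in>B. r x y)"

definition bags :: "('a \<Rightarrow> 'a \<Rightarrow> bool) \<Rightarrow> 'a set set \<Rightarrow> bool" where
  "bags r \<B> \<longleftrightarrow> finite \<B> \<and> disjoint \<B> \<and> (\<forall>B\<in>\<B>. rel_connected r B)"

definition bag_pairs :: "('a \<Rightarrow> 'a \<Rightarrow> bool) \<Rightarrow> 'a set set \<Rightarrow> ('a set \<times> 'a set) set" where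
  "bag_pairs r \<B> = {(A, B). A \<in> \<B> \<and> B \<in> \<B> \<and> A \<noteq> B \<and> touching r A B}"

definition bag_nbrs :: "('a \<Rightarrow> 'a \<Rightarrow> bool) \<Rightarrow> 'a set set \<Rightarrow> 'a set \<Rightarrow> 'a set set" where
  "bag_nbrs r \<B> A = {B \<in> \<B>. B \<noteq> A \<and> touching r A B}"

definition contract :: "'a set \<Rightarrow> 'a set \<Rightarrow> 'a set set \<Rightarrow> 'a set set" where
  "contract A B \<B> = insert (A \<union> B) (\<B> - {A, B})"

definition coarsens :: "'a set set \<Rightarrow> 'a set set \<Rightarrow> bool" where
  "coarsens \<M> \<B> \<longleftrightarrow> (\<forall>M\<in>\<M>. M \<subseteq> \<Union>\<B> \<and> (\<exists>B\<in>\<B>. B \<subseteq> M))"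

lemma touching_commute: "symp r \<Longrightarrow> touching r A B \<longleftrightarrow> touching r B A"
  by (auto simp: touching_def symp_def)

lemma coarsens_trans: "\<lbrakk>coarsens \<M> \<C>; coarsens \<C> \<B>\<rbrakk> \<Longrightarrow> coarsens \<M> \<B>"
  unfolding coarsens_def by (meson Union_least order_trans)

lemma coarsens_subset: "\<C> \<subseteq> \<B> \<Longrightarrow> coarsens \<C> \<B>"
  by (auto simp: coarsens_def)

lemma coarsens_contract: "\<lbrakk>A \<in> \<B>; B \<in> \<B>\<rbrakk> \<Longrightarrow> coarsens (contract A B \<B>) \<B>"
  by (auto simp: coarsens_def contract_def)

lemma finite_bag_pairs: "finite \<B> \<Longrightarrow> finite (bag_pairs r \<B>)"
  by (rule finite_subset[of _ "\<B> \<times> \<B>"]) (auto simp: bag_pairs_def)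

lemma bags_ne: "bags r \<B> \<Longrightarrow> B \<in> \<B> \<Longrightarrow> B \<noteq> {}"
  by (auto simp: bags_def rel_connected_def)

lemma bags_disjoint: "bags r \<B> \<Longrightarrow> A \<in> \<B> \<Longrightarrow> B \<in> \<B> \<Longrightarrow> A \<noteq> B \<Longrightarrow> A \<inter> B = {}"
  by (auto simp: bags_def dest: disjointD)

lemma bags_subset: "bags r \<B> \<Longrightarrow> \<C> \<subseteq> \<B> \<Longrightarrow> bags r \<C>"
  by (auto simp: bags_def pairwise_def finite_subset)

lemma Un_not_bag:
  assumes "bags r \<B>" "A \<in> \<B>" "B \<in> \<B>" "A \<noteq> B"
  shows "A \<union> B \<notin> \<B>"
  using bags_disjoint[OF assms(1), of "A \<union> B" A] bags_disjoint[OF assms(1), of "A \<union> B" B]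
    bags_ne[OF assms(1)] assms(2-4) by blast

lemma bags_contract:
  assumes "symp r" "bags r \<B>" "A \<in> \<B>" "B \<in> \<B>" "A \<noteq> B" "touching r A B"
  shows "bags r (contract A B \<B>)" "card (contract A B \<B>) = card \<B> - 1"
proof -
  have fin: "finite \<B>"
    using assms(2) by (simp add: bags_def)
  have "rel_connected r (A \<union> B)"
    using assms by (auto simp: bags_def touching_def intro: rel_connected_Un)
  moreover have "C \<inter> (A \<union> B) = {}" if "C \<in> \<B> - {A, B}" for C
    using that bags_disjoint[OF assms(2), of C A] bags_disjoint[OF assms(2), of C B] assms(3,4) by auto
  ultimately show "bags r (contract A B \<B>)"
    using assms(2) by (auto simp: bags_def contract_def pairwise_insert disjnt_def Int_commute pairwise_def)
  have "card {A, B} \<le> card \<B>"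
    using fin assms(3,4) by (intro card_mono) auto
  moreover have "card (\<B> - {A, B}) = card \<B> - 2"
    using assms(3-5) by (simp add: card_Diff_subset)
  moreover have "card (contract A B \<B>) = Suc (card (\<B> - {A, B}))"
    using Un_not_bag[OF assms(2-5)] fin by (simp add: contract_def)
  ultimately show "card (contract A B \<B>) = card \<B> - 1"
    using assms(5) by simp
qed

lemma card_bag_pairs_le:
  assumes "symp r" "finite \<B>" "A \<noteq> B"
  defines "\<R> \<equiv> \<B> - {A, B}"
  shows "card (bag_pairs r \<B>) \<le> card (bag_pairs r \<R>) + 2 * card (bag_nbrs r \<R> A) + 2 * card (bag_nbrs r \<R> B) + 2"
proof -
  let ?NA = "bag_nbrs r \<R> A" and ?NB = "bag_nbrs r \<R> B"
  let ?X = "{A} \<times> ?NA \<union> ?NA \<times> {A}" and ?Y = "{B} \<times> ?NB \<union> ?NB \<times> {B}"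
  have fin: "finite \<R>" "finite ?NA" "finite ?NB"
    using assms(2) by (auto simp: \<R>_def bag_nbrs_def)
  have "bag_pairs r \<B> \<subseteq> bag_pairs r \<R> \<union> ?X \<union> ?Y \<union> {(A, B), (B, A)}"
  proof (rule subrelI)
    fix X Y assume "(X, Y) \<in> bag_pairs r \<B>"
    then show "(X, Y) \<in> bag_pairs r \<R> \<union> ?X \<union> ?Y \<union> {(A, B), (B, A)}"
      using touching_commute[OF assms(1), of X Y] by (auto simp: bag_pairs_def bag_nbrs_def \<R>_def)
  qed
  then have "card (bag_pairs r \<B>) \<le> card (bag_pairs r \<R> \<union> ?X \<union> ?Y \<union> {(A, B), (B, A)})"
    by (intro card_mono) (use finite_bag_pairs[OF fin(1)] fin in auto)
  also have "\<dots> \<le> card (bag_pairs r \<R>) + (card ({A} \<times> ?NA) + card (?NA \<times> {A}))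
      + (card ({B} \<times> ?NB) + card (?NB \<times> {B})) + card {(A, B), (B, A)}"
    by (intro order_trans[OF card_Un_le] add_mono order_refl)
  also have "card {(A, B), (B, A)} = 2"
    using assms(3) by simp
  finally show ?thesis
    by (simp add: card_cartesian_product)
qed

lemma card_bag_pairs_contract_ge:
  assumes "symp r" "bags r \<B>" "A \<in> \<B>" "B \<in> \<B>" "A \<noteq> B"
  defines "\<R> \<equiv> \<B> - {A, B}"
  shows "card (bag_pairs r \<R>) + 2 * card (bag_nbrs r \<R> A \<union> bag_nbrs r \<R> B) \<le> card (bag_pairs r (contract A B \<B>))"
proof -
  let ?N = "bag_nbrs r \<R> A \<union> bag_nbrs r \<R> B"
  let ?X = "{A \<union> B} \<times> ?N" and ?Y = "?N \<times> {A \<union> B}"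
  have fin: "finite \<R>" "finite ?N"
    using assms(2) by (auto simp: \<R>_def bag_nbrs_def bags_def)
  have new: "A \<union> B \<notin> \<R>"
    using Un_not_bag[OF assms(2-5)] by (simp add: \<R>_def)
  have "touching r D (A \<union> B)" "touching r (A \<union> B) D" if "D \<in> ?N" for D
    using that touching_commute[OF assms(1), of D "A \<union> B"] by (auto simp: bag_nbrs_def touching_def)
  then have "bag_pairs r \<R> \<union> (?X \<union> ?Y) \<subseteq> bag_pairs r (contract A B \<B>)"
    using new by (auto simp: bag_pairs_def contract_def bag_nbrs_def \<R>_def)
  then have "card (bag_pairs r \<R> \<union> (?X \<union> ?Y)) \<le> card (bag_pairs r (contract A B \<B>))"
    using fin by (intro card_mono finite_bag_pairs) (auto simp: contract_def \<R>_def)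
  moreover have "card (?X \<union> ?Y) = card ?X + card ?Y"
    using fin new by (intro card_Un_disjoint) (auto simp: bag_nbrs_def)
  moreover have "card (bag_pairs r \<R> \<union> (?X \<union> ?Y)) = card (bag_pairs r \<R>) + card (?X \<union> ?Y)"
    using fin new by (intro card_Un_disjoint finite_bag_pairs) (auto simp: bag_pairs_def)
  ultimately show ?thesis
    by (simp add: card_cartesian_product)
qed

text \<open>Contracting a pair loses one bag; if the density drops below \<open>2 d\<close>, more than \<open>2 d\<close> pairs were lost, and
  these are accounted for by the pair itself and the common neighbours.\<close>

lemma card_common_bag_nbrs_ge:
  assumes r: "symp r" and \<B>: "bags r \<B>" and AB: "A \<in> \<B>" "B \<in> \<B>" "A \<noteq> B" "touching r A B"
    and dense: "2 * d * card \<B> \<le> card (bag_pairs r \<B>)"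
    and sparse: "card (bag_pairs r (contract A B \<B>)) < 2 * d * card (contract A B \<B>)"
  shows "d \<le> card (bag_nbrs r \<B> A \<inter> bag_nbrs r \<B> B)"
proof -
  let ?\<R> = "\<B> - {A, B}"
  let ?NA = "bag_nbrs r ?\<R> A" and ?NB = "bag_nbrs r ?\<R> B"
  have fin: "finite \<B>" "finite ?NA" "finite ?NB"
    using \<B> by (auto simp: bags_def bag_nbrs_def)
  then have "0 < card \<B>"
    using AB(1) by (auto simp: card_gt_0_iff)
  then have "2 * d * card \<B> = 2 * d * card (contract A B \<B>) + 2 * d"
    using bags_contract(2)[OF r \<B> AB] by (cases "card \<B>") simp_all
  moreover have "card ?NA + card ?NB = card (?NA \<union> ?NB) + card (?NA \<inter> ?NB)"
    by (rule card_Un_Int[OF fin(2,3)])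
  ultimately have "d \<le> card (?NA \<inter> ?NB)"
    using card_bag_pairs_le[OF r fin(1) AB(3)] card_bag_pairs_contract_ge[OF r \<B> AB(1-3)] dense sparse
    by linarith
  also have "?NA \<inter> ?NB = bag_nbrs r \<B> A \<inter> bag_nbrs r \<B> B"
    by (auto simp: bag_nbrs_def)
  finally show ?thesis .
qed

lemma exists_contraction_minimal_bags:
  assumes r: "symp r" and "bags r \<B>" "\<B> \<noteq> {}" "2 * d * card \<B> \<le> card (bag_pairs r \<B>)"
  obtains \<C> where "bags r \<C>" "\<C> \<noteq> {}" "coarsens \<C> \<B>" "2 * d * card \<C> \<le> card (bag_pairs r \<C>)"
    "\<And>A B. \<lbrakk>A \<in> \<C>; B \<in> bag_nbrs r \<C> A\<rbrakk> \<Longrightarrow> d \<le> card (bag_nbrs r \<C> A \<inter> bag_nbrs r \<C> B)"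
proof -
  define dense where "dense \<C> \<longleftrightarrow> bags r \<C> \<and> \<C> \<noteq> {} \<and> coarsens \<C> \<B> \<and> 2 * d * card \<C> \<le> card (bag_pairs r \<C>)" for \<C>
  have "dense \<B>"
    using assms by (simp add: dense_def coarsens_subset)
  then obtain \<C> where \<C>: "dense \<C>" and min: "\<And>\<D>. dense \<D> \<Longrightarrow> card \<C> \<le> card \<D>"
    using ex_has_least_nat[of dense \<B> card] by blast
  have "d \<le> card (bag_nbrs r \<C> A \<inter> bag_nbrs r \<C> B)" if A: "A \<in> \<C>" and B: "B \<in> bag_nbrs r \<C> A" for A B
  proof -
    have AB: "B \<in> \<C>" "A \<noteq> B" "touching r A B"
      using B by (auto simp: bag_nbrs_def)
    note contr = bags_contract[OF r _ A AB]
    have "0 < card \<C>"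
      using A \<C> by (auto simp: dense_def bags_def card_gt_0_iff)
    then have "\<not> dense (contract A B \<C>)"
      using min[of "contract A B \<C>"] contr(2) \<C> by (fastforce simp: dense_def)
    moreover have "coarsens (contract A B \<C>) \<B>"
      using \<C> coarsens_trans[OF coarsens_contract[OF A AB(1)]] by (simp add: dense_def)
    ultimately have "card (bag_pairs r (contract A B \<C>)) < 2 * d * card (contract A B \<C>)"
      using \<C> contr(1) by (auto simp: dense_def contract_def)
    then show ?thesis
      using \<C> by (intro card_common_bag_nbrs_ge[OF r _ A AB]) (auto simp: dense_def)
  qed
  then show thesis
    using \<C> that[of \<C>] by (simp add: dense_def)
qed

theorem complete_minor:
  assumes r: "symp r" and "bags r \<B>" "\<B> \<noteq> {}" "2 ^ t * card \<B> \<le> card (bag_pairs r \<B>)"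
  shows "\<exists>\<M>. bags r \<M> \<and> card \<M> = Suc t \<and> coarsens \<M> \<B> \<and> (\<forall>A\<in>\<M>. \<forall>B\<in>\<M>. A \<noteq> B \<longrightarrow> touching r A B)"
  using assms(2-)
proof (induction t arbitrary: \<B>)
  case 0
  then obtain B where "B \<in> \<B>"
    by blast
  then show ?case
    using bags_subset[OF 0(1), of "{B}"] by (intro exI[of _ "{B}"]) (auto simp: coarsens_subset)
next
  case (Suc t)
  obtain \<C> where \<C>: "bags r \<C>" "\<C> \<noteq> {}" "coarsens \<C> \<B>" "2 * 2 ^ t * card \<C> \<le> card (bag_pairs r \<C>)"
    and common: "\<And>A B. \<lbrakk>A \<in> \<C>; B \<in> bag_nbrs r \<C> A\<rbrakk> \<Longrightarrow> 2 ^ t \<le> card (bag_nbrs r \<C> A \<inter> bag_nbrs r \<C> B)"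
    using exists_contraction_minimal_bags[OF r Suc.prems(1,2), of "2 ^ t"] Suc.prems(3) by (metis power_Suc)
  have "0 < card \<C>"
    using \<C>(1,2) by (simp add: card_gt_0_iff bags_def)
  then have "bag_pairs r \<C> \<noteq> {}"
    using \<C>(4) by force
  then obtain B where B: "B \<in> \<C>" "bag_nbrs r \<C> B \<noteq> {}"
    by (auto simp: bag_pairs_def bag_nbrs_def)
  let ?N = "bag_nbrs r \<C> B"
  have N: "?N \<subseteq> \<C>" "finite ?N" "bags r ?N"
    using \<C>(1) bags_subset[OF \<C>(1), of ?N] by (auto simp: bag_nbrs_def bags_def)
  have "2 ^ t * card ?N \<le> (\<Sum>D\<in>?N. card (?N \<inter> bag_nbrs r \<C> D))"
    using sum_bounded_below[of ?N "2 ^ t" "\<lambda>D. card (?N \<inter> bag_nbrs r \<C> D)"] common[OF B(1)]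
    by (simp add: mult.commute)
  also have "\<dots> = card (SIGMA D:?N. ?N \<inter> bag_nbrs r \<C> D)"
    using N(2) by (simp add: card_SigmaI)
  also have "\<dots> \<le> card (bag_pairs r ?N)"
    using finite_bag_pairs[OF N(2)] by (intro card_mono) (auto simp: bag_pairs_def bag_nbrs_def)
  finally obtain \<M> where \<M>: "bags r \<M>" "card \<M> = Suc t" "coarsens \<M> ?N"
      "\<And>A A'. \<lbrakk>A \<in> \<M>; A' \<in> \<M>; A \<noteq> A'\<rbrakk> \<Longrightarrow> touching r A A'"
    using Suc.IH[OF N(3) B(2)] by metis
  have disj: "M \<inter> B = {}" if "M \<in> \<M>" for M
    using \<M>(3) that bags_disjoint[OF \<C>(1) B(1)] by (fastforce simp: coarsens_def bag_nbrs_def)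
  have touch: "touching r B M \<and> touching r M B" if "M \<in> \<M>" for M
    using \<M>(3) that touching_commute[OF r, of M B] by (fastforce simp: coarsens_def bag_nbrs_def touching_def)
  have "B \<notin> \<M>"
    using disj[of B] bags_ne[OF \<C>(1) B(1)] by auto
  then have "bags r (insert B \<M>)" "card (insert B \<M>) = Suc (Suc t)"
    using \<M>(1,2) \<C>(1) B(1) disj by (auto simp: bags_def pairwise_insert disjnt_def Int_commute)
  moreover have "coarsens \<M> \<B>" "coarsens {B} \<B>"
    using \<M>(3) N(1) B(1) \<C>(3) by (blast intro: coarsens_trans coarsens_subset)+
  then have "coarsens (insert B \<M>) \<B>"
    by (simp add: coarsens_def)
  ultimately show ?case
    using \<M>(4) touch by (intro exI[of _ "insert B \<M>"]) auto
qed

section \<open>Plane graphs are sparse\<close>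

lemma path_component_along_rtrancl:
  assumes "(x, y) \<in> (induced r S)\<^sup>*" "x \<in> S" "p \<in> R x" "q \<in> R y"
    and "\<And>x. x \<in> S \<Longrightarrow> R x \<noteq> {}"
    and "\<And>x y p q. \<lbrakk>x \<in> S; y \<in> S; x = y \<or> r x y; p \<in> R x; q \<in> R y\<rbrakk> \<Longrightarrow> path_component T p q"
  shows "path_component T p q"
  using assms(1,4)
proof (induction arbitrary: q)
  case base
  then show ?case
    using assms(2,3,6) by blast
next
  case (step y z)
  have yz: "y \<in> S" "z \<in> S" "r y z"
    using step.hyps(2) by (auto simp: induced_def)
  then obtain q' where q': "q' \<in> R y"
    using assms(5) by blast
  then have "path_component T q' q"
    using assms(6) yz step.prems by blast
  with step.IH[OF q'] show ?case
    by (rule path_component_trans)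
qed

lemma path_connected_UN_links:
  fixes R :: "'a \<Rightarrow> 'b::topological_space set"
  assumes S: "rel_connected r S" and R: "\<And>x. x \<in> S \<Longrightarrow> path_connected (R x) \<and> R x \<noteq> {}"
    and J: "\<And>x y. \<lbrakk>x \<in> S; y \<in> S; r x y\<rbrakk> \<Longrightarrow> path_connected (R x \<union> J x y \<union> R y)"
  shows "path_connected ((\<Union>x\<in>S. R x) \<union> (\<Union>x\<in>S. \<Union>y\<in>{y \<in> S. r x y}. J x y))" (is "path_connected ?T")
proof -
  have within: "path_component ?T p q" if "A \<subseteq> ?T" "path_connected A" "p \<in> A" "q \<in> A" for A p q
    using that by (meson path_component_of_subset path_connected_component)
  have link: "path_component ?T p q"
    if "x \<in> S" "y \<in> S" "r x y" "p \<in> R x \<union> J x y \<union> R y" "q \<in> R x \<union> J x y \<union> R y" for x y p q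
    using J[OF that(1-3)] that by (intro within[of "R x \<union> J x y \<union> R y"]) auto
  have region: "path_component ?T p q" if "x \<in> S" "p \<in> R x" "q \<in> R x" for x p q
    using R that by (intro within[of "R x"]) auto
  have anchor: "\<exists>x\<in>S. \<exists>p'\<in>R x. path_component ?T p p'" if p: "p \<in> ?T" for p
  proof -
    consider (in_region) x where "x \<in> S" "p \<in> R x" | (in_link) x y where "x \<in> S" "y \<in> S" "r x y" "p \<in> J x y"
      using p by blast
    then show ?thesis
    proof cases
      case in_region
      with region[OF in_region in_region(2)] show ?thesis
        by blast
    next
      case in_link
      obtain p' where p': "p' \<in> R x"
        using R in_link(1) by blast
      have "path_component ?T p p'"
        using in_link p' by (intro link[of x y]) auto
      with in_link(1) p' show ?thesis
        by blast
    qed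
  qed
  show ?thesis
    unfolding path_connected_component
  proof (intro ballI)
    fix p q assume "p \<in> ?T" "q \<in> ?T"
    obtain x p' where x: "x \<in> S" "p' \<in> R x" "path_component ?T p p'"
      using anchor[OF \<open>p \<in> ?T\<close>] by (elim bexE)
    obtain y q' where y: "y \<in> S" "q' \<in> R y" "path_component ?T q q'"
      using anchor[OF \<open>q \<in> ?T\<close>] by (elim bexE)
    have "path_component ?T p' q'"
      by (rule path_component_along_rtrancl[where R = R and S = S and r = r])
        (use S R x y link region in \<open>auto simp: rel_connected_def\<close>)
    then show "path_component ?T p q"
      by (rule path_component_trans[OF x(3) path_component_trans[OF _ path_component_sym[OF y(3)]]])
  qed
qed

corollary path_connected_UN_meeting:
  fixes R :: "'a \<Rightarrow> 'b::topological_space set"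
  assumes "rel_connected r S" "\<And>x. x \<in> S \<Longrightarrow> path_connected (R x) \<and> R x \<noteq> {}"
    and "\<And>x y. \<lbrakk>x \<in> S; y \<in> S; r x y\<rbrakk> \<Longrightarrow> R x \<inter> R y \<noteq> {}"
  shows "path_connected (\<Union>x\<in>S. R x)"
proof -
  have "path_connected (R x \<union> {} \<union> R y)" if "x \<in> S" "y \<in> S" "r x y" for x y
    using assms(2,3) that by (simp add: path_connected_Un)
  then show ?thesis
    using path_connected_UN_links[OF assms(1,2), where J = "\<lambda>_ _. {}"] by simp
qed

locale plane_realization =
  fixes W :: "'a set" and r :: "'a \<Rightarrow> 'a \<Rightarrow> bool" and R :: "'a \<Rightarrow> complex set" and J :: "'a \<Rightarrow> 'a \<Rightarrow> complex set"
  assumes finite_W: "finite W" and r_sym: "symp r" and r_within: "r x y \<Longrightarrow> x \<in> W \<and> y \<in> W \<and> x \<noteq> y"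
    and region: "x \<in> W \<Longrightarrow> path_connected (R x) \<and> R x \<noteq> {}"
    and regions_disjoint: "\<lbrakk>x \<in> W; y \<in> W; x \<noteq> y\<rbrakk> \<Longrightarrow> R x \<inter> R y = {}"
    and link: "r x y \<Longrightarrow> path_connected (R x \<union> J x y \<union> R y)"
    and link_region_disjoint: "\<lbrakk>r x y; z \<in> W\<rbrakk> \<Longrightarrow> J x y \<inter> R z = {}"
    and links_disjoint: "\<lbrakk>r x y; r x' y'; {x, y} \<noteq> {x', y'}\<rbrakk> \<Longrightarrow> J x y \<inter> J x' y' = {}"
begin

definition drawing :: "'a set \<Rightarrow> complex set" where
  "drawing B = (\<Union>x\<in>B. R x) \<union> (\<Union>x\<in>B. \<Union>y\<in>{y \<in> B. r x y}. J x y)"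

lemma drawing_mono: "A \<subseteq> B \<Longrightarrow> drawing A \<subseteq> drawing B"
  unfolding drawing_def by blast

lemma path_connected_drawing: "B \<subseteq> W \<Longrightarrow> rel_connected r B \<Longrightarrow> path_connected (drawing B)"
  unfolding drawing_def using region link by (intro path_connected_UN_links) auto

lemma drawing_ne: "B \<subseteq> W \<Longrightarrow> B \<noteq> {} \<Longrightarrow> drawing B \<noteq> {}"
  using region by (fastforce simp: drawing_def)

lemma drawing_disjoint:
  assumes "A \<subseteq> W" "B \<subseteq> W" "A \<inter> B = {}"
  shows "drawing A \<inter> drawing B = {}"
proof -
  have "R x \<inter> R y = {}" if "x \<in> A" "y \<in> B" for x y
    using that regions_disjoint assms by blast
  moreover have "J x y \<inter> R z = {}" if "r x y" "z \<in> A \<union> B" for x y z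
    using that link_region_disjoint assms(1,2) by blast
  moreover have "J x y \<inter> J x' y' = {}" if "x \<in> A" "r x y" "x' \<in> B" "y' \<in> B" "r x' y'" for x y x' y'
    using that assms(3) by (intro links_disjoint) auto
  ultimately show ?thesis
    unfolding drawing_def by blast
qed

lemma card_touching_bags_le:
  assumes \<M>: "bags r \<M>" "\<Union>\<M> \<subseteq> W" and touch: "\<And>A B. \<lbrakk>A \<in> \<M>; B \<in> \<M>; A \<noteq> B\<rbrakk> \<Longrightarrow> touching r A B"
  shows "card \<M> \<le> 5"
proof (rule ccontr)
  assume "\<not> ?thesis"
  then have "card {..<6::nat} \<le> card \<M>"
    by simp
  then obtain f where f: "f ` {..<6::nat} \<subseteq> \<M>" "inj_on f {..<6}"
    using card_le_inj[of "{..<6::nat}" \<M>] \<M>(1) by (auto simp: bags_def)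
  have mem: "f i \<in> \<M>" "f i \<subseteq> W" "f i \<noteq> {}" "rel_connected r (f i)" if "i < 6" for i
    using f(1) that \<M> bags_ne[OF \<M>(1)] by (auto simp: bags_def)
  have neq: "f i \<noteq> f j" if "i < 6" "j < 6" "i \<noteq> j" for i j
    using that f(2) by (auto dest: inj_onD)
  define a where "a i = (SOME p. p \<in> drawing (f i))" for i
  have a: "a i \<in> drawing (f i)" if "i < 6" for i
    unfolding a_def using drawing_ne mem[OF that] by (simp add: some_in_eq)
  define Z where "Z i j = drawing (f i \<union> f (3 + j))" for i j
  have "\<exists>g. path g \<and> path_image g \<subseteq> Z i j \<and> pathstart g = a i \<and> pathfinish g = a (3 + j)"
    if ij: "i < 3" "j < 3" for i j
  proof -
    have "touching r (f i) (f (3 + j))"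
      using touch mem neq ij by simp
    then have "rel_connected r (f i \<union> f (3 + j))"
      using mem ij r_sym by (auto simp: touching_def intro: rel_connected_Un)
    then have "path_connected (Z i j)"
      unfolding Z_def using mem ij by (intro path_connected_drawing) auto
    moreover have "a i \<in> Z i j" "a (3 + j) \<in> Z i j"
      using a[of i] a[of "3 + j"] drawing_mono[of "f i" "f i \<union> f (3 + j)"]
        drawing_mono[of "f (3 + j)" "f i \<union> f (3 + j)"] ij
      by (auto simp: Z_def)
    ultimately show ?thesis
      by (simp add: path_connected_def)
  qed
  then obtain g where g: "\<And>i j. \<lbrakk>i < 3; j < 3\<rbrakk> \<Longrightarrow>
      path (g i j) \<and> path_image (g i j) \<subseteq> Z i j \<and> pathstart (g i j) = a i \<and> pathfinish (g i j) = a (3 + j)"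
    by metis
  then have "\<exists>i j k l. ((i, j), (k, l)) \<in> independent_pairs \<and> path_image (g i j) \<inter> path_image (g k l) \<noteq> {}"
    by (intro K33_paths_meet[where a = a and b = "\<lambda>j. a (3 + j)"]) blast
  then obtain i j k l where ijkl: "((i, j), (k, l)) \<in> independent_pairs"
    "path_image (g i j) \<inter> path_image (g k l) \<noteq> {}"
    by blast
  then have bounds: "i < 3" "j < 3" "k < 3" "l < 3" "i \<noteq> k" "j \<noteq> l"
    by (auto simp: independent_pairs_def)
  then have "(f i \<union> f (3 + j)) \<inter> (f k \<union> f (3 + l)) = {}"
    using bags_disjoint[OF \<M>(1) mem(1) mem(1) neq] by (auto simp: Int_Un_distrib Int_Un_distrib2)
  then have "Z i j \<inter> Z k l = {}"
    unfolding Z_def using mem bounds by (intro drawing_disjoint) auto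
  then show False
    using ijkl(2) g[of i j] g[of k l] bounds by blast
qed

theorem card_adjacent_pairs_le: "card {(x, y). r x y} \<le> 32 * card W"
proof (rule ccontr)
  assume "\<not> ?thesis"
  then have many: "2 ^ 5 * card W \<le> card {(x, y). r x y}" and ne: "{(x, y). r x y} \<noteq> {}"
    by force+
  let ?B = "(\<lambda>x. {x}) ` W"
  have "W \<noteq> {}"
    using ne r_within by auto
  moreover have "bags r ?B"
    using finite_W by (auto simp: bags_def rel_connected_singleton pairwise_def disjnt_def)
  moreover have "bag_pairs r ?B = (\<lambda>(x, y). ({x}, {y})) ` {(x, y). r x y}"
    using r_within by (auto simp: bag_pairs_def touching_def)
  then have "card (bag_pairs r ?B) = card {(x, y). r x y}"
    by (simp only:) (rule card_image, auto simp: inj_on_def)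
  moreover have "card ?B = card W"
    by (intro card_image) (auto simp: inj_on_def)
  ultimately obtain \<M> where "bags r \<M>" "card \<M> = Suc 5" "coarsens \<M> ?B"
      "\<And>A B. \<lbrakk>A \<in> \<M>; B \<in> \<M>; A \<noteq> B\<rbrakk> \<Longrightarrow> touching r A B"
    using complete_minor[OF r_sym, of ?B 5] many by auto
  then show False
    using card_touching_bags_le[of \<M>] by (auto simp: coarsens_def)
qed

end

lemma card_plane_incidences_le:
  fixes V :: "complex set" and Q :: "'p \<Rightarrow> complex set" and inc :: "complex \<Rightarrow> 'p \<Rightarrow> bool"
  assumes fin: "finite V" "finite P"
    and Q: "\<And>p. p \<in> P \<Longrightarrow> path_connected (Q p) \<and> Q p \<noteq> {} \<and> Q p \<inter> V = {}"
    and disj: "\<And>p p'. \<lbrakk>p \<in> P; p' \<in> P; p \<noteq> p'\<rbrakk> \<Longrightarrow> Q p \<inter> Q p' = {}"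
    and inc: "\<And>v p. \<lbrakk>v \<in> V; p \<in> P; inc v p\<rbrakk> \<Longrightarrow> path_connected (insert v (Q p))"
  shows "card {(v, p). v \<in> V \<and> p \<in> P \<and> inc v p} \<le> 16 * (card V + card P)"
proof -
  define r where "r x y = (case (x, y) of (Inl v, Inr p) \<Rightarrow> v \<in> V \<and> p \<in> P \<and> inc v p
      | (Inr p, Inl v) \<Rightarrow> v \<in> V \<and> p \<in> P \<and> inc v p | _ \<Rightarrow> False)" for x y
  define R where "R x = (case x of Inl v \<Rightarrow> {v} | Inr p \<Rightarrow> Q p)" for x
  let ?W = "V <+> P" and ?I = "{(v, p). v \<in> V \<and> p \<in> P \<and> inc v p}"
  let ?A = "(\<lambda>(v, p). (Inl v, Inr p)) ` ?I :: ((complex + 'p) \<times> (complex + 'p)) set"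
    and ?B = "(\<lambda>(v, p). (Inr p, Inl v)) ` ?I :: ((complex + 'p) \<times> (complex + 'p)) set"
  interpret plane_realization ?W r R "\<lambda>_ _. {}"
  proof
    show "finite ?W" "symp r"
      using fin by (auto simp: symp_def r_def split: sum.splits)
    show "x \<in> ?W \<and> y \<in> ?W \<and> x \<noteq> y" "path_connected (R x \<union> {} \<union> R y)" if "r x y" for x y
      using that inc by (auto simp: r_def R_def split: sum.splits)
    show "path_connected (R x) \<and> R x \<noteq> {}" if "x \<in> ?W" for x
      using that Q by (auto simp: R_def)
    show "R x \<inter> R y = {}" if "x \<in> ?W" "y \<in> ?W" "x \<noteq> y" for x y
      using that Q disj by (fastforce simp: R_def)
  qed auto
  have "finite ?I"
    by (rule finite_subset[of _ "V \<times> P"]) (use fin in auto)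
  then have "card (?A \<union> ?B) = card ?A + card ?B"
    by (intro card_Un_disjoint) auto
  also have "\<dots> = 2 * card ?I"
    by (subst (1 2) card_image) (auto simp: inj_on_def)
  also have "?A \<union> ?B = {(x, y). r x y}"
  proof (rule set_eqI, clarify)
    show "(x, y) \<in> ?A \<union> ?B \<longleftrightarrow> (x, y) \<in> {(x, y). r x y}" for x y
      by (cases x; cases y) (auto simp: r_def image_iff)
  qed
  finally have "2 * card ?I = card {(x, y). r x y}"
    by (rule sym)
  also have "\<dots> \<le> 32 * (card V + card P)"
    using card_adjacent_pairs_le fin by (simp add: card_Plus)
  finally show ?thesis
    by simp
qed

lemma card_doubleton_pairs:
  assumes "finite F" "\<And>e. e \<in> F \<Longrightarrow> card e = 2"
  shows "card {(x, y). {x, y} \<in> F} = 2 * card F"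
proof -
  have pairs: "finite {(x, y). {x, y} = e} \<and> card {(x, y). {x, y} = e} = 2" if e: "e \<in> F" for e
  proof -
    obtain u v where uv: "e = {u, v}" "u \<noteq> v"
      using assms(2)[OF e] by (auto simp: card_2_iff)
    then have "{(x, y). {x, y} = e} = {(u, v), (v, u)}"
      by (auto simp: doubleton_eq_iff)
    then show ?thesis
      using uv by simp
  qed
  have "{(x, y). {x, y} \<in> F} = (\<Union>e\<in>F. {(x, y). {x, y} = e})"
    by auto
  also have "card \<dots> = (\<Sum>e\<in>F. card {(x, y). {x, y} = e})"
    using assms(1) pairs by (intro card_UN_disjoint) auto
  finally show ?thesis
    using pairs by simp
qed

context simple_tg
begin

abbreviation inner :: "complex set \<Rightarrow> complex set" where "inner \<equiv> edge_interior curve"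

lemma inner_eq: "e \<in> E \<Longrightarrow> inner e = img e - V"
  using edgeD(1,5)[of e] by (auto simp: edge_interior_def)

lemma inner_eq_image:
  assumes "e \<in> E"
  shows "inner e = curve e ` {0<..<1}"
proof -
  have ends: "{curve e 0, curve e 1} = e"
    using edgeD(4)[OF assms] by (simp add: pathstart_def pathfinish_def)
  have "inner e = curve e ` {0..1} - curve e ` {0, 1}"
    by (simp add: edge_interior_def path_image_def ends)
  also have "\<dots> = curve e ` ({0..1} - {0, 1})"
    using edgeD(3)[OF assms] by (intro inj_on_image_set_diff[symmetric]) (auto simp: arc_def)
  also have "{0..1} - {0, 1} = {0<..<1::real}"
    by auto
  finally show ?thesis .
qed

lemma inner_ne: "e \<in> E \<Longrightarrow> inner e \<noteq> {}"
  by (simp add: inner_eq_image)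

lemma path_connected_insert_inner:
  assumes e: "e \<in> E" and z: "z \<in> img e"
  shows "path_connected (insert z (inner e))"
proof -
  have cont: "continuous_on {0..1} (curve e)"
    using edgeD(3)[OF e] by (simp add: arc_def path_def)
  obtain t where t: "t \<in> {0..1}" "z = curve e t"
    using z by (auto simp: path_image_def)
  have "is_interval (insert t {0<..<1})"
    using t(1) by (auto simp: is_interval_1)
  then have "path_connected (curve e ` insert t {0<..<1})"
    using t(1) by (intro path_connected_continuous_image continuous_on_subset[OF cont])
      (auto simp: is_interval_path_connected_1)
  then show ?thesis
    by (simp add: inner_eq_image[OF e] t(2))
qed

lemma path_connected_inner:
  assumes "e \<in> E"
  shows "path_connected (inner e)"
proof -
  obtain z where "z \<in> inner e"
    using inner_ne[OF assms] by blast
  then show ?thesis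
    using path_connected_insert_inner[OF assms, of z] by (simp add: edge_interior_def insert_absorb)
qed

lemma crossing_refl: "e \<in> E \<Longrightarrow> crossing e e"
  using inner_ne by (simp add: edges_cross_def)

lemma symp_crossing: "symp crossing"
  using crossing_sym by (blast intro: sympI)

lemma path_connected_piece:
  assumes "P \<subseteq> E" "rel_connected crossing P"
  shows "path_connected (\<Union>e\<in>P. inner e)" "path_connected (\<Union>e\<in>P. img e)"
proof -
  show "path_connected (\<Union>e\<in>P. inner e)"
    using assms path_connected_inner inner_ne
    by (intro path_connected_UN_meeting[OF assms(2)]) (auto simp: edges_cross_def)
  have "img e \<inter> img f \<noteq> {}" if "crossing e f" for e f
    using that by (auto simp: edges_cross_def edge_interior_def)
  then show "path_connected (\<Union>e\<in>P. img e)"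
    using assms(1) edgeD(3)
    by (intro path_connected_UN_meeting[OF assms(2)]) (auto intro!: path_connected_path_image arc_imp_path)
qed

lemma path_connected_insert_piece:
  assumes "P \<subseteq> E" "rel_connected crossing P" "e \<in> P" "z \<in> img e"
  shows "path_connected (insert z (\<Union>e\<in>P. inner e))"
proof -
  have "e \<in> E"
    using assms(1,3) by blast
  then have "path_connected (insert z (inner e) \<union> (\<Union>e\<in>P. inner e))"
    using assms(3,4) inner_ne
    by (intro path_connected_Un path_connected_insert_inner path_connected_piece(1)[OF assms(1,2)]) auto
  moreover have "insert z (inner e) \<union> (\<Union>e\<in>P. inner e) = insert z (\<Union>e\<in>P. inner e)"
    using assms(3) by blast
  ultimately show ?thesis
    by simp
qed

lemma card_noncrossing_le:
  assumes F: "F \<subseteq> E" and noncrossing: "\<And>e f. \<lbrakk>e \<in> F; f \<in> F; e \<noteq> f\<rbrakk> \<Longrightarrow> \<not> crossing e f"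
  shows "card F \<le> 16 * card V"
proof -
  interpret plane_realization V "\<lambda>x y. {x, y} \<in> F" "\<lambda>x. {x}" "\<lambda>x y. inner {x, y}"
  proof
    show "finite V" "symp (\<lambda>x y. {x, y} \<in> F)"
      using finite_V by (auto simp: symp_def insert_commute)
    fix x y assume xy: "{x, y} \<in> F"
    then have E: "{x, y} \<in> E"
      using F by blast
    then show "x \<in> V \<and> y \<in> V \<and> x \<noteq> y"
      using edgeD(1,2)[OF E] by auto
    have "path_connected (insert x (inner {x, y}) \<union> insert y (inner {x, y}))"
      using edgeD(5)[OF E] inner_ne[OF E] by (intro path_connected_Un path_connected_insert_inner[OF E]) auto
    then show "path_connected ({x} \<union> inner {x, y} \<union> {y})"
      by (simp add: insert_commute)
    show "inner {x, y} \<inter> {z} = {}" if "z \<in> V" for z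
      using that by (auto simp: inner_eq[OF E])
    show "inner {x, y} \<inter> inner {x', y'} = {}" if "{x', y'} \<in> F" "{x, y} \<noteq> {x', y'}" for x' y'
      using that xy noncrossing by (auto simp: edges_cross_def)
  qed auto
  show ?thesis
    using card_adjacent_pairs_le card_doubleton_pairs[of F] F finite_E finite_subset edgeD(2) by fastforce
qed

lemma card_separated_pieces_le:
  assumes within: "\<And>P. P \<in> \<P> \<Longrightarrow> P \<subseteq> E \<and> P \<noteq> {}"
    and separated: "\<And>P Q e f. \<lbrakk>P \<in> \<P>; Q \<in> \<P>; P \<noteq> Q; e \<in> P; f \<in> Q\<rbrakk> \<Longrightarrow> \<not> crossing e f"
  shows "card \<P> \<le> 16 * card V"
proof -
  obtain pick where pick: "\<And>P. P \<in> \<P> \<Longrightarrow> pick P \<in> P"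
    using within by (metis all_not_in_conv)
  have not_crossing_pick: "\<not> crossing (pick P) (pick Q)" if "P \<in> \<P>" "Q \<in> \<P>" "P \<noteq> Q" for P Q
    using that pick separated by blast
  have pick_in_E: "pick P \<in> E" if "P \<in> \<P>" for P
    using that pick within by blast
  have "inj_on pick \<P>"
    using not_crossing_pick crossing_refl pick_in_E by (metis inj_onI)
  moreover have "card (pick ` \<P>) \<le> 16 * card V"
    using not_crossing_pick pick_in_E by (intro card_noncrossing_le) auto
  ultimately show ?thesis
    by (simp add: card_image)
qed

lemma sum_card_vertices_pieces_le:
  assumes finite_pieces: "finite \<P>" and within: "\<And>P. P \<in> \<P> \<Longrightarrow> P \<subseteq> E" and connected_pieces: "\<And>P. P \<in> \<P> \<Longrightarrow> rel_connected crossing P"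
    and separated: "\<And>P Q e f. \<lbrakk>P \<in> \<P>; Q \<in> \<P>; P \<noteq> Q; e \<in> P; f \<in> Q\<rbrakk> \<Longrightarrow> \<not> crossing e f"
  shows "(\<Sum>P\<in>\<P>. card (\<Union>P)) \<le> 272 * card V"
proof -
  let ?Q = "\<lambda>P. \<Union>e\<in>P. inner e"
  have nonempty: "P \<noteq> {}" if "P \<in> \<P>" for P
    using connected_pieces[OF that] by (simp add: rel_connected_def)
  have in_V: "\<Union>P \<subseteq> V" if "P \<in> \<P>" for P
    using within[OF that] edgeD(1) by blast
  have "card {(v, P). v \<in> V \<and> P \<in> \<P> \<and> v \<in> \<Union>P} \<le> 16 * (card V + card \<P>)"
  proof (rule card_plane_incidences_le[where Q = ?Q])
    fix P assume P: "P \<in> \<P>"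
    have connected_inner: "path_connected (?Q P)"
      by (rule path_connected_piece(1)[OF within[OF P] connected_pieces[OF P]])
    obtain e where "e \<in> P" "e \<in> E"
      using nonempty[OF P] within[OF P] by blast
    then have "?Q P \<noteq> {}"
      using inner_ne by blast
    moreover have "?Q P \<inter> V = {}"
      using within[OF P] by (auto simp: inner_eq)
    ultimately show "path_connected (?Q P) \<and> ?Q P \<noteq> {} \<and> ?Q P \<inter> V = {}"
      using connected_inner by simp
    show "?Q P \<inter> ?Q P' = {}" if "P' \<in> \<P>" "P \<noteq> P'" for P'
      using separated[OF P that] by (auto simp: edges_cross_def)
    show "path_connected (insert v (?Q P))" if "v \<in> \<Union>P" for v
    proof -
      obtain e where e: "e \<in> P" "v \<in> e"
        using \<open>v \<in> \<Union>P\<close> by blast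
      then have "v \<in> img e"
        using within[OF P] edgeD(5)[of e] by blast
      then show ?thesis
        by (rule path_connected_insert_piece[OF within[OF P] connected_pieces[OF P] e(1)])
    qed
  qed (use finite_pieces finite_V in auto)
  also have "{(v, P). v \<in> V \<and> P \<in> \<P> \<and> v \<in> \<Union>P} = prod.swap ` (SIGMA P:\<P>. \<Union>P)"
    by (auto simp: image_iff) (use in_V in blast)
  also have "card \<dots> = (\<Sum>P\<in>\<P>. card (\<Union>P))"
    using finite_pieces finite_subset[OF in_V finite_V] by (subst card_image) (auto intro: card_SigmaI)
  finally have "(\<Sum>P\<in>\<P>. card (\<Union>P)) \<le> 16 * (card V + card \<P>)" .
  moreover have "card \<P> \<le> 16 * card V"
    using within nonempty separated by (intro card_separated_pieces_le) blast+
  ultimately show ?thesis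
    by simp
qed

end

section \<open>Intersecting families of connected sets in the plane\<close>

lemma sum_cells_eq_boundary:
  fixes hor ver :: "nat \<Rightarrow> nat \<Rightarrow> 'a::ab_group_add"
  shows "(\<Sum>j<N. \<Sum>i<N. hor i j + ver (Suc i) j - hor i (Suc j) - ver i j)
    = (\<Sum>i<N. hor i 0) - (\<Sum>i<N. hor i N) + (\<Sum>j<N. ver N j) - (\<Sum>j<N. ver 0 j)"
proof -
  have row: "(\<Sum>i<N. hor i j + ver (Suc i) j - hor i (Suc j) - ver i j)
      = ((\<Sum>i<N. hor i j) - (\<Sum>i<N. hor i (Suc j))) + (ver N j - ver 0 j)" for j
    using sum_lessThan_telescope[of "\<lambda>i. ver i j" N] by (simp add: sum.distrib sum_subtractf algebra_simps)
  show ?thesis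
    unfolding row sum.distrib sum_lessThan_telescope'[of "\<lambda>j. \<Sum>i<N. hor i j"] sum_subtractf[of "ver N"]
    by (simp add: algebra_simps)
qed

lemma winding_number_linepath_subdivide:
  fixes a d :: complex
  assumes "y \<notin> closed_segment a (a + of_nat n * d)"
  shows "(\<Sum>i<n. winding_number (linepath (a + of_nat i * d) (a + of_nat (Suc i) * d)) y)
     = winding_number (linepath a (a + of_nat n * d)) y"
  using assms
proof (induction n)
  case 0
  then have "winding_number (linepath a a) y = 0"
    by (intro winding_number_trivial) auto
  then show ?case
    by (simp only: lessThan_0 sum.empty of_nat_0 mult_zero_left add_0_right)
next
  case (Suc n)
  have "a + of_nat n * d = (1 - real n / real (Suc n)) *\<^sub>R a
      + (real n / real (Suc n)) *\<^sub>R (a + of_nat (Suc n) * d)"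
    by (simp add: scaleR_conv_of_real field_simps del: of_nat_Suc)
  then have mem: "a + of_nat n * d \<in> closed_segment a (a + of_nat (Suc n) * d)"
    unfolding in_segment by (intro exI[of _ "real n / real (Suc n)"]) auto
  then have "y \<notin> closed_segment a (a + of_nat n * d)"
    using Suc.prems subset_closed_segment[of a "a + of_nat n * d" a "a + of_nat (Suc n) * d"] by auto
  from Suc.IH[OF this] show ?case
    using winding_number_split_linepath[OF mem Suc.prems] by (simp del: of_nat_Suc)
qed

lemma winding_number_reverse_linepath:
  "y \<notin> closed_segment a b \<Longrightarrow> winding_number (linepath b a) y = - winding_number (linepath a b) y"
  using winding_number_reversepath[of "linepath a b" y] by simp

lemma winding_number_quadrilateral:
  assumes "y \<notin> closed_segment a b" "y \<notin> closed_segment b c" "y \<notin> closed_segment c d" "y \<notin> closed_segment d a"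
  shows "winding_number (linepath a b +++ linepath b c +++ linepath c d +++ linepath d a) y
    = winding_number (linepath a b) y - winding_number (linepath d c) y
      + winding_number (linepath b c) y - winding_number (linepath a d) y"
  using assms winding_number_reverse_linepath[of y d c] winding_number_reverse_linepath[of y a d]
  by (simp add: winding_number_join path_image_join closed_segment_commute)

lemma winding_number_quadrilateral_outside:
  assumes "convex S" "{a, b, c, d} \<subseteq> S" "y \<notin> S"
  shows "winding_number (linepath a b) y - winding_number (linepath d c) y
      + winding_number (linepath b c) y - winding_number (linepath a d) y = 0"
proof -
  have segs: "closed_segment u v \<subseteq> S" if "u \<in> {a, b, c, d}" "v \<in> {a, b, c, d}" for u v
    using that assms(1,2) by (intro closed_segment_subset) auto
  have "winding_number (linepath a b +++ linepath b c +++ linepath c d +++ linepath d a) y = 0"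
  proof (rule winding_number_zero_outside[OF _ assms(1) _ assms(3)])
    show "path_image (linepath a b +++ linepath b c +++ linepath c d +++ linepath d a) \<subseteq> S"
      using segs by (simp add: path_image_join)
  qed auto
  moreover have "y \<notin> closed_segment u v" if "u \<in> {a, b, c, d}" "v \<in> {a, b, c, d}" for u v
    using segs[OF that] assms(3) by blast
  ultimately show ?thesis
    using winding_number_quadrilateral[of y a b c d] by simp
qed

text \<open>For paths \<open>g\<close> and \<open>h\<close> with a common end point, the winding number of the loop that runs straight from the
  start of \<open>g\<close> to the start of \<open>h\<close>, along \<open>h\<close>, and back along \<open>g\<close>.\<close>

definition start_winding :: "(real \<Rightarrow> complex) \<Rightarrow> (real \<Rightarrow> complex) \<Rightarrow> complex \<Rightarrow> complex" where
  "start_winding g h y = winding_number (linepath (pathstart g) (pathstart h)) y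
     + winding_number h y - winding_number g y"

lemma start_winding_constant:
  assumes gh: "path g" "path h" "pathfinish g = pathfinish h"
    and Y: "connected Y" "Y \<inter> (path_image g \<union> path_image h \<union> closed_segment (pathstart g) (pathstart h)) = {}"
    and y: "y \<in> Y" "y' \<in> Y"
  shows "start_winding g h y = start_winding g h y'"
proof -
  let ?L = "linepath (pathstart g) (pathstart h) +++ h +++ reversepath g"
  have "Y \<inter> path_image ?L = {}"
    using Y(2) gh(3) by (auto simp: path_image_join)
  then have "winding_number ?L constant_on Y"
    using gh by (intro winding_number_constant Y(1)) auto
  then have "winding_number ?L y = winding_number ?L y'"
    using y by (auto simp: constant_on_def)
  moreover have "winding_number ?L z = start_winding g h z" if "z \<in> Y" for z
  proof -
    have "z \<notin> path_image g" "z \<notin> path_image h" "z \<notin> closed_segment (pathstart g) (pathstart h)"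
      using that Y(2) by blast+
    then show ?thesis
      using gh by (simp add: start_winding_def winding_number_join winding_number_reversepath path_image_join)
  qed
  ultimately show ?thesis
    using y by simp
qed

definition grid_point :: "complex \<Rightarrow> real \<Rightarrow> nat \<Rightarrow> nat \<Rightarrow> complex" where
  "grid_point z h i j = z + of_nat i * of_real h + of_nat j * (\<i> * of_real h)"

lemma Re_grid_point: "Re (grid_point z h i j) = Re z + real i * h"
  and Im_grid_point: "Im (grid_point z h i j) = Im z + real j * h"
  by (simp_all add: grid_point_def)

lemma dist_grid_point:
  "0 \<le> h \<Longrightarrow> dist (grid_point z h i j) (grid_point z h (Suc i) j) = h"
  "0 \<le> h \<Longrightarrow> dist (grid_point z h i j) (grid_point z h i (Suc j)) = h"
  by (auto simp: grid_point_def dist_norm norm_mult algebra_simps)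

lemma winding_number_grid_boundary:
  assumes "0 < h" "0 < N" and y: "y \<in> box z (grid_point z h N N)"
  defines "G \<equiv> grid_point z h"
  shows "(\<Sum>i<N. winding_number (linepath (G i 0) (G (Suc i) 0)) y)
    - (\<Sum>i<N. winding_number (linepath (G i N) (G (Suc i) N)) y)
    + (\<Sum>j<N. winding_number (linepath (G N j) (G N (Suc j))) y)
    - (\<Sum>j<N. winding_number (linepath (G 0 j) (G 0 (Suc j))) y) = 1"
proof -
  have corners: "G 0 0 = z" "G N 0 = Complex (Re (G N N)) (Im z)" "G 0 N = Complex (Re z) (Im (G N N))"
    by (simp_all add: G_def grid_point_def complex_eq_iff)
  have "Re z < Re (G N N)" "Im z < Im (G N N)"
    using assms(1,2) by (simp_all add: G_def Re_grid_point Im_grid_point)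
  then have "y \<notin> path_image (rectpath z (G N N))"
    using y path_image_rectpath_cbox_minus_box[of z "G N N"] by (auto simp: G_def)
  then have off: "y \<notin> closed_segment (G 0 0) (G N 0)" "y \<notin> closed_segment (G N 0) (G N N)"
      "y \<notin> closed_segment (G N N) (G 0 N)" "y \<notin> closed_segment (G 0 N) (G 0 0)"
    unfolding corners by (auto simp: rectpath_def Let_def path_image_join closed_segment_commute)
  have "rectpath z (G N N) = linepath (G 0 0) (G N 0) +++ linepath (G N 0) (G N N)
      +++ linepath (G N N) (G 0 N) +++ linepath (G 0 N) (G 0 0)"
    unfolding corners by (simp add: rectpath_def Let_def)
  then have "winding_number (linepath (G 0 0) (G N 0)) y - winding_number (linepath (G 0 N) (G N N)) y
      + winding_number (linepath (G N 0) (G N N)) y - winding_number (linepath (G 0 0) (G 0 N)) y = 1"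
    using winding_number_quadrilateral[OF off] winding_number_rectpath[OF y] by (simp add: G_def)
  moreover have "(\<Sum>i<N. winding_number (linepath (G i j) (G (Suc i) j)) y)
      = winding_number (linepath (G 0 j) (G N j)) y"
    if "y \<notin> closed_segment (G 0 j) (G N j)" for j
    using winding_number_linepath_subdivide[of y "G 0 j" N "of_real h"] that
    by (simp add: G_def grid_point_def add_ac)
  moreover have "(\<Sum>j<N. winding_number (linepath (G i j) (G i (Suc j))) y)
      = winding_number (linepath (G i 0) (G i N)) y"
    if "y \<notin> closed_segment (G i 0) (G i N)" for i
    using winding_number_linepath_subdivide[of y "G i 0" N "\<i> * of_real h"] that
    by (simp add: G_def grid_point_def add_ac)
  ultimately show ?thesis
    using off by (simp add: closed_segment_commute)
qed

locale intersecting_family =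
  fixes \<F> :: "complex set set" and \<epsilon> :: real
  assumes connected: "Y \<in> \<F> \<Longrightarrow> connected Y" and meet: "\<lbrakk>Y \<in> \<F>; Y' \<in> \<F>\<rbrakk> \<Longrightarrow> Y \<inter> Y' \<noteq> {}"
begin

definition tube :: "(real \<Rightarrow> complex) \<Rightarrow> complex set" where
  "tube g = path_image g \<union> cball (pathstart g) \<epsilon>"

text \<open>The common value of \<open>start_winding g h\<close> at the members of the family that avoid both tubes.\<close>

definition family_winding :: "(real \<Rightarrow> complex) \<Rightarrow> (real \<Rightarrow> complex) \<Rightarrow> complex" where
  "family_winding g h = start_winding g h (SOME y. \<exists>Y\<in>\<F>. y \<in> Y \<and> Y \<inter> (tube g \<union> tube h) = {})"

lemma family_winding_eq:
  assumes gh: "path g" "path h" "pathfinish g = pathfinish h" "dist (pathstart g) (pathstart h) \<le> \<epsilon>"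
    and Y: "Y \<in> \<F>" "y \<in> Y" "Y \<inter> (tube g \<union> tube h) = {}"
  shows "family_winding g h = start_winding g h y"
proof -
  define y' where "y' = (SOME y. \<exists>Y\<in>\<F>. y \<in> Y \<and> Y \<inter> (tube g \<union> tube h) = {})"
  have "\<exists>Y\<in>\<F>. y' \<in> Y \<and> Y \<inter> (tube g \<union> tube h) = {}"
    unfolding y'_def by (rule someI[of _ y]) (use Y in blast)
  then obtain Y' where Y': "Y' \<in> \<F>" "y' \<in> Y'" "Y' \<inter> (tube g \<union> tube h) = {}"
    by blast
  have "0 \<le> \<epsilon>"
    using gh(4) zero_le_dist order_trans by blast
  then have "closed_segment (pathstart g) (pathstart h) \<subseteq> cball (pathstart g) \<epsilon>"
    using gh(4) by (intro closed_segment_subset) auto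
  then have "path_image g \<union> path_image h \<union> closed_segment (pathstart g) (pathstart h) \<subseteq> tube g \<union> tube h"
    unfolding tube_def by blast
  then have "(Y \<union> Y') \<inter> (path_image g \<union> path_image h \<union> closed_segment (pathstart g) (pathstart h)) = {}"
    using Y(3) Y'(3) by blast
  moreover have "connected (Y \<union> Y')"
    using connected meet Y(1) Y'(1) by (intro connected_Un) auto
  ultimately show ?thesis
    unfolding family_winding_def y'_def[symmetric] using gh Y(2) Y'(2)
    by (intro start_winding_constant[where Y = "Y \<union> Y'"]) auto
qed

lemma family_winding_cell:
  assumes paths: "\<And>g. g \<in> {ga, gb, gc, gd} \<Longrightarrow> path g \<and> pathfinish g = \<rho>"
    and dist: "dist (pathstart ga) (pathstart gb) \<le> \<epsilon> / 2" "dist (pathstart gb) (pathstart gc) \<le> \<epsilon> / 2"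
      "dist (pathstart gd) (pathstart gc) \<le> \<epsilon> / 2" "dist (pathstart ga) (pathstart gd) \<le> \<epsilon> / 2"
    and Y: "Y \<in> \<F>" "Y \<inter> (tube ga \<union> tube gb \<union> tube gc \<union> tube gd) = {}"
  shows "family_winding ga gb + family_winding gb gc - family_winding gd gc - family_winding ga gd = 0"
proof -
  obtain y where y: "y \<in> Y"
    using meet[OF Y(1) Y(1)] by blast
  have nonneg: "0 \<le> \<epsilon>"
    using dist(1) zero_le_dist[of "pathstart ga" "pathstart gb"] by linarith
  have winding: "family_winding g h = start_winding g h y"
    if "g \<in> {ga, gb, gc, gd}" "h \<in> {ga, gb, gc, gd}" "dist (pathstart g) (pathstart h) \<le> \<epsilon> / 2" for g h
    using that paths Y(2) nonneg by (intro family_winding_eq[OF _ _ _ _ Y(1) y]) auto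
  have "dist (pathstart ga) (pathstart gc) \<le> \<epsilon>"
    using dist(1,2) dist_triangle[of "pathstart ga" "pathstart gc" "pathstart gb"] by linarith
  moreover have "y \<notin> cball (pathstart ga) \<epsilon>"
    using Y(2) y by (auto simp: tube_def)
  ultimately have zero: "winding_number (linepath (pathstart ga) (pathstart gb)) y
      - winding_number (linepath (pathstart gd) (pathstart gc)) y
      + winding_number (linepath (pathstart gb) (pathstart gc)) y
      - winding_number (linepath (pathstart ga) (pathstart gd)) y = 0" (is "?sum = 0")
    using dist nonneg by (intro winding_number_quadrilateral_outside[of "cball (pathstart ga) \<epsilon>"]) auto
  have sides: "family_winding ga gb = start_winding ga gb y" "family_winding gb gc = start_winding gb gc y"
      "family_winding gd gc = start_winding gd gc y" "family_winding ga gd = start_winding ga gd y"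
    using winding[of ga gb] winding[of gb gc] winding[of gd gc] winding[of ga gd] dist by simp_all
  have "family_winding ga gb + family_winding gb gc - family_winding gd gc - family_winding ga gd = ?sum"
    unfolding sides start_winding_def by (simp add: algebra_simps)
  then show ?thesis
    unfolding zero .
qed

lemma sum_family_winding:
  assumes q: "\<And>i. i \<le> N \<Longrightarrow> path (q i) \<and> pathfinish (q i) = \<rho>"
    and dist: "\<And>i. i < N \<Longrightarrow> dist (pathstart (q i)) (pathstart (q (Suc i))) \<le> \<epsilon>"
    and Y: "Y \<in> \<F>" "y \<in> Y" "\<And>i. i \<le> N \<Longrightarrow> Y \<inter> tube (q i) = {}"
  shows "(\<Sum>i<N. family_winding (q i) (q (Suc i)))
    = (\<Sum>i<N. winding_number (linepath (pathstart (q i)) (pathstart (q (Suc i)))) y)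
      + (winding_number (q N) y - winding_number (q 0) y)"
proof -
  have "family_winding (q i) (q (Suc i)) = winding_number (linepath (pathstart (q i)) (pathstart (q (Suc i)))) y
      + (winding_number (q (Suc i)) y - winding_number (q i) y)" if "i < N" for i
  proof -
    have "family_winding (q i) (q (Suc i)) = start_winding (q i) (q (Suc i)) y"
      using q[of i] q[of "Suc i"] dist[OF that] Y(3)[of i] Y(3)[of "Suc i"] that
      by (intro family_winding_eq[OF _ _ _ _ Y(1,2)]) (simp_all add: Int_Un_distrib)
    then show ?thesis
      by (simp add: start_winding_def)
  qed
  then have "(\<Sum>i<N. family_winding (q i) (q (Suc i)))
      = (\<Sum>i<N. winding_number (linepath (pathstart (q i)) (pathstart (q (Suc i)))) y
        + (winding_number (q (Suc i)) y - winding_number (q i) y))"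
    by (intro sum.cong refl) auto
  then show ?thesis
    by (simp only: sum.distrib sum_lessThan_telescope[of "\<lambda>i. winding_number (q i) y"])
qed

text \<open>A discrete Stokes argument: \<open>family_winding\<close> vanishes around every cell, but would add up to \<open>1\<close> along the
  boundary of the grid if \<open>Y\<close> avoided all boundary tubes.\<close>

theorem meets_boundary_tube:
  fixes p :: "nat \<Rightarrow> nat \<Rightarrow> real \<Rightarrow> complex"
  assumes h: "0 < h" "2 * h \<le> \<epsilon>" and N: "0 < N"
    and p: "\<And>i j. \<lbrakk>i \<le> N; j \<le> N\<rbrakk> \<Longrightarrow> path (p i j) \<and> pathstart (p i j) = grid_point z h i j \<and> pathfinish (p i j) = \<rho>"
    and cells: "\<And>i j. \<lbrakk>i < N; j < N\<rbrakk> \<Longrightarrow>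
      \<exists>Y\<in>\<F>. Y \<inter> (tube (p i j) \<union> tube (p (Suc i) j) \<union> tube (p (Suc i) (Suc j)) \<union> tube (p i (Suc j))) = {}"
    and Y: "Y \<in> \<F>" "y \<in> Y" "y \<in> box z (grid_point z h N N)"
  shows "\<exists>i\<le>N. \<exists>j\<le>N. (i = 0 \<or> i = N \<or> j = 0 \<or> j = N) \<and> Y \<inter> tube (p i j) \<noteq> {}"
proof (rule ccontr)
  assume "\<not> ?thesis"
  then have avoid: "Y \<inter> tube (p i j) = {}" if "i \<le> N" "j \<le> N" "i = 0 \<or> i = N \<or> j = 0 \<or> j = N" for i j
    using that by blast
  let ?G = "grid_point z h"
  define hor where "hor i j = family_winding (p i j) (p (Suc i) j)" for i j
  define ver where "ver i j = family_winding (p i j) (p i (Suc j))" for i j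
  define w where "w i j = winding_number (p i j) y" for i j
  have "hor i j + ver (Suc i) j - hor i (Suc j) - ver i j = 0" if ij: "i < N" "j < N" for i j
  proof -
    obtain Y' where "Y' \<in> \<F>" "Y' \<inter> (tube (p i j) \<union> tube (p (Suc i) j) \<union> tube (p (Suc i) (Suc j))
        \<union> tube (p i (Suc j))) = {}"
      using cells[OF ij] by blast
    then show ?thesis
      unfolding hor_def ver_def using p h ij dist_grid_point[of h]
      by (intro family_winding_cell[where Y = Y']) auto
  qed
  then have "(\<Sum>j<N. \<Sum>i<N. hor i j + ver (Suc i) j - hor i (Suc j) - ver i j) = 0"
    by (intro sum.neutral ballI) auto
  then have boundary: "(\<Sum>i<N. hor i 0) - (\<Sum>i<N. hor i N) + (\<Sum>j<N. ver N j) - (\<Sum>j<N. ver 0 j) = 0"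
    unfolding sum_cells_eq_boundary .
  have hor_sum: "(\<Sum>i<N. hor i j) = (\<Sum>i<N. winding_number (linepath (?G i j) (?G (Suc i) j)) y) + (w N j - w 0 j)"
    if "j = 0 \<or> j = N" for j
    unfolding hor_def w_def using sum_family_winding[of N "\<lambda>i. p i j" \<rho>, OF _ _ Y(1,2)]
      p avoid that h dist_grid_point[of h]
    by auto
  have ver_sum: "(\<Sum>j<N. ver i j) = (\<Sum>j<N. winding_number (linepath (?G i j) (?G i (Suc j))) y) + (w i N - w i 0)"
    if "i = 0 \<or> i = N" for i
    unfolding ver_def w_def using sum_family_winding[of N "p i" \<rho>, OF _ _ Y(1,2)]
      p avoid that h dist_grid_point[of h]
    by auto
  have "(\<Sum>i<N. hor i 0) - (\<Sum>i<N. hor i N) + (\<Sum>j<N. ver N j) - (\<Sum>j<N. ver 0 j) = 1"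
    unfolding hor_sum[OF disjI1[OF refl]] hor_sum[OF disjI2[OF refl]] ver_sum[OF disjI1[OF refl]]
      ver_sum[OF disjI2[OF refl]]
      winding_number_grid_boundary[OF h(1) N Y(3), symmetric]
    by (simp add: algebra_simps)
  then show False
    using boundary by simp
qed

end

lemma compact_in_large_square:
  assumes "compact K"
  obtains t where "0 < t" "\<And>x. x \<in> K \<Longrightarrow> \<bar>Re x - Re \<rho>\<bar> + \<epsilon> < t \<and> \<bar>Im x - Im \<rho>\<bar> + \<epsilon> < t"
proof -
  obtain M where M: "M > 0" "\<And>x. x \<in> K \<Longrightarrow> norm x \<le> M"
    using compact_imp_bounded[OF assms] bounded_pos by metis
  show thesis
  proof (rule that[of "M + norm \<rho> + \<bar>\<epsilon>\<bar> + 1"])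
    show "0 < M + norm \<rho> + \<bar>\<epsilon>\<bar> + 1"
      using M(1) norm_ge_zero[of \<rho>] by linarith
    show "\<bar>Re x - Re \<rho>\<bar> + \<epsilon> < M + norm \<rho> + \<bar>\<epsilon>\<bar> + 1 \<and> \<bar>Im x - Im \<rho>\<bar> + \<epsilon> < M + norm \<rho> + \<bar>\<epsilon>\<bar> + 1" if "x \<in> K" for x
      using M(2)[OF that] abs_Re_le_cmod[of x] abs_Im_le_cmod[of x] abs_Re_le_cmod[of \<rho>] abs_Im_le_cmod[of \<rho>]
      by linarith
  qed
qed

text \<open>The segment from the lower left corner to the extreme point \<open>\<rho>\<close> approaches \<open>K\<close> along the direction \<open>1 + \<i>\<close>
  in which \<open>K\<close> is minimal at \<open>\<rho>\<close>.\<close>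

lemma rectangle_with_tail:
  assumes t: "0 < t" and K: "\<And>x. x \<in> K \<Longrightarrow> Re \<rho> + Im \<rho> \<le> Re x + Im x"
  defines "z \<equiv> \<rho> - of_real t * (1 + \<i>)"
  assumes "K \<subseteq> box z b"
  shows "path_connected (path_image (rectpath z b) \<union> closed_segment z \<rho>)"
    and "(path_image (rectpath z b) \<union> closed_segment z \<rho>) \<inter> K \<subseteq> {\<rho>}"
proof -
  have "z \<in> path_image (rectpath z b)"
    by (metis pathstart_in_path_image pathstart_rectpath)
  then show "path_connected (path_image (rectpath z b) \<union> closed_segment z \<rho>)"
    by (intro path_connected_Un path_connected_path_image path_rectpath) (auto simp: convex_imp_path_connected)
  show "(path_image (rectpath z b) \<union> closed_segment z \<rho>) \<inter> K \<subseteq> {\<rho>}"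
  proof
    fix x assume x: "x \<in> (path_image (rectpath z b) \<union> closed_segment z \<rho>) \<inter> K"
    then have "x \<in> box z b"
      using assms(4) by blast
    moreover from this have "path_image (rectpath z b) = cbox z b - box z b"
      by (intro path_image_rectpath_cbox_minus_box) (auto simp: in_box_complex_iff)
    ultimately have "x \<in> closed_segment z \<rho>"
      using x by blast
    then obtain u where u: "0 \<le> u" "u \<le> 1" "x = (1 - u) *\<^sub>R z + u *\<^sub>R \<rho>"
      by (auto simp: in_segment)
    have "x = \<rho> - of_real ((1 - u) * t) * (1 + \<i>)"
      unfolding u(3) z_def by (simp add: scaleR_conv_of_real algebra_simps)
    then have "Re x + Im x = Re \<rho> + Im \<rho> - 2 * ((1 - u) * t)"
      by simp
    moreover have "Re \<rho> + Im \<rho> \<le> Re x + Im x"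
      using x by (intro K) simp
    ultimately have "(1 - u) * t \<le> 0"
      by linarith
    then have "u = 1"
      using t u(2) by (simp add: mult_le_0_iff)
    then show "x \<in> {\<rho>}"
      using u(3) by simp
  qed
qed

lemma grid_point_in_rectpath:
  assumes "0 < h" and ij: "i \<le> N" "j \<le> N" "i = 0 \<or> i = N \<or> j = 0 \<or> j = N"
  shows "grid_point z h i j \<in> path_image (rectpath z (grid_point z h N N))"
proof -
  have "real i * h \<le> real N * h" "real j * h \<le> real N * h"
    using ij assms(1) by (intro mult_right_mono; simp)+
  moreover have "0 \<le> real N * h" "0 \<le> real i * h" "0 \<le> real j * h"
    using assms(1) by simp_all
  ultimately have "grid_point z h i j \<in> cbox z (grid_point z h N N)"
    by (simp add: in_cbox_complex_iff Re_grid_point Im_grid_point)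
  moreover have "grid_point z h i j \<notin> box z (grid_point z h N N)"
    using ij(3) by (auto simp: in_box_complex_iff Re_grid_point Im_grid_point)
  moreover have "path_image (rectpath z (grid_point z h N N))
      = cbox z (grid_point z h N N) - box z (grid_point z h N N)"
    using assms(1) by (intro path_image_rectpath_cbox_minus_box) (simp_all add: Re_grid_point Im_grid_point)
  ultimately show ?thesis
    by blast
qed

lemma enclosing_grid:
  assumes "compact K" "0 < \<epsilon>" and \<rho>: "\<And>x. x \<in> K \<Longrightarrow> Re \<rho> + Im \<rho> \<le> Re x + Im x"
  obtains h N z C where "0 < h" "2 * h \<le> \<epsilon>" "0 < N" "K \<subseteq> box z (grid_point z h N N)"
    "path_connected C" "\<rho> \<in> C" "C \<inter> K \<subseteq> {\<rho>}"
    "\<And>i j. \<lbrakk>i \<le> N; j \<le> N; i = 0 \<or> i = N \<or> j = 0 \<or> j = N\<rbrakk> \<Longrightarrow>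
       grid_point z h i j \<in> C \<and> cball (grid_point z h i j) \<epsilon> \<inter> K = {}"
proof -
  obtain t where t: "0 < t" "\<And>x. x \<in> K \<Longrightarrow> \<bar>Re x - Re \<rho>\<bar> + \<epsilon> < t \<and> \<bar>Im x - Im \<rho>\<bar> + \<epsilon> < t"
    using compact_in_large_square[OF assms(1)] by metis
  define z where "z = \<rho> - of_real t * (1 + \<i>)"
  define N where "N = Suc (nat \<lceil>4 * t / \<epsilon>\<rceil>)"
  define h where "h = 2 * t / real N"
  define C where "C = path_image (rectpath z (grid_point z h N N)) \<union> closed_segment z \<rho>"
  have "4 * t / \<epsilon> \<le> real N" "0 < N"
    unfolding N_def by linarith+
  then have h: "0 < h" "2 * h \<le> \<epsilon>" "0 < N" "real N * h = 2 * t"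
    using t(1) assms(2) by (simp_all add: h_def field_simps)
  have coord: "Re (grid_point z h i j) = Re \<rho> - t + real i * h"
    "Im (grid_point z h i j) = Im \<rho> - t + real j * h" for i j
    by (simp_all add: Re_grid_point Im_grid_point z_def)
  have z: "Re z = Re \<rho> - t" "Im z = Im \<rho> - t"
    by (simp_all add: z_def)
  have box: "K \<subseteq> box z (grid_point z h N N)"
    using t(2) assms(2) by (fastforce simp: in_box_complex_iff coord z h(4))
  note C = rectangle_with_tail[OF t(1) \<rho> box[unfolded z_def], folded z_def, folded C_def]
  have "grid_point z h i j \<in> C \<and> cball (grid_point z h i j) \<epsilon> \<inter> K = {}"
    if ij: "i \<le> N" "j \<le> N" "i = 0 \<or> i = N \<or> j = 0 \<or> j = N" for i j
  proof
    show "grid_point z h i j \<in> C"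
      unfolding C_def using grid_point_in_rectpath[OF h(1) ij] by blast
    have side: "Re (grid_point z h i j) \<in> {Re \<rho> - t, Re \<rho> + t}
        \<or> Im (grid_point z h i j) \<in> {Im \<rho> - t, Im \<rho> + t}"
      using ij(3) h(4) by (auto simp: coord)
    have "x \<notin> K" if "dist (grid_point z h i j) x \<le> \<epsilon>" for x
      using that side t(2)[of x] abs_Re_le_cmod[of "grid_point z h i j - x"]
        abs_Im_le_cmod[of "grid_point z h i j - x"]
      by (auto simp: dist_norm)
    then show "cball (grid_point z h i j) \<epsilon> \<inter> K = {}"
      by auto
  qed
  then show thesis
    using h box C by (intro that[of h N z C]) (auto simp: C_def)
qed

lemma (in intersecting_family) paths_within_barriers:
  assumes K: "\<And>Y. Y \<in> \<F> \<Longrightarrow> Y \<subseteq> K"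
    and B: "\<And>g. path_connected (B g) \<and> g \<in> B g \<and> \<rho> \<in> B g"
    and C: "path_connected C" "\<rho> \<in> C" "C \<inter> K \<subseteq> {\<rho>}"
    and outer: "\<And>x. x \<in> X \<Longrightarrow> x \<in> C \<and> cball x \<epsilon> \<inter> K = {}"
  obtains p g where "\<And>x. path (p x) \<and> pathstart (p x) = x \<and> pathfinish (p x) = \<rho>" "\<And>x. x \<in> X \<Longrightarrow> g x = \<rho>"
    "\<And>x Y. \<lbrakk>Y \<in> \<F>; Y \<inter> (B (g x) \<union> cball (g x) \<epsilon>) = {}\<rbrakk> \<Longrightarrow> Y \<inter> tube (p x) = {}"
proof -
  define D where "D x = (if x \<in> X then C else B x)" for x
  have "path_connected (D x) \<and> x \<in> D x \<and> \<rho> \<in> D x" for x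
    using B[of x] C(1,2) outer[of x] by (simp add: D_def)
  then have "\<exists>q. path q \<and> path_image q \<subseteq> D x \<and> pathstart q = x \<and> pathfinish q = \<rho>" for x
    unfolding path_connected_def by blast
  then obtain p where p: "\<And>x. path (p x) \<and> path_image (p x) \<subseteq> D x \<and> pathstart (p x) = x \<and> pathfinish (p x) = \<rho>"
    by metis
  have tube: "tube (p x) \<subseteq> D x \<union> cball x \<epsilon>" for x
    using p[of x] by (auto simp: tube_def)
  define g where "g x = (if x \<in> X then \<rho> else x)" for x
  show thesis
  proof (rule that[of p g])
    show "path (p x) \<and> pathstart (p x) = x \<and> pathfinish (p x) = \<rho>" for x
      using p by simp
    show "g x = \<rho>" if "x \<in> X" for x
      using that by (simp add: g_def)
    show "Y \<inter> tube (p x) = {}" if Y: "Y \<in> \<F>" "Y \<inter> (B (g x) \<union> cball (g x) \<epsilon>) = {}" for x Y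
    proof (cases "x \<in> X")
      case True
      then have "\<rho> \<notin> Y"
        using Y(2) B[of \<rho>] by (auto simp: g_def)
      then show ?thesis
        using tube[of x] K[OF Y(1)] C(3) outer[OF True] True by (auto simp: D_def)
    next
      case False
      then show ?thesis
        using tube[of x] Y(2) by (auto simp: D_def g_def)
    qed
  qed
qed

theorem four_barriers_meet_intersecting_family:
  assumes K: "compact K" "\<rho> \<in> K" "\<And>x. x \<in> K \<Longrightarrow> Re \<rho> + Im \<rho> \<le> Re x + Im x" and \<epsilon>: "0 < \<epsilon>"
    and \<F>: "\<And>Y. Y \<in> \<F> \<Longrightarrow> connected Y \<and> Y \<subseteq> K" "\<And>Y Y'. \<lbrakk>Y \<in> \<F>; Y' \<in> \<F>\<rbrakk> \<Longrightarrow> Y \<inter> Y' \<noteq> {}"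
    and B: "\<And>g. path_connected (B g) \<and> g \<in> B g \<and> \<rho> \<in> B g"
  shows "\<exists>a b c d. \<forall>Y\<in>\<F>. \<exists>g\<in>{a, b, c, d}. Y \<inter> (B g \<union> cball g \<epsilon>) \<noteq> {}"
proof (rule ccontr)
  assume "\<not> ?thesis"
  then have avoid: "\<exists>Y\<in>\<F>. \<forall>g\<in>{a, b, c, d}. Y \<inter> (B g \<union> cball g \<epsilon>) = {}" for a b c d
    by metis
  obtain h N z C where h: "0 < h" "2 * h \<le> \<epsilon>" "0 < N" and box: "K \<subseteq> box z (grid_point z h N N)"
    and C: "path_connected C" "\<rho> \<in> C" "C \<inter> K \<subseteq> {\<rho>}"
    and bd: "\<And>i j. \<lbrakk>i \<le> N; j \<le> N; i = 0 \<or> i = N \<or> j = 0 \<or> j = N\<rbrakk> \<Longrightarrow>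
       grid_point z h i j \<in> C \<and> cball (grid_point z h i j) \<epsilon> \<inter> K = {}"
    by (rule enclosing_grid[OF K(1) \<epsilon> K(3)]) (assumption | rule that)+
  let ?G = "grid_point z h" and ?bd = "\<lambda>i j. i = 0 \<or> i = N \<or> j = 0 \<or> j = N"
  define X where "X = {?G i j | i j. i \<le> N \<and> j \<le> N \<and> ?bd i j}"
  interpret intersecting_family \<F> \<epsilon>
    using \<F> by unfold_locales auto
  have outer: "x \<in> C \<and> cball x \<epsilon> \<inter> K = {}" if "x \<in> X" for x
    using that bd by (auto simp: X_def)
  have "Y \<subseteq> K" if "Y \<in> \<F>" for Y
    using \<F>(1) that by blast
  then obtain p g where p: "\<And>x. path (p x) \<and> pathstart (p x) = x \<and> pathfinish (p x) = \<rho>"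
    and g: "\<And>x. x \<in> X \<Longrightarrow> g x = \<rho>"
    and avoid_tube: "\<And>x Y. \<lbrakk>Y \<in> \<F>; Y \<inter> (B (g x) \<union> cball (g x) \<epsilon>) = {}\<rbrakk> \<Longrightarrow> Y \<inter> tube (p x) = {}"
    by (rule paths_within_barriers[OF _ B C outer]) (assumption | rule that)+
  obtain Y where Y: "Y \<in> \<F>" "Y \<inter> (B \<rho> \<union> cball \<rho> \<epsilon>) = {}"
    using avoid[of \<rho> \<rho> \<rho> \<rho>] by blast
  obtain y where y: "y \<in> Y"
    using \<F>(2)[OF Y(1) Y(1)] by blast
  have "\<exists>i\<le>N. \<exists>j\<le>N. ?bd i j \<and> Y \<inter> tube (p (?G i j)) \<noteq> {}"
  proof (rule meets_boundary_tube[OF h])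
    show "path (p (?G i j)) \<and> pathstart (p (?G i j)) = ?G i j \<and> pathfinish (p (?G i j)) = \<rho>" for i j
      by (rule p)
    show "y \<in> box z (?G N N)"
      using y \<F>(1)[OF Y(1)] box by blast
    fix i j
    obtain Y' where "Y' \<in> \<F>" and Y': "\<forall>x\<in>{g (?G i j), g (?G (Suc i) j), g (?G (Suc i) (Suc j)), g (?G i (Suc j))}.
        Y' \<inter> (B x \<union> cball x \<epsilon>) = {}"
      using avoid by blast
    then have "Y' \<inter> tube (p (?G i j)) = {}" "Y' \<inter> tube (p (?G (Suc i) j)) = {}"
        "Y' \<inter> tube (p (?G (Suc i) (Suc j))) = {}" "Y' \<inter> tube (p (?G i (Suc j))) = {}"
      using avoid_tube[OF \<open>Y' \<in> \<F>\<close>] by simp_all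
    then show "\<exists>Y\<in>\<F>. Y \<inter> (tube (p (?G i j)) \<union> tube (p (?G (Suc i) j))
        \<union> tube (p (?G (Suc i) (Suc j))) \<union> tube (p (?G i (Suc j)))) = {}"
      using \<open>Y' \<in> \<F>\<close> by (intro bexI[of _ Y']) (simp_all add: Int_Un_distrib)
  qed (use Y y in auto)
  then obtain i j where "?G i j \<in> X" "Y \<inter> tube (p (?G i j)) \<noteq> {}"
    unfolding X_def by blast
  then show False
    using avoid_tube[OF Y(1), of "?G i j"] Y(2) g by simp
qed

lemma eventually_common_point:
  fixes K :: "'i \<Rightarrow> 'a::metric_space set"
  assumes K: "\<And>e. e \<in> F \<Longrightarrow> compact (K e)" and "F \<noteq> {}"
  shows "\<forall>\<^sub>F \<epsilon> in at_right (0::real). \<forall>z. (\<forall>e\<in>F. K e \<inter> cball z \<epsilon> \<noteq> {}) \<longrightarrow> (\<Inter>e\<in>F. K e) \<noteq> {}"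
proof (cases "(\<Inter>e\<in>F. K e) = {}")
  case True
  obtain d where d: "d \<in> F"
    using assms(2) by blast
  have "K d \<subseteq> \<Union>((\<lambda>e. - K e) ` F)"
    using True by auto
  moreover have "open B" if "B \<in> (\<lambda>e. - K e) ` F" for B
    using that K by (auto intro: compact_imp_closed)
  ultimately obtain \<delta> where \<delta>: "0 < \<delta>" "\<And>x. x \<in> K d \<Longrightarrow> \<exists>B\<in>(\<lambda>e. - K e) ` F. ball x \<delta> \<subseteq> B"
    using Heine_Borel_lemma[of "K d" "(\<lambda>e. - K e) ` F"] K[OF d] by blast
  have "\<exists>e\<in>F. K e \<inter> cball z \<epsilon> = {}" if "\<epsilon> < \<delta> / 2" for z \<epsilon>
  proof (cases "K d \<inter> cball z \<epsilon> = {}")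
    case False
    then obtain x where x: "x \<in> K d" "dist z x \<le> \<epsilon>"
      by auto
    then obtain e where e: "e \<in> F" "ball x \<delta> \<inter> K e = {}"
      using \<delta>(2) by blast
    have "cball z \<epsilon> \<subseteq> ball x \<delta>"
    proof
      fix w assume "w \<in> cball z \<epsilon>"
      then show "w \<in> ball x \<delta>"
        using x(2) that dist_triangle[of x w z] by (simp add: dist_commute)
    qed
    then show ?thesis
      using e by blast
  qed (use d in blast)
  then show ?thesis
    unfolding eventually_at_right_field using \<delta>(1) by (intro exI[of _ "\<delta> / 2"]) auto
qed simp

lemma compact_common_point_scale:
  fixes K :: "'i \<Rightarrow> 'a::metric_space set"
  assumes "finite S" and K: "\<And>e. e \<in> S \<Longrightarrow> compact (K e)"
  shows "\<exists>\<epsilon>>0. \<forall>z. \<forall>F\<subseteq>S. F \<noteq> {} \<longrightarrow> (\<forall>e\<in>F. K e \<inter> cball z \<epsilon> \<noteq> {}) \<longrightarrow> (\<Inter>e\<in>F. K e) \<noteq> {}"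
proof -
  have "\<forall>\<^sub>F \<epsilon> in at_right (0::real).
      \<forall>F\<in>Pow S - {{}}. \<forall>z. (\<forall>e\<in>F. K e \<inter> cball z \<epsilon> \<noteq> {}) \<longrightarrow> (\<Inter>e\<in>F. K e) \<noteq> {}"
    using assms(1) K by (intro eventually_ball_finite ballI eventually_common_point) auto
  then have "\<forall>\<^sub>F \<epsilon> in at_right (0::real). 0 < \<epsilon> \<and>
      (\<forall>F\<in>Pow S - {{}}. \<forall>z. (\<forall>e\<in>F. K e \<inter> cball z \<epsilon> \<noteq> {}) \<longrightarrow> (\<Inter>e\<in>F. K e) \<noteq> {})"
    by (intro eventually_conj eventually_at_right_less)
  then obtain \<epsilon> where "0 < \<epsilon>"
    "\<forall>F\<in>Pow S - {{}}. \<forall>z. (\<forall>e\<in>F. K e \<inter> cball z \<epsilon> \<noteq> {}) \<longrightarrow> (\<Inter>e\<in>F. K e) \<noteq> {}"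
    using eventually_happens'[OF trivial_limit_at_right_real] by blast
  then show ?thesis
    by (intro exI[of _ \<epsilon>]) blast
qed

section \<open>Geodesics in relations without large cliques\<close>

lemma rtrancl_geodesic:
  assumes "(a, b) \<in> R\<^sup>*"
  obtains f n where "f 0 = a" "f n = b" "\<And>i. i < n \<Longrightarrow> (f i, f (Suc i)) \<in> R"
    "\<And>i j m. \<lbrakk>i \<le> n; j \<le> n; (f i, f j) \<in> R ^^ m\<rbrakk> \<Longrightarrow> j \<le> i + m"
proof -
  define n where "n = (LEAST n. (a, b) \<in> R ^^ n)"
  obtain m where "(a, b) \<in> R ^^ m"
    using rtrancl_imp_relpow[OF assms] ..
  then have "(a, b) \<in> R ^^ n"
    unfolding n_def by (rule LeastI)
  then obtain f where f: "f 0 = a" "f n = b" "\<And>i. i < n \<Longrightarrow> (f i, f (Suc i)) \<in> R"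
    by (auto simp: relpow_fun_conv)
  have segment: "(f i, f (i + m)) \<in> R ^^ m" if "i + m \<le> n" for i m
    unfolding relpow_fun_conv using f(3) that by (intro exI[of _ "\<lambda>l. f (i + l)"]) simp
  have "j \<le> i + m" if "i \<le> n" "j \<le> n" "(f i, f j) \<in> R ^^ m" for i j m
  proof -
    have "(a, f i) \<in> R ^^ i" "(f j, b) \<in> R ^^ (n - j)"
      using segment[of 0 i] segment[of j "n - j"] that f(1,2) by simp_all
    then have "(a, b) \<in> R ^^ (i + m + (n - j))"
      using that(3) by (auto simp: relpow_add)
    then have "n \<le> i + m + (n - j)"
      unfolding n_def by (rule Least_le)
    then show ?thesis
      using that(2) by simp
  qed
  then show thesis
    using f that by blast
qed

definition clique_free :: "('a \<Rightarrow> 'a \<Rightarrow> bool) \<Rightarrow> nat \<Rightarrow> 'a set \<Rightarrow> bool" where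
  "clique_free r k S \<longleftrightarrow> \<not> (\<exists>C\<subseteq>S. card C = k \<and> pairwise r C)"

locale geodesic =
  fixes r :: "'a \<Rightarrow> 'a \<Rightarrow> bool" and S :: "'a set" and f :: "nat \<Rightarrow> 'a" and n :: nat
  assumes symp: "symp r" and finite_S: "finite S" and in_S: "i \<le> n \<Longrightarrow> f i \<in> S"
    and step: "i < n \<Longrightarrow> r (f i) (f (Suc i))"
    and shortest: "\<lbrakk>i \<le> n; j \<le> n; (f i, f j) \<in> induced r S ^^ m\<rbrakk> \<Longrightarrow> j \<le> i + m"
begin

definition nbhd :: "nat \<Rightarrow> 'a set" where
  "nbhd i = {x \<in> S. r x (f i) \<and> x \<noteq> f i}"

lemma sym: "r x y \<Longrightarrow> r y x"
  using symp by (rule sympD)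

lemma adjacent_nbhds:
  assumes "i \<le> n" "j \<le> n" "x \<in> nbhd i" "y \<in> nbhd j" "x = y \<or> r x y"
  shows "j \<le> i + 3"
proof -
  have "(f i, x) \<in> induced r S" "(y, f j) \<in> induced r S" "x = y \<or> (x, y) \<in> induced r S"
    using assms in_S sym by (auto simp: nbhd_def induced_def)
  then have "(f i, f j) \<in> induced r S ^^ 2 \<or> (f i, f j) \<in> induced r S ^^ 3"
    by (auto simp: numeral_2_eq_2 numeral_3_eq_3)
  then show ?thesis
    using shortest[OF assms(1,2), of 2] shortest[OF assms(1,2), of 3] by auto
qed

definition layer :: "nat \<Rightarrow> 'a set" where
  "layer q = (\<Union>i\<in>{i. i \<le> n \<and> i mod 4 = q}. nbhd i)"

text \<open>By \<open>adjacent_nbhds\<close> a clique in a layer lies in a single neighbourhood, so the centre of that neighbourhood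
  extends it.\<close>

lemma clique_free_layer:
  assumes "0 < k" "clique_free r (Suc k) S"
  shows "clique_free r k (layer q)"
  unfolding clique_free_def
proof (rule notI, elim exE conjE)
  fix C assume C: "C \<subseteq> layer q" "card C = k" "pairwise r C"
  then obtain x where x: "x \<in> C"
    using assms(1) by fastforce
  then obtain i where i: "i \<le> n" "i mod 4 = q" "x \<in> nbhd i"
    using C(1) by (auto simp: layer_def)
  have "C \<subseteq> nbhd i"
  proof
    fix y assume y: "y \<in> C"
    then obtain j where j: "j \<le> n" "j mod 4 = q" "y \<in> nbhd j"
      using C(1) by (auto simp: layer_def)
    have "x = y \<or> r x y"
      using C(3) x y by (auto simp: pairwise_def)
    then have "j \<le> i + 3" "i \<le> j + 3"
      using adjacent_nbhds[OF i(1) j(1) i(3) j(3)] adjacent_nbhds[OF j(1) i(1) j(3) i(3)] sym by blast+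
    moreover have "4 * (i div 4) + q = i" "4 * (j div 4) + q = j"
      using i(2) j(2) mult_div_mod_eq[of 4] by metis+
    moreover from calculation have "i div 4 = j div 4"
      by linarith
    ultimately have "i = j"
      by metis
    then show "y \<in> nbhd i"
      using j(3) by simp
  qed
  then have nbhd: "C \<subseteq> S" "f i \<notin> C" "\<And>y. y \<in> C \<Longrightarrow> r y (f i)"
    by (auto simp: nbhd_def)
  have "card (insert (f i) C) = Suc k"
    using C(2) nbhd(1,2) finite_S by (simp add: finite_subset)
  moreover have "pairwise r (insert (f i) C)"
    using C(3) nbhd(3) sym by (simp add: pairwise_insert)
  moreover have "insert (f i) C \<subseteq> S"
    using nbhd(1) in_S[OF i(1)] by simp
  ultimately show False
    using assms(2) by (auto simp: clique_free_def)
qed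

lemma neighbours_subset_layers: "{x \<in> S. \<exists>y\<in>f ` {..n}. r x y} \<subseteq> insert (f n) (\<Union>q<4. layer q)"
proof
  fix x assume "x \<in> {x \<in> S. \<exists>y\<in>f ` {..n}. r x y}"
  then obtain i where i: "x \<in> S" "i \<le> n" "r x (f i)"
    by auto
  have in_layers: "x \<in> (\<Union>q<4. layer q)" if "j \<le> n" "x \<in> nbhd j" for j
    using that by (intro UN_I[of "j mod 4"]) (auto simp: layer_def)
  consider "x \<noteq> f i" | "x = f i" "i < n" | "x = f n"
    using i(2) by fastforce
  then show "x \<in> insert (f n) (\<Union>q<4. layer q)"
  proof cases
    assume "x \<noteq> f i"
    then show ?thesis
      using i in_layers[of i] by (simp add: nbhd_def)
  next
    assume x: "x = f i" "i < n"
    have "f i \<noteq> f (Suc i)"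
      using shortest[of i "Suc i" 0] x(2) by auto
    then show ?thesis
      using i(1) x step[OF x(2)] in_layers[of "Suc i"] by (simp add: nbhd_def)
  qed simp
qed

lemma card_neighbours_le:
  assumes "0 < k" "clique_free r (Suc k) S" and F: "\<And>T. \<lbrakk>T \<subseteq> S; clique_free r k T\<rbrakk> \<Longrightarrow> card T \<le> F"
  shows "card {x \<in> S. \<exists>y\<in>f ` {..n}. r x y} \<le> 4 * F + 1"
proof -
  have layer: "layer q \<subseteq> S" for q
    by (auto simp: layer_def nbhd_def)
  have "card (\<Union>q<4. layer q) \<le> (\<Sum>q<4. card (layer q))"
    by (rule card_UN_le) simp
  also have "\<dots> \<le> 4 * F"
    using sum_bounded_above[of "{..<4}" "\<lambda>q. card (layer q)" F] F[OF layer clique_free_layer[OF assms(1,2)]]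
    by simp
  finally have "card (insert (f n) (\<Union>q<4. layer q)) \<le> 4 * F + 1"
    using card_insert_le_m1[of "4 * F + 1"] by simp
  moreover have "finite (\<Union>q<4. layer q)"
    using layer finite_S by (auto intro: finite_subset)
  ultimately show ?thesis
    using card_mono[OF _ neighbours_subset_layers] by fastforce
qed

lemma rel_connected_geodesic: "rel_connected r (f ` {..n})"
proof (rule rel_connectedI[OF symp, of "f 0"])
  have "(f 0, f i) \<in> (induced r (f ` {..n}))\<^sup>*" if "i \<le> n" for i
    using that
  proof (induction i)
    case (Suc i)
    then have "(f i, f (Suc i)) \<in> induced r (f ` {..n})"
      using step by (auto simp: induced_def)
    then show ?case
      using Suc by (auto intro: rtrancl_into_rtrancl)
  qed simp
  then show "(f 0, y) \<in> (induced r (f ` {..n}))\<^sup>*" if "y \<in> f ` {..n}" for y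
    using that by auto
qed simp

end

lemma geodesic_with_few_neighbours:
  assumes r: "symp r" and S: "finite S" "rel_connected r S" "a \<in> S" "b \<in> S"
    and k: "0 < k" "clique_free r (Suc k) S" and F: "\<And>T. \<lbrakk>T \<subseteq> S; clique_free r k T\<rbrakk> \<Longrightarrow> card T \<le> F"
  obtains P where "P \<subseteq> S" "a \<in> P" "b \<in> P" "rel_connected r P" "card {x \<in> S. \<exists>y\<in>P. r x y} \<le> 4 * F + 1"
proof -
  have "(a, b) \<in> (induced r S)\<^sup>*"
    using S(2-4) by (simp add: rel_connected_def)
  then obtain f n where f: "f 0 = a" "f n = b" "\<And>i. i < n \<Longrightarrow> (f i, f (Suc i)) \<in> induced r S"
    "\<And>i j m. \<lbrakk>i \<le> n; j \<le> n; (f i, f j) \<in> induced r S ^^ m\<rbrakk> \<Longrightarrow> j \<le> i + m"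
    by (rule rtrancl_geodesic) (rule that)
  have in_S: "f i \<in> S" if "i \<le> n" for i
    using that f(2) f(3)[of i] S(4) by (cases "i = n") (auto simp: induced_def)
  interpret geodesic r S f n
    using r S(1) f(3,4) in_S by unfold_locales (auto simp: induced_def)
  have "a \<in> f ` {..n}" "b \<in> f ` {..n}"
    using f(1,2) by auto
  then show thesis
    using in_S rel_connected_geodesic card_neighbours_le[OF k F] by (intro that[of "f ` {..n}"]) auto
qed

section \<open>Balanced separators for the crossing relation\<close>

lemma nearest_point_segment:
  fixes g :: "'a::euclidean_space"
  assumes "closed A" "A \<noteq> {}"
  obtains q where "q \<in> A" "closed_segment g q \<inter> A = {q}"
proof -
  obtain q where q: "q \<in> A" "\<And>z. z \<in> A \<Longrightarrow> dist g q \<le> dist g z"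
    using distance_attains_inf[OF assms] by blast
  have "z = q" if z: "z \<in> closed_segment g q" "z \<in> A" for z
  proof -
    have "dist g q = dist g z + dist z q"
      using z(1) by (simp add: between_mem_segment[symmetric] between)
    then show ?thesis
      using q(2)[OF z(2)] by simp
  qed
  then show thesis
    using q(1) by (intro that[of q]) auto
qed

context simple_tg
begin

lemma card_through_point:
  assumes S: "S \<subseteq> E" "clique_free crossing (Suc k) S"
  shows "card {e \<in> S. z \<in> img e} \<le> card V + k"
proof (cases "z \<in> V")
  case True
  have "{e \<in> S. z \<in> img e} \<subseteq> (\<lambda>u. {z, u}) ` V"
  proof
    fix e assume "e \<in> {e \<in> S. z \<in> img e}"
    then have e: "e \<in> E" "z \<in> e"
      using S(1) True edgeD(5)[of e] by auto
    obtain a b where "e = {a, b}"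
      using edgeD(2)[OF e(1)] by (auto simp: card_2_iff)
    then show "e \<in> (\<lambda>u. {z, u}) ` V"
      using e(2) edgeD(1)[OF e(1)] by (auto simp: insert_commute)
  qed
  then have "card {e \<in> S. z \<in> img e} \<le> card V"
    using finite_V by (meson surj_card_le)
  then show ?thesis
    by simp
next
  case False
  let ?C = "{e \<in> S. z \<in> img e}"
  have cross: "crossing e f" if "e \<in> ?C" "f \<in> ?C" for e f
  proof -
    have "z \<in> inner e" "z \<in> inner f"
      using that False S(1) by (simp_all add: inner_eq subset_iff)
    then show ?thesis
      unfolding edges_cross_def by blast
  qed
  have "\<not> Suc k \<le> card ?C"
  proof
    assume "Suc k \<le> card ?C"
    then obtain C where C: "C \<subseteq> ?C" "card C = Suc k"
      by (rule obtain_subset_with_card_n)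
    then have "C \<subseteq> S" "pairwise crossing C"
      using cross by (auto simp: pairwise_def)
    then show False
      using S(2) C(2) unfolding clique_free_def by blast
  qed
  then show ?thesis
    by simp
qed

lemma card_near_point:
  assumes S: "S \<subseteq> E" "clique_free crossing (Suc k) S"
  shows "\<exists>\<epsilon>>0. \<forall>z. card {e \<in> S. img e \<inter> cball z \<epsilon> \<noteq> {}} \<le> card V + k"
proof -
  have finite_S: "finite S"
    using S(1) finite_E by (rule finite_subset)
  obtain \<epsilon> where \<epsilon>: "0 < \<epsilon>"
    "\<And>z F. \<lbrakk>F \<subseteq> S; F \<noteq> {}; \<forall>e\<in>F. img e \<inter> cball z \<epsilon> \<noteq> {}\<rbrakk> \<Longrightarrow> (\<Inter>e\<in>F. img e) \<noteq> {}"
    using compact_common_point_scale[OF finite_S, of img] S(1) edgeD(3)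
    by (auto simp: compact_path_image arc_imp_path subset_iff)
  have "card {e \<in> S. img e \<inter> cball z \<epsilon> \<noteq> {}} \<le> card V + k" for z
  proof (cases "{e \<in> S. img e \<inter> cball z \<epsilon> \<noteq> {}} = {}")
    case False
    then obtain x where "\<forall>e\<in>{e \<in> S. img e \<inter> cball z \<epsilon> \<noteq> {}}. x \<in> img e"
      using \<epsilon>(2)[of "{e \<in> S. img e \<inter> cball z \<epsilon> \<noteq> {}}" z] by blast
    then have "card {e \<in> S. img e \<inter> cball z \<epsilon> \<noteq> {}} \<le> card {e \<in> S. x \<in> img e}"
      using finite_S by (intro card_mono) auto
    then show ?thesis
      using card_through_point[OF S, of x] by linarith
  qed (simp only: card.empty)
  then show ?thesis
    using \<epsilon>(1) by blast
qed

lemma edges_meeting_barrier_subset: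
  assumes "S \<subseteq> E" "P \<subseteq> E" and seg: "closed_segment g q \<inter> (\<Union>e\<in>S. img e) \<subseteq> {q}"
  shows "{e \<in> S. img e \<inter> (closed_segment g q \<union> insert q (insert \<rho> (\<Union>e\<in>P. inner e)) \<union> cball g \<epsilon>) \<noteq> {}}
    \<subseteq> {x \<in> S. \<exists>y\<in>P. crossing x y} \<union> {e \<in> S. q \<in> img e} \<union> {e \<in> S. \<rho> \<in> img e} \<union> {e \<in> S. img e \<inter> cball g \<epsilon> \<noteq> {}}"
    (is "_ \<subseteq> ?R")
proof
  fix e assume "e \<in> {e \<in> S. img e \<inter> (closed_segment g q \<union> insert q (insert \<rho> (\<Union>e\<in>P. inner e)) \<union> cball g \<epsilon>) \<noteq> {}}"
  then obtain z where e: "e \<in> S" "z \<in> img e"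
    and z: "z \<in> closed_segment g q \<union> insert q (insert \<rho> (\<Union>e\<in>P. inner e)) \<union> cball g \<epsilon>"
    by blast
  have "\<exists>y\<in>P. crossing e y" if "z \<in> (\<Union>e\<in>P. inner e)"
    using that e assms(1,2) by (auto simp: edges_cross_def inner_eq subset_iff)
  moreover have "z = q" if "z \<in> closed_segment g q"
    using that e seg by blast
  ultimately show "e \<in> ?R"
    using z e by blast
qed

lemma barrier:
  assumes S: "S \<subseteq> E" "rel_connected crossing S" and k: "0 < k" "clique_free crossing (Suc k) S"
    and F: "\<And>T. \<lbrakk>T \<subseteq> S; clique_free crossing k T\<rbrakk> \<Longrightarrow> card T \<le> F"
    and \<rho>: "\<rho> \<in> (\<Union>e\<in>S. img e)" and near: "card {e \<in> S. img e \<inter> cball g \<epsilon> \<noteq> {}} \<le> card V + k"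
  shows "\<exists>B. path_connected B \<and> g \<in> B \<and> \<rho> \<in> B
     \<and> card {e \<in> S. img e \<inter> (B \<union> cball g \<epsilon>) \<noteq> {}} \<le> 4 * F + 1 + 3 * (card V + k)"
proof -
  have finite_S: "finite S"
    using S(1) finite_E by (rule finite_subset)
  have "closed (\<Union>e\<in>S. img e)"
    using finite_S S(1) edgeD(3) by (intro closed_UN ballI closed_path_image) (auto simp: arc_imp_path)
  then obtain q where q: "q \<in> (\<Union>e\<in>S. img e)" "closed_segment g q \<inter> (\<Union>e\<in>S. img e) = {q}"
    using nearest_point_segment[of "\<Union>e\<in>S. img e" g] \<rho> by blast
  obtain c d where c: "c \<in> S" "q \<in> img c" and d: "d \<in> S" "\<rho> \<in> img d"
    using q(1) \<rho> by blast
  obtain P where P: "P \<subseteq> S" "c \<in> P" "d \<in> P" "rel_connected crossing P"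
    and card_P: "card {x \<in> S. \<exists>y\<in>P. crossing x y} \<le> 4 * F + 1"
    by (rule geodesic_with_few_neighbours[OF symp_crossing finite_S S(2) c(1) d(1) k F])
  have PE: "P \<subseteq> E"
    using P(1) S(1) by blast
  define I where "I = (\<Union>e\<in>P. inner e)"
  define B where "B = closed_segment g q \<union> insert q (insert \<rho> I)"
  have "I \<noteq> {}"
    using P(2) PE inner_ne unfolding I_def by blast
  moreover have "path_connected (insert q I)" "path_connected (insert \<rho> I)"
    unfolding I_def using path_connected_insert_piece[OF PE P(4)] P(2,3) c(2) d(2) by blast+
  ultimately have "path_connected (insert q I \<union> insert \<rho> I)"
    by (intro path_connected_Un) blast+
  then have "path_connected (insert q (insert \<rho> I))"
    by (simp add: insert_commute)
  then have "path_connected B"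
    unfolding B_def by (rule path_connected_Un[rotated]) (auto simp: convex_imp_path_connected)
  moreover have "card {e \<in> S. img e \<inter> (B \<union> cball g \<epsilon>) \<noteq> {}} \<le> 4 * F + 1 + 3 * (card V + k)"
  proof -
    let ?cross = "{x \<in> S. \<exists>y\<in>P. crossing x y}" and ?through = "\<lambda>z. {e \<in> S. z \<in> img e}"
      and ?near = "{e \<in> S. img e \<inter> cball g \<epsilon> \<noteq> {}}"
    have "card {e \<in> S. img e \<inter> (B \<union> cball g \<epsilon>) \<noteq> {}} \<le> card (?cross \<union> ?through q \<union> ?through \<rho> \<union> ?near)"
      unfolding B_def I_def using finite_S q(2)
      by (intro card_mono edges_meeting_barrier_subset[OF S(1) PE]) auto
    also have "\<dots> \<le> card ?cross + card (?through q) + card (?through \<rho>) + card ?near"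
      by (intro order_trans[OF card_Un_le] add_mono order_refl)
    also have "\<dots> \<le> (4 * F + 1) + (card V + k) + (card V + k) + (card V + k)"
      by (intro add_mono card_P near card_through_point[OF S(1) k(2)])
    finally show ?thesis
      by simp
  qed
  ultimately show ?thesis
    by (intro exI[of _ B]) (auto simp: B_def)
qed

lemma barriers_at_all_points:
  assumes S: "S \<subseteq> E" "rel_connected crossing S" and k: "0 < k" "clique_free crossing (Suc k) S"
    and F: "\<And>T. \<lbrakk>T \<subseteq> S; clique_free crossing k T\<rbrakk> \<Longrightarrow> card T \<le> F" and \<rho>: "\<rho> \<in> (\<Union>e\<in>S. img e)"
  obtains \<epsilon> B where "0 < \<epsilon>" "\<And>g. path_connected (B g) \<and> g \<in> B g \<and> \<rho> \<in> B g"
    "\<And>g. card {e \<in> S. img e \<inter> (B g \<union> cball g \<epsilon>) \<noteq> {}} \<le> 4 * F + 1 + 3 * (card V + k)"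
proof -
  obtain \<epsilon> where \<epsilon>: "0 < \<epsilon>" "\<And>z. card {e \<in> S. img e \<inter> cball z \<epsilon> \<noteq> {}} \<le> card V + k"
    using card_near_point[OF S(1) k(2)] by blast
  have "\<exists>B. path_connected B \<and> g \<in> B \<and> \<rho> \<in> B
      \<and> card {e \<in> S. img e \<inter> (B \<union> cball g \<epsilon>) \<noteq> {}} \<le> 4 * F + 1 + 3 * (card V + k)" for g
    by (rule barrier[OF S k F \<rho> \<epsilon>(2)])
  then have "\<exists>B. \<forall>g. path_connected (B g) \<and> g \<in> B g \<and> \<rho> \<in> B g
      \<and> card {e \<in> S. img e \<inter> (B g \<union> cball g \<epsilon>) \<noteq> {}} \<le> 4 * F + 1 + 3 * (card V + k)"
    by (intro choice allI)
  then show thesis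
    using that[OF \<epsilon>(1)] by blast
qed

lemma majorities_meet:
  assumes "finite S" "C \<subseteq> S" "C' \<subseteq> S" "card S < 2 * card C" "card S < 2 * card C'"
  shows "C \<inter> C' \<noteq> {}"
proof
  assume "C \<inter> C' = {}"
  then have "card (C \<union> C') = card C + card C'"
    using assms(1-3) by (simp add: card_Un_disjoint finite_subset)
  moreover have "card (C \<union> C') \<le> card S"
    using assms(1-3) by (intro card_mono) auto
  ultimately show False
    using assms(4,5) by simp
qed

definition majority_pieces :: "complex set set \<Rightarrow> complex set set" where
  "majority_pieces S = {\<Union>e\<in>C. img e | C. C \<subseteq> S \<and> rel_connected crossing C \<and> card S < 2 * card C}"

lemma majority_pieces_connected: "\<lbrakk>S \<subseteq> E; Y \<in> majority_pieces S\<rbrakk> \<Longrightarrow> connected Y"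
  using path_connected_piece(2) by (fastforce simp: majority_pieces_def intro: path_connected_imp_connected)

lemma majority_pieces_meet:
  assumes "finite S" "Y \<in> majority_pieces S" "Y' \<in> majority_pieces S"
  shows "Y \<inter> Y' \<noteq> {}"
proof -
  obtain C C' where C: "Y = (\<Union>e\<in>C. img e)" "C \<subseteq> S" "card S < 2 * card C"
    and C': "Y' = (\<Union>e\<in>C'. img e)" "C' \<subseteq> S" "card S < 2 * card C'"
    using assms(2,3) by (auto simp: majority_pieces_def)
  obtain e where "e \<in> C" "e \<in> C'"
    using majorities_meet[OF assms(1) C(2) C'(2) C(3) C'(3)] by blast
  then show ?thesis
    unfolding C(1) C'(1) using pathstart_in_path_image[of "curve e"] by blast
qed

lemma card_UN_four_le:
  assumes "\<And>x. card (T x) \<le> \<beta>"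
  shows "card (\<Union>x\<in>{a, b, c, d}. T x) \<le> 4 * \<beta>"
proof -
  have "card (\<Union>x\<in>{a, b, c, d}. T x) \<le> (\<Sum>x\<in>{a, b, c, d}. card (T x))"
    by (rule card_UN_le) simp
  also have "\<dots> \<le> card {a, b, c, d} * \<beta>"
    using sum_bounded_above[of "{a, b, c, d}" "\<lambda>x. card (T x)" \<beta>] assms by simp
  also have "\<dots> \<le> 4 * \<beta>"
    by (intro mult_right_mono) (auto simp: card_insert_if)
  finally show ?thesis .
qed

theorem crossing_separator:
  assumes S: "S \<subseteq> E" "rel_connected crossing S" and k: "0 < k" "clique_free crossing (Suc k) S"
    and F: "\<And>T. \<lbrakk>T \<subseteq> S; clique_free crossing k T\<rbrakk> \<Longrightarrow> card T \<le> F"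
  obtains T where "T \<subseteq> S" "card T \<le> 4 * (4 * F + 1 + 3 * (card V + k))"
    "\<And>C. \<lbrakk>C \<subseteq> S - T; rel_connected crossing C\<rbrakk> \<Longrightarrow> 2 * card C \<le> card S"
proof -
  define \<beta> where "\<beta> = 4 * F + 1 + 3 * (card V + k)"
  have finite_S: "finite S"
    using S(1) finite_E by (rule finite_subset)
  define K where "K = (\<Union>e\<in>S. img e)"
  have K: "compact K" "K \<noteq> {}"
    unfolding K_def using finite_S S edgeD(3)
    by (auto intro!: compact_UN compact_path_image arc_imp_path simp: rel_connected_def)
  have "continuous_on K (\<lambda>z. Re z + Im z)"
    by (intro continuous_intros)
  then obtain \<rho> where \<rho>: "\<rho> \<in> K" "\<And>z. z \<in> K \<Longrightarrow> Re \<rho> + Im \<rho> \<le> Re z + Im z"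
    using continuous_attains_inf[OF K] by blast
  obtain \<epsilon> B where \<epsilon>: "0 < \<epsilon>" and B: "\<And>g. path_connected (B g) \<and> g \<in> B g \<and> \<rho> \<in> B g"
    and card_B: "\<And>g. card {e \<in> S. img e \<inter> (B g \<union> cball g \<epsilon>) \<noteq> {}} \<le> \<beta>"
    unfolding \<beta>_def by (rule barriers_at_all_points[OF S k F \<rho>(1)[unfolded K_def]]) blast+
  have "\<exists>a b c d. \<forall>Y\<in>majority_pieces S. \<exists>g\<in>{a, b, c, d}. Y \<inter> (B g \<union> cball g \<epsilon>) \<noteq> {}"
  proof (rule four_barriers_meet_intersecting_family[OF K(1) \<rho> \<epsilon>])
    show "connected Y \<and> Y \<subseteq> K" if "Y \<in> majority_pieces S" for Y
      using that majority_pieces_connected[OF S(1)] by (auto simp: majority_pieces_def K_def)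
  qed (assumption | rule B majority_pieces_meet[OF finite_S])+
  then obtain a b c d where abcd: "\<forall>Y\<in>majority_pieces S. \<exists>g\<in>{a, b, c, d}. Y \<inter> (B g \<union> cball g \<epsilon>) \<noteq> {}"
    by blast
  define T where "T = (\<Union>g\<in>{a, b, c, d}. {e \<in> S. img e \<inter> (B g \<union> cball g \<epsilon>) \<noteq> {}})"
  have "card T \<le> 4 * \<beta>"
    unfolding T_def by (rule card_UN_four_le[OF card_B])
  moreover have "2 * card C \<le> card S" if C: "C \<subseteq> S - T" "rel_connected crossing C" for C
  proof (rule ccontr)
    assume "\<not> 2 * card C \<le> card S"
    then have "(\<Union>e\<in>C. img e) \<in> majority_pieces S"
      using C by (auto simp: majority_pieces_def)
    then obtain g where g: "g \<in> {a, b, c, d}" "(\<Union>e\<in>C. img e) \<inter> (B g \<union> cball g \<epsilon>) \<noteq> {}"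
      using abcd by meson
    then obtain e where "e \<in> C" "img e \<inter> (B g \<union> cball g \<epsilon>) \<noteq> {}"
      by blast
    then have "e \<in> T"
      unfolding T_def using C(1) g(1) by blast
    then show False
      using C(1) \<open>e \<in> C\<close> by blast
  qed
  ultimately show thesis
    unfolding \<beta>_def by (intro that[of T]) (auto simp: T_def)
qed

end

section \<open>Edges without crossing cliques\<close>

lemma square_le_power_two:
  assumes "1 \<le> n"
  obtains j where "n\<^sup>2 \<le> 2 ^ j" "real j \<le> 3 * (1 + ln (real n))"
proof
  define j where "j = nat \<lceil>2 * log 2 n\<rceil>"
  have "0 \<le> log 2 n"
    using assms by simp
  then have j: "2 * log 2 n \<le> j" "j \<le> 2 * log 2 n + 1"
    unfolding j_def by linarith+
  have "real (n\<^sup>2) = 2 powr (2 * log 2 n)"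
    using assms powr_powr[of 2 "log 2 n" 2] by (simp add: mult.commute)
  also have "\<dots> \<le> 2 powr j"
    using j(1) by (intro powr_mono) auto
  also have "\<dots> = real (2 ^ j)"
    by (simp add: powr_realpow)
  finally show "n\<^sup>2 \<le> 2 ^ j"
    using of_nat_le_iff by blast
  have "ln n * (2 / 3) \<le> ln n * ln 2"
    using ln2_ge_two_thirds assms by (intro mult_left_mono) auto
  then have "log 2 n \<le> 3 / 2 * ln n"
    by (simp add: log_def field_simps)
  then show "real j \<le> 3 * (1 + ln (real n))"
    using j(2) by simp
qed

context simple_tg
begin

lemma card_E_le_square: "card E \<le> (card V)\<^sup>2"
proof -
  have "E \<subseteq> {e. e \<subseteq> V \<and> card e = 2}"
    using edgeD(1,2) by auto
  then have "card E \<le> card {e. e \<subseteq> V \<and> card e = 2}"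
    using finite_V by (intro card_mono) auto
  also have "\<dots> = card V choose 2"
    by (rule n_subsets[OF finite_V])
  also have "\<dots> \<le> (card V)\<^sup>2"
    by (cases "2 \<le> card V") (auto simp: binomial_le_pow binomial_eq_0)
  finally show ?thesis .
qed

lemma card_Union_ge_1:
  assumes "T \<subseteq> E" "T \<noteq> {}"
  shows "1 \<le> card (\<Union>T)"
proof -
  obtain e where e: "e \<in> T"
    using assms(2) by blast
  then have "\<Union>T \<noteq> {}"
    using assms(1) edgeD(2)[of e] by fastforce
  moreover have "finite (\<Union>T)"
    using assms(1) edgeD(1) by (intro finite_subset[OF _ finite_V]) blast
  ultimately show ?thesis
    by (simp add: Suc_le_eq card_gt_0_iff)
qed

lemma rel_connected_crossing_pair:
  "crossing e f \<Longrightarrow> rel_connected crossing {e, f}"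
  using rel_connected_Un[OF symp_crossing rel_connected_singleton rel_connected_singleton, of e e f f]
  by (simp add: insert_commute)

lemma component_separator:
  fixes c :: real
  assumes k: "0 < k" "clique_free crossing (Suc k) E" and c_nonneg: "0 \<le> c"
    and F: "\<And>T. \<lbrakk>T \<subseteq> E; clique_free crossing k T\<rbrakk> \<Longrightarrow> real (card T) \<le> c * card (\<Union>T)"
    and P: "P \<subseteq> E" "rel_connected crossing P"
  shows "\<exists>T\<subseteq>P. real (card T) \<le> (16 * c + 16 + 12 * real k) * card (\<Union>P)
    \<and> (\<forall>C\<subseteq>P - T. rel_connected crossing C \<longrightarrow> 2 * card C \<le> card P)"
proof -
  have UP: "\<Union>P \<subseteq> V"
    using P(1) edgeD(1) by blast
  interpret P: simple_tg "\<Union>P" P curve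
    by (rule subgraph[OF P(1) UP order_refl])
  define N where "N = card (\<Union>P)"
  have N: "1 \<le> N"
    unfolding N_def using P by (intro card_Union_ge_1) (auto simp: rel_connected_def)
  have "clique_free crossing (Suc k) P"
    using k(2) P(1) unfolding clique_free_def by blast
  moreover have "card T \<le> nat \<lfloor>c * N\<rfloor>" if T: "T \<subseteq> P" "clique_free crossing k T" for T
  proof -
    have "card (\<Union>T) \<le> N"
      unfolding N_def using T(1) P.finite_V by (intro card_mono) auto
    then have "c * card (\<Union>T) \<le> c * N"
      using c_nonneg by (intro mult_left_mono) auto
    moreover have "real (card T) \<le> c * card (\<Union>T)"
      using T P(1) by (intro F) auto
    ultimately show ?thesis
      by (intro le_nat_floor) linarith
  qed
  ultimately obtain T where T: "T \<subseteq> P" "card T \<le> 4 * (4 * nat \<lfloor>c * N\<rfloor> + 1 + 3 * (N + k))"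
      "\<And>C. \<lbrakk>C \<subseteq> P - T; rel_connected crossing C\<rbrakk> \<Longrightarrow> 2 * card C \<le> card P"
    unfolding N_def by (rule P.crossing_separator[OF order_refl P(2) k(1)]) blast+
  have floor: "real (nat \<lfloor>c * N\<rfloor>) \<le> c * N"
    using c_nonneg by (intro of_nat_floor) simp
  have "real (card T) \<le> real (4 * (4 * nat \<lfloor>c * N\<rfloor> + 1 + 3 * (N + k)))"
    using T(2) of_nat_le_iff by blast
  also have "\<dots> = 16 * real (nat \<lfloor>c * N\<rfloor>) + 4 + 12 * real N + 12 * real k"
    by simp
  also have "\<dots> \<le> 16 * (c * N) + 4 * real N + 12 * real N + 12 * (real k * real N)"
    using floor N mult_left_mono[of 1 "real N" "real k"] by simp
  also have "\<dots> = (16 * c + 16 + 12 * real k) * N"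
    by (simp add: algebra_simps)
  finally show ?thesis
    using T(1,3) unfolding N_def by blast
qed

lemma card_UN_separators_le:
  fixes K :: real
  assumes finite_pieces: "finite \<P>" and within: "\<And>P. P \<in> \<P> \<Longrightarrow> P \<subseteq> E"
    and connected_pieces: "\<And>P. P \<in> \<P> \<Longrightarrow> rel_connected crossing P"
    and separated: "\<And>P Q e f. \<lbrakk>P \<in> \<P>; Q \<in> \<P>; P \<noteq> Q; e \<in> P; f \<in> Q\<rbrakk> \<Longrightarrow> \<not> crossing e f"
    and T: "\<And>P. P \<in> \<P> \<Longrightarrow> real (card (T P)) \<le> K * card (\<Union>P)" and K: "0 \<le> K"
  shows "real (card (\<Union>P\<in>\<P>. T P)) \<le> 272 * K * card V"
proof -
  have "real (card (\<Union>P\<in>\<P>. T P)) \<le> real (\<Sum>P\<in>\<P>. card (T P))"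
    using card_UN_le[OF finite_pieces] by (rule of_nat_mono)
  also have "\<dots> \<le> (\<Sum>P\<in>\<P>. K * card (\<Union>P))"
    using T by (simp add: sum_mono)
  also have "\<dots> = K * real (\<Sum>P\<in>\<P>. card (\<Union>P))"
    by (simp add: sum_distrib_left)
  also have "\<dots> \<le> K * real (272 * card V)"
    using sum_card_vertices_pieces_le[OF finite_pieces within connected_pieces separated] K
    by (intro mult_left_mono of_nat_mono) auto
  finally show ?thesis
    by simp
qed

lemma halve_components:
  fixes K :: real
  assumes sep: "\<And>P. \<lbrakk>P \<subseteq> E; rel_connected crossing P\<rbrakk> \<Longrightarrow> \<exists>T\<subseteq>P. real (card T) \<le> K * card (\<Union>P)
      \<and> (\<forall>C\<subseteq>P - T. rel_connected crossing C \<longrightarrow> 2 * card C \<le> card P)"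
    and K: "0 \<le> K" and W: "W \<subseteq> E"
  obtains R where "R \<subseteq> W" "real (card R) \<le> 272 * K * card V"
    "\<And>C. \<lbrakk>C \<subseteq> W - R; rel_connected crossing C\<rbrakk> \<Longrightarrow> \<exists>P\<subseteq>W. rel_connected crossing P \<and> 2 * card C \<le> card P"
proof -
  define \<P> where "\<P> = rel_component crossing W ` W"
  have finite_pieces: "finite \<P>"
    unfolding \<P>_def using W finite_E by (auto intro: finite_subset)
  have within: "P \<subseteq> W" if "P \<in> \<P>" for P
    using that rel_component_subset by (fastforce simp: \<P>_def)
  have connected_pieces: "rel_connected crossing P" if "P \<in> \<P>" for P
    using that rel_connected_rel_component[OF symp_crossing] by (auto simp: \<P>_def)
  have "\<forall>P\<in>\<P>. \<exists>T\<subseteq>P. real (card T) \<le> K * card (\<Union>P) \<and> (\<forall>C\<subseteq>P - T. rel_connected crossing C \<longrightarrow> 2 * card C \<le> card P)"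
    using within connected_pieces W by (intro ballI sep) auto
  then obtain T where T: "\<And>P. P \<in> \<P> \<Longrightarrow> T P \<subseteq> P" "\<And>P. P \<in> \<P> \<Longrightarrow> real (card (T P)) \<le> K * card (\<Union>P)"
      "\<And>P C. \<lbrakk>P \<in> \<P>; C \<subseteq> P - T P; rel_connected crossing C\<rbrakk> \<Longrightarrow> 2 * card C \<le> card P"
    by metis
  show thesis
  proof
    show "(\<Union>P\<in>\<P>. T P) \<subseteq> W"
      using T(1) within by blast
    have separated: "\<not> crossing e f" if PQ: "P \<in> \<P>" "Q \<in> \<P>" "P \<noteq> Q" "e \<in> P" "f \<in> Q" for P Q e f
      using PQ rel_components_separated[OF symp_crossing, of _ W] unfolding \<P>_def by blast
    show "real (card (\<Union>P\<in>\<P>. T P)) \<le> 272 * K * card V"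
      by (rule card_UN_separators_le[OF finite_pieces order_trans[OF within W] connected_pieces separated T(2) K])
    fix C assume C: "C \<subseteq> W - (\<Union>P\<in>\<P>. T P)" "rel_connected crossing C"
    then obtain x where x: "x \<in> C" "x \<in> W"
      by (auto simp: rel_connected_def)
    let ?P = "rel_component crossing W x"
    have P: "?P \<in> \<P>"
      using x(2) by (simp add: \<P>_def)
    have "C \<subseteq> ?P"
      using C x(1) by (intro subset_rel_component) auto
    then have "C \<subseteq> ?P - T ?P"
      using C(1) P by blast
    then have "2 * card C \<le> card ?P"
      using T(3)[OF P] C(2) by blast
    then show "\<exists>P\<subseteq>W. rel_connected crossing P \<and> 2 * card C \<le> card P"
      using within[OF P] connected_pieces[OF P] by blast
  qed
qed

lemma iterated_halving:
  fixes K :: real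
  assumes sep: "\<And>P. \<lbrakk>P \<subseteq> E; rel_connected crossing P\<rbrakk> \<Longrightarrow> \<exists>T\<subseteq>P. real (card T) \<le> K * card (\<Union>P)
      \<and> (\<forall>C\<subseteq>P - T. rel_connected crossing C \<longrightarrow> 2 * card C \<le> card P)"
    and K: "0 \<le> K" and "W \<subseteq> E" "\<And>C. \<lbrakk>C \<subseteq> W; rel_connected crossing C\<rbrakk> \<Longrightarrow> card C \<le> 2 ^ j"
  shows "real (card W) \<le> (16 + 272 * K * j) * card V"
  using assms(3,4)
proof (induction j arbitrary: W)
  case 0
  have "card W \<le> 16 * card V"
  proof (rule card_noncrossing_le[OF 0(1)])
    show "\<not> crossing e f" if "e \<in> W" "f \<in> W" "e \<noteq> f" for e f
      using that 0(2)[of "{e, f}"] rel_connected_crossing_pair[of e f] by auto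
  qed
  then show ?case
    by simp
next
  case (Suc j)
  obtain R where R: "R \<subseteq> W" "real (card R) \<le> 272 * K * card V"
    "\<And>C. \<lbrakk>C \<subseteq> W - R; rel_connected crossing C\<rbrakk> \<Longrightarrow> \<exists>P\<subseteq>W. rel_connected crossing P \<and> 2 * card C \<le> card P"
    by (rule halve_components[OF sep K Suc.prems(1)]) (assumption | rule that)+
  have finite_W: "finite W"
    using Suc.prems(1) finite_E by (rule finite_subset)
  have "real (card (W - R)) \<le> (16 + 272 * K * j) * card V"
  proof (rule Suc.IH)
    show "W - R \<subseteq> E"
      using Suc.prems(1) by blast
    fix C assume "C \<subseteq> W - R" "rel_connected crossing C"
    then obtain P where "P \<subseteq> W" "rel_connected crossing P" "2 * card C \<le> card P"
      using R(3) by blast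
    then show "card C \<le> 2 ^ j"
      using Suc.prems(2)[of P] by simp
  qed
  moreover have "card W = card (W - R) + card R"
    using R(1) finite_W card_mono[OF finite_W R(1)] by (simp add: card_Diff_subset finite_subset)
  ultimately show ?case
    using R(2) by (simp add: algebra_simps)
qed

lemma card_E_le_if_sparse_subgraphs:
  fixes c :: real
  assumes k: "0 < k" "clique_free crossing (Suc k) E" and c_nonneg: "0 \<le> c" and V: "V \<noteq> {}"
    and F: "\<And>T. \<lbrakk>T \<subseteq> E; clique_free crossing k T\<rbrakk> \<Longrightarrow> real (card T) \<le> c * card (\<Union>T)"
  shows "real (card E) \<le> (16 + 816 * (16 * c + 16 + 12 * real k) * (1 + ln (card V))) * card V"
proof -
  have "1 \<le> card V"
    using V finite_V by (simp add: Suc_le_eq card_gt_0_iff)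
  then obtain j where j: "(card V)\<^sup>2 \<le> 2 ^ j" "real j \<le> 3 * (1 + ln (real (card V)))"
    by (rule square_le_power_two)
  have "card C \<le> 2 ^ j" if "C \<subseteq> E" for C
    using card_mono[OF finite_E that] card_E_le_square j(1) by linarith
  then have "real (card E) \<le> (16 + 272 * (16 * c + 16 + 12 * real k) * j) * card V"
    using c_nonneg by (intro iterated_halving component_separator[OF k c_nonneg F]) auto
  also have "\<dots> \<le> (16 + 272 * (16 * c + 16 + 12 * real k) * (3 * (1 + ln (card V)))) * card V"
    using j(2) c_nonneg by (intro mult_right_mono add_left_mono mult_left_mono) auto
  finally show ?thesis
    by (simp add: algebra_simps)
qed

lemma polylog_bound_enlarge_vertex_set:
  fixes C :: real
  assumes T: "T \<subseteq> E" and C: "0 \<le> C" and bound: "real (card T) \<le> C * (1 + ln (card (\<Union>T))) ^ k * card (\<Union>T)"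
  shows "real (card T) \<le> C * (1 + ln (card V)) ^ k * card (\<Union>T)"
proof (cases "T = {}")
  case False
  have UT: "\<Union>T \<subseteq> V"
    using T edgeD(1) by blast
  have "0 \<le> ln (real (card (\<Union>T)))" "ln (real (card (\<Union>T))) \<le> ln (real (card V))"
    using card_Union_ge_1[OF T False] card_mono[OF finite_V UT] by simp_all
  then have "(1 + ln (real (card (\<Union>T)))) ^ k \<le> (1 + ln (real (card V))) ^ k"
    by (intro power_mono) auto
  then have "C * (1 + ln (card (\<Union>T))) ^ k * card (\<Union>T) \<le> C * (1 + ln (card V)) ^ k * card (\<Union>T)"
    using C by (intro mult_right_mono mult_left_mono) auto
  then show ?thesis
    using bound by linarith
qed simp

lemma polylog_bound_step:
  fixes C :: real
  assumes C: "1 \<le> C" and free: "clique_free crossing (Suc k + 2) E"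
    and IH: "\<And>V E curve. \<lbrakk>simple_tg V E curve; clique_free (edges_cross curve) (k + 2) E\<rbrakk> \<Longrightarrow>
      real (card E) \<le> C * (1 + ln (card V)) ^ k * card V"
  shows "real (card E) \<le> C * (16 + 816 * (56 + 12 * real k)) * (1 + ln (card V)) ^ Suc k * card V"
proof (cases "V = {}")
  case True
  then show ?thesis
    using card_E_le_square by simp
next
  case False
  define L where "L = 1 + ln (real (card V))"
  define c where "c = C * L ^ k"
  have L: "1 \<le> L"
    using False finite_V by (simp add: L_def Suc_le_eq card_gt_0_iff)
  have c_ge_1: "1 \<le> c"
    unfolding c_def using C L mult_mono[of 1 C 1 "L ^ k"] by simp
  have "real (card T) \<le> c * card (\<Union>T)" if T: "T \<subseteq> E" "clique_free crossing (k + 2) T" for T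
    unfolding c_def L_def
  proof (rule polylog_bound_enlarge_vertex_set[OF T(1)])
    have "simple_tg (\<Union>T) T curve"
      using T(1) edgeD(1) by (intro subgraph) auto
    then show "real (card T) \<le> C * (1 + ln (card (\<Union>T))) ^ k * card (\<Union>T)"
      using IH T(2) by blast
  qed (use C in simp)
  then have "real (card E) \<le> (16 + 816 * (16 * c + 16 + 12 * real (k + 2)) * L) * card V"
    unfolding L_def using free c_ge_1 False by (intro card_E_le_if_sparse_subgraphs) auto
  also have "\<dots> \<le> (16 * (c * L) + 816 * ((56 + 12 * real k) * c) * L) * card V"
  proof (intro mult_right_mono add_mono mult_left_mono)
    show "(16::real) \<le> 16 * (c * L)"
      using c_ge_1 L mult_mono[of 1 c 1 L] by simp
    have "12 * real k \<le> 12 * real k * c"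
      using mult_left_mono[OF c_ge_1, of "12 * real k"] by simp
    then show "16 * c + 16 + 12 * real (k + 2) \<le> (56 + 12 * real k) * c"
      using c_ge_1 by (simp add: algebra_simps)
  qed (use L in auto)
  also have "\<dots> = C * (16 + 816 * (56 + 12 * real k)) * L ^ Suc k * card V"
    unfolding c_def by (simp add: algebra_simps)
  finally show ?thesis
    unfolding L_def .
qed

lemma clique_free_2_noncrossing:
  assumes "clique_free crossing 2 E" "e \<in> E" "f \<in> E" "e \<noteq> f"
  shows "\<not> crossing e f"
proof
  assume "crossing e f"
  then have "pairwise crossing {e, f}"
    using crossing_sym by (auto simp: pairwise_insert)
  moreover have "{e, f} \<subseteq> E" "card {e, f} = 2"
    using assms(2-4) by auto
  ultimately show False
    using assms(1) unfolding clique_free_def by blast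
qed

end

theorem few_edges_without_crossing_clique:
  "\<exists>C\<ge>1. \<forall>V E curve. simple_tg V E curve \<longrightarrow> clique_free (edges_cross curve) (k + 2) E \<longrightarrow>
    real (card E) \<le> C * (1 + ln (card V)) ^ k * card V"
proof (induction k)
  case 0
  have "real (card E) \<le> 16 * (1 + ln (card V)) ^ 0 * card V"
    if "simple_tg V E curve" "clique_free (edges_cross curve) (0 + 2) E" for V E curve
  proof -
    interpret simple_tg V E curve
      by fact
    have "clique_free crossing 2 E"
      using that(2) by (simp add: numeral_2_eq_2)
    then have "card E \<le> 16 * card V"
      using clique_free_2_noncrossing by (intro card_noncrossing_le) simp_all
    then show ?thesis
      by simp
  qed
  then show ?case
    by (intro exI[of _ 16]) simp
next
  case (Suc k)
  then obtain C where C: "1 \<le> C" "\<And>V E curve. \<lbrakk>simple_tg V E curve; clique_free (edges_cross curve) (k + 2) E\<rbrakk> \<Longrightarrow>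
      real (card E) \<le> C * (1 + ln (card V)) ^ k * card V"
    by blast
  have "real (card E) \<le> C * (16 + 816 * (56 + 12 * real k)) * (1 + ln (card V)) ^ Suc k * card V"
    if "simple_tg V E curve" "clique_free (edges_cross curve) (Suc k + 2) E" for V E curve
    by (rule simple_tg.polylog_bound_step[OF that(1) C(1) that(2)]) (rule C(2))
  moreover have "1 \<le> C * (16 + 816 * (56 + 12 * real k))"
    using C(1) mult_mono[of 1 C 1 "16 + 816 * (56 + 12 * real k)"] by simp
  ultimately show ?case
    by blast
qed

section \<open>Mixing of lazy walks\<close>

lemma weighted_Cauchy_Schwarz:
  fixes w a b :: "'i \<Rightarrow> real"
  assumes w: "\<And>i. i \<in> I \<Longrightarrow> 0 \<le> w i"
  shows "(\<Sum>i\<in>I. w i * (a i * b i))\<^sup>2 \<le> (\<Sum>i\<in>I. w i * (a i)\<^sup>2) * (\<Sum>i\<in>I. w i * (b i)\<^sup>2)"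
proof -
  have "w i * (a i * b i) = (sqrt (w i) * a i) * (sqrt (w i) * b i)" if "i \<in> I" for i
  proof -
    have "w i * (a i * b i) = (sqrt (w i) * sqrt (w i)) * (a i * b i)"
      using w[OF that] by simp
    then show ?thesis
      by (simp only: mult_ac)
  qed
  then have "(\<Sum>i\<in>I. w i * (a i * b i)) = (\<Sum>i\<in>I. (sqrt (w i) * a i) * (sqrt (w i) * b i))"
    by (intro sum.cong refl)
  moreover have "(\<Sum>i\<in>I. (sqrt (w i) * c i)\<^sup>2) = (\<Sum>i\<in>I. w i * (c i)\<^sup>2)" for c
    using w by (intro sum.cong) (auto simp: power_mult_distrib)
  ultimately show ?thesis
    using Cauchy_Schwarz_ineq_sum[of "\<lambda>i. sqrt (w i) * a i" "\<lambda>i. sqrt (w i) * b i" I] by simp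
qed

text \<open>The weights are normalised to total mass 1, so that the row sums \<open>\<pi>\<close> are the stationary distribution.\<close>

locale network =
  fixes V :: "'a set" and w :: "'a \<Rightarrow> 'a \<Rightarrow> real"
  assumes finite_vertices: "finite V" and w_sym: "w u v = w v u" and w_nonneg: "0 \<le> w u v"
    and w_total: "(\<Sum>v\<in>V. \<Sum>u\<in>V. w v u) = 1" and w_pos: "v \<in> V \<Longrightarrow> 0 < (\<Sum>u\<in>V. w v u)"
begin

definition \<pi> :: "'a \<Rightarrow> real" where
  "\<pi> v = (\<Sum>u\<in>V. w v u)"

definition mean :: "('a \<Rightarrow> real) \<Rightarrow> real" where
  "mean f = (\<Sum>v\<in>V. \<pi> v * f v)"

definition energy :: "('a \<Rightarrow> real) \<Rightarrow> real" where
  "energy f = (\<Sum>v\<in>V. \<Sum>u\<in>V. w v u * (f v - f u)\<^sup>2)"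

definition variation :: "('a \<Rightarrow> real) \<Rightarrow> real" where
  "variation f = (\<Sum>v\<in>V. \<Sum>u\<in>V. w v u * \<bar>f v - f u\<bar>)"

definition lazy :: "('a \<Rightarrow> real) \<Rightarrow> 'a \<Rightarrow> real" where
  "lazy f v = (f v + (\<Sum>u\<in>V. w v u * f u) / \<pi> v) / 2"

definition flow_out :: "'a set \<Rightarrow> real" where
  "flow_out U = (\<Sum>v\<in>U. \<Sum>u\<in>V - U. w v u)"

lemma \<pi>_pos: "v \<in> V \<Longrightarrow> 0 < \<pi> v"
  using w_pos by (simp add: \<pi>_def)

lemma \<pi>_nonneg: "0 \<le> \<pi> v"
  unfolding \<pi>_def by (intro sum_nonneg w_nonneg)

lemma sum_\<pi>: "sum \<pi> V = 1"
  using w_total by (simp add: \<pi>_def)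

lemma sum_\<pi>_mono: "\<lbrakk>U \<subseteq> W; W \<subseteq> V\<rbrakk> \<Longrightarrow> sum \<pi> U \<le> sum \<pi> W"
  using finite_vertices by (intro sum_mono2 \<pi>_nonneg) (auto intro: finite_subset)

lemma sum_w_fst: "(\<Sum>v\<in>V. \<Sum>u\<in>V. w v u * g v) = mean g"
  by (simp add: mean_def \<pi>_def sum_distrib_right)

lemma sum_w_snd: "(\<Sum>v\<in>V. \<Sum>u\<in>V. w v u * g u) = mean g"
proof -
  have "(\<Sum>v\<in>V. \<Sum>u\<in>V. w v u * g u) = (\<Sum>u\<in>V. \<Sum>v\<in>V. w v u * g u)"
    by (rule sum.swap)
  also have "\<dots> = (\<Sum>u\<in>V. \<Sum>v\<in>V. w u v * g u)"
    by (simp only: w_sym)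
  finally show ?thesis
    by (simp add: sum_w_fst)
qed

lemma mean_mono: "(\<And>v. v \<in> V \<Longrightarrow> f v \<le> g v) \<Longrightarrow> mean f \<le> mean g"
  unfolding mean_def by (intro sum_mono mult_left_mono \<pi>_nonneg)

lemma mean_add: "mean (\<lambda>v. f v + g v) = mean f + mean g"
  by (simp add: mean_def algebra_simps sum.distrib)

lemma mean_diff: "mean (\<lambda>v. f v - g v) = mean f - mean g"
  by (simp add: mean_def algebra_simps sum_subtractf)

lemma mean_scale: "mean (\<lambda>v. c * f v) = c * mean f"
  by (simp add: mean_def sum_distrib_left mult_ac)

lemma mean_const: "mean (\<lambda>v. c) = c"
  using sum_\<pi> by (simp add: mean_def flip: sum_distrib_right)

lemma mean_nonneg: "(\<And>v. v \<in> V \<Longrightarrow> 0 \<le> f v) \<Longrightarrow> 0 \<le> mean f"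
  unfolding mean_def by (intro sum_nonneg mult_nonneg_nonneg \<pi>_nonneg)

lemma mean_indicator:
  assumes "U \<subseteq> V"
  shows "mean (\<lambda>v. of_bool (v \<in> U)) = sum \<pi> U"
proof -
  have "V \<inter> {v. v \<in> U} = U"
    using assms by blast
  then show ?thesis
    using finite_vertices by (simp add: mean_def)
qed

lemma energy_nonneg: "0 \<le> energy f"
  unfolding energy_def by (intro sum_nonneg mult_nonneg_nonneg w_nonneg) simp

lemma \<pi>_lazy:
  assumes "v \<in> V"
  shows "\<pi> v * lazy f v = (\<Sum>u\<in>V. w v u * ((f v + f u) / 2))"
proof -
  have "\<pi> v * lazy f v = (\<pi> v * f v + (\<Sum>u\<in>V. w v u * f u)) / 2"
    using \<pi>_pos[OF assms] by (simp add: lazy_def field_simps)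
  also have "\<pi> v * f v = (\<Sum>u\<in>V. w v u * f v)"
    by (simp add: \<pi>_def sum_distrib_right)
  finally show ?thesis
    by (simp add: sum.distrib[symmetric] sum_divide_distrib distrib_left)
qed

lemma mean_mult_lazy:
  "mean (\<lambda>v. f v * lazy g v) = (mean (\<lambda>v. f v * g v) + (\<Sum>v\<in>V. \<Sum>u\<in>V. w v u * (f v * g u))) / 2"
proof -
  have "mean (\<lambda>v. f v * lazy g v) = (\<Sum>v\<in>V. f v * (\<pi> v * lazy g v))"
    by (simp add: mean_def mult_ac)
  also have "\<dots> = (\<Sum>v\<in>V. f v * (\<Sum>u\<in>V. w v u * ((g v + g u) / 2)))"
    by (intro sum.cong refl arg_cong2[where f = "(*)"] \<pi>_lazy)
  also have "\<dots> = ((\<Sum>v\<in>V. \<Sum>u\<in>V. w v u * (f v * g v)) + (\<Sum>v\<in>V. \<Sum>u\<in>V. w v u * (f v * g u))) / 2"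
    by (simp add: sum_divide_distrib sum.distrib[symmetric] distrib_left sum_distrib_left mult_ac
      add_divide_distrib)
  finally show ?thesis
    by (simp add: sum_w_fst)
qed

lemma lazy_self_adjoint: "mean (\<lambda>v. f v * lazy g v) = mean (\<lambda>v. lazy f v * g v)"
proof -
  have "(\<Sum>v\<in>V. \<Sum>u\<in>V. w v u * (f v * g u)) = (\<Sum>u\<in>V. \<Sum>v\<in>V. w v u * (f v * g u))"
    by (rule sum.swap)
  also have "\<dots> = (\<Sum>v\<in>V. \<Sum>u\<in>V. w v u * (g v * f u))"
  proof (intro sum.cong refl)
    fix x y show "w x y * (f x * g y) = w y x * (g y * f x)"
      using w_sym[of x y] by (simp add: mult_ac)
  qed
  finally have "mean (\<lambda>v. f v * lazy g v) = mean (\<lambda>v. g v * lazy f v)"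
    unfolding mean_mult_lazy by (simp add: mult_ac)
  then show ?thesis
    by (simp add: mult_ac)
qed

lemma lazy_pow_self_adjoint: "mean (\<lambda>v. f v * (lazy ^^ t) g v) = mean (\<lambda>v. (lazy ^^ t) f v * g v)"
proof (induction t arbitrary: f)
  case (Suc t)
  have "mean (\<lambda>v. f v * (lazy ^^ Suc t) g v) = mean (\<lambda>v. lazy f v * (lazy ^^ t) g v)"
    using lazy_self_adjoint[of f "(lazy ^^ t) g"] by simp
  also have "\<dots> = mean (\<lambda>v. (lazy ^^ t) (lazy f) v * g v)"
    by (rule Suc)
  also have "(lazy ^^ t) (lazy f) = (lazy ^^ Suc t) f"
    by (simp add: funpow_swap1)
  finally show ?case .
qed simp

lemma mean_lazy: "mean (lazy f) = mean f"
  using mean_mult_lazy[of "\<lambda>_. 1" f] by (simp add: sum_w_snd)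

lemma mean_lazy_pow: "mean ((lazy ^^ t) f) = mean f"
  by (induction t) (simp_all add: mean_lazy)

lemma lazy_scale: "lazy (\<lambda>v. c * f v) = (\<lambda>v. c * lazy f v)"
  by (auto simp: lazy_def sum_distrib_left mult_ac add_divide_distrib distrib_left intro!: ext)

lemma lazy_pow_scale: "(lazy ^^ t) (\<lambda>v. c * f v) = (\<lambda>v. c * (lazy ^^ t) f v)"
  by (induction t) (simp_all add: lazy_scale)

lemma lazy_nonneg: "(\<And>v. 0 \<le> f v) \<Longrightarrow> 0 \<le> lazy f v"
  unfolding lazy_def
  by (intro divide_nonneg_nonneg add_nonneg_nonneg sum_nonneg mult_nonneg_nonneg w_nonneg \<pi>_nonneg) auto

lemma lazy_pow_nonneg: "(\<And>v. 0 \<le> f v) \<Longrightarrow> 0 \<le> (lazy ^^ t) f v"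
  by (induction t arbitrary: v) (simp_all add: lazy_nonneg)

lemma lazy_contraction: "mean (\<lambda>v. (lazy f v)\<^sup>2) \<le> mean (\<lambda>v. (f v)\<^sup>2) - energy f / 4"
proof -
  have "\<pi> v * (lazy f v)\<^sup>2 \<le> (\<Sum>u\<in>V. w v u * ((f v + f u) / 2)\<^sup>2)" if v: "v \<in> V" for v
  proof -
    have "(\<pi> v * lazy f v)\<^sup>2 \<le> \<pi> v * (\<Sum>u\<in>V. w v u * ((f v + f u) / 2)\<^sup>2)"
      using weighted_Cauchy_Schwarz[of V "w v" "\<lambda>u. 1" "\<lambda>u. (f v + f u) / 2"] w_nonneg \<pi>_lazy[OF v, of f]
      by (simp add: \<pi>_def)
    then have "\<pi> v * (\<pi> v * (lazy f v)\<^sup>2) \<le> \<pi> v * (\<Sum>u\<in>V. w v u * ((f v + f u) / 2)\<^sup>2)"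
      by (simp add: power2_eq_square mult_ac)
    then show ?thesis
      using \<pi>_pos[OF v] by simp
  qed
  then have "mean (\<lambda>v. (lazy f v)\<^sup>2) \<le> (\<Sum>v\<in>V. \<Sum>u\<in>V. w v u * ((f v + f u) / 2)\<^sup>2)"
    unfolding mean_def by (rule sum_mono)
  also have "\<dots> = (\<Sum>v\<in>V. \<Sum>u\<in>V. (w v u * (f v)\<^sup>2) / 2 + (w v u * (f u)\<^sup>2) / 2 - (w v u * (f v - f u)\<^sup>2) / 4)"
    by (intro sum.cong refl) (simp add: power2_eq_square field_simps)
  also have "\<dots> = (\<Sum>v\<in>V. \<Sum>u\<in>V. w v u * (f v)\<^sup>2) / 2 + (\<Sum>v\<in>V. \<Sum>u\<in>V. w v u * (f u)\<^sup>2) / 2 - energy f / 4"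
    by (simp add: energy_def sum.distrib sum_subtractf sum_divide_distrib)
  also have "\<dots> = mean (\<lambda>v. (f v)\<^sup>2) - energy f / 4"
    by (simp add: sum_w_fst[of "\<lambda>v. (f v)\<^sup>2"] sum_w_snd[of "\<lambda>v. (f v)\<^sup>2"])
  finally show ?thesis .
qed

lemma sum_w_boundary:
  assumes "U \<subseteq> V"
  shows "(\<Sum>v\<in>V. \<Sum>u\<in>V. w v u * of_bool (v \<in> U \<and> u \<notin> U)) = flow_out U"
    and "(\<Sum>v\<in>V. \<Sum>u\<in>V. w v u * of_bool (u \<in> U \<and> v \<notin> U)) = flow_out U"
proof -
  have "(\<Sum>u\<in>V. w v u * of_bool (v \<in> U \<and> u \<notin> U)) = of_bool (v \<in> U) * (\<Sum>u\<in>V - U. w v u)" for v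
    using finite_vertices by (auto intro!: sum.mono_neutral_cong_right)
  then show out: "(\<Sum>v\<in>V. \<Sum>u\<in>V. w v u * of_bool (v \<in> U \<and> u \<notin> U)) = flow_out U"
    using finite_vertices assms by (auto simp: flow_out_def intro!: sum.mono_neutral_cong_right)
  have "(\<Sum>v\<in>V. \<Sum>u\<in>V. w v u * of_bool (u \<in> U \<and> v \<notin> U)) = (\<Sum>u\<in>V. \<Sum>v\<in>V. w u v * of_bool (u \<in> U \<and> v \<notin> U))"
    by (subst sum.swap) (simp only: w_sym)
  then show "(\<Sum>v\<in>V. \<Sum>u\<in>V. w v u * of_bool (u \<in> U \<and> v \<notin> U)) = flow_out U"
    using out by simp
qed

lemma variation_peel:
  assumes U: "U \<subseteq> V" and \<mu>: "0 \<le> \<mu>" and F: "\<And>v. v \<in> V \<Longrightarrow> 0 \<le> F v" "\<And>v. v \<in> V - U \<Longrightarrow> F v = 0"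
  shows "variation (\<lambda>v. F v + \<mu> * of_bool (v \<in> U)) = variation F + 2 * \<mu> * flow_out U"
proof -
  have "\<bar>F v + \<mu> * of_bool (v \<in> U) - (F u + \<mu> * of_bool (u \<in> U))\<bar>
      = \<bar>F v - F u\<bar> + \<mu> * of_bool (v \<in> U \<and> u \<notin> U) + \<mu> * of_bool (u \<in> U \<and> v \<notin> U)" if "v \<in> V" "u \<in> V" for u v
    using that F(1)[of u] F(1)[of v] F(2)[of u] F(2)[of v] \<mu> by (cases "v \<in> U"; cases "u \<in> U") auto
  then have "variation (\<lambda>v. F v + \<mu> * of_bool (v \<in> U)) = (\<Sum>v\<in>V. \<Sum>u\<in>V. w v u * \<bar>F v - F u\<bar>
      + \<mu> * (w v u * of_bool (v \<in> U \<and> u \<notin> U)) + \<mu> * (w v u * of_bool (u \<in> U \<and> v \<notin> U)))"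
    unfolding variation_def by (intro sum.cong refl) (simp add: algebra_simps)
  also have "\<dots> = variation F + \<mu> * flow_out U + \<mu> * flow_out U"
    by (simp only: variation_def sum.distrib sum_distrib_left[symmetric] sum_w_boundary[OF U])
  finally show ?thesis
    by simp
qed

lemma peel_support:
  fixes F :: "'a \<Rightarrow> real"
  assumes F: "\<And>v. v \<in> V \<Longrightarrow> 0 \<le> F v"
  defines "U \<equiv> {v \<in> V. 0 < F v}"
  assumes "U \<noteq> {}"
  obtains \<mu> F' where "0 < \<mu>" "F = (\<lambda>v. F' v + \<mu> * of_bool (v \<in> U))" "\<And>v. v \<in> V \<Longrightarrow> 0 \<le> F' v"
    "\<And>v. v \<in> V - U \<Longrightarrow> F' v = 0" "{v \<in> V. 0 < F' v} \<subset> U"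
proof -
  define \<mu> where "\<mu> = Min (F ` U)"
  define F' where "F' v = F v - \<mu> * of_bool (v \<in> U)" for v
  have U: "finite U"
    using finite_vertices by (simp add: U_def)
  then have "\<mu> \<in> F ` U"
    unfolding \<mu>_def using assms(3) by (intro Min_in) auto
  then obtain z where z: "z \<in> U" "F z = \<mu>"
    by auto
  have outside: "F v = 0" if "v \<in> V - U" for v
    using that F[of v] by (auto simp: U_def)
  show thesis
  proof (rule that[of \<mu> F'])
    show "0 < \<mu>"
      using z by (simp add: U_def)
    show "0 \<le> F' v" if "v \<in> V" for v
      using that U outside[of v] by (cases "v \<in> U") (auto simp: F'_def \<mu>_def)
    have "v \<in> U - {z}" if "v \<in> V" "0 < F' v" for v
      using that z outside[of v] by (cases "v \<in> U") (auto simp: F'_def)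
    then show "{v \<in> V. 0 < F' v} \<subset> U"
      using z(1) by blast
  qed (auto simp: F'_def outside)
qed

text \<open>Peels off the superlevel sets of \<open>F\<close> one at a time, starting with the support.\<close>

lemma coarea:
  assumes "\<And>v. v \<in> V \<Longrightarrow> 0 \<le> F v" and "\<And>U. \<lbrakk>U \<subseteq> {v \<in> V. 0 < F v}; U \<noteq> {}\<rbrakk> \<Longrightarrow> \<psi> * sum \<pi> U \<le> flow_out U"
  shows "2 * \<psi> * mean F \<le> variation F"
  using assms
proof (induction "card {v \<in> V. 0 < F v}" arbitrary: F rule: less_induct)
  case less
  define U where "U = {v \<in> V. 0 < F v}"
  have U: "U \<subseteq> V" "finite U"
    using finite_vertices by (auto simp: U_def)
  show ?case
  proof (cases "U = {}")
    case True
    then have "F v = 0" if "v \<in> V" for v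
      using that less.prems(1)[of v] by (force simp: U_def)
    then show ?thesis
      by (simp add: mean_def variation_def)
  next
    case False
    obtain \<mu> F' where \<mu>: "0 < \<mu>" and F: "F = (\<lambda>v. F' v + \<mu> * of_bool (v \<in> U))"
      and F': "\<And>v. v \<in> V \<Longrightarrow> 0 \<le> F' v" "\<And>v. v \<in> V - U \<Longrightarrow> F' v = 0"
      and support: "{v \<in> V. 0 < F' v} \<subset> U"
      by (rule peel_support[OF less.prems(1) False[unfolded U_def], folded U_def]) (assumption | rule that)+
    have IH: "2 * \<psi> * mean F' \<le> variation F'"
    proof (rule less.hyps[OF _ F'(1)])
      show "card {v \<in> V. 0 < F' v} < card {v \<in> V. 0 < F v}"
        using psubset_card_mono[OF U(2) support] by (simp add: U_def)
      show "\<psi> * sum \<pi> X \<le> flow_out X" if "X \<subseteq> {v \<in> V. 0 < F' v}" "X \<noteq> {}" for X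
        using that support unfolding U_def by (intro less.prems(2)) auto
    qed
    have "\<psi> * sum \<pi> U \<le> flow_out U"
      using less.prems(2)[of U] False by (simp add: U_def)
    then have "2 * \<mu> * (\<psi> * sum \<pi> U) \<le> 2 * \<mu> * flow_out U"
      using \<mu> by (intro mult_left_mono) auto
    moreover have "variation F = variation F' + 2 * \<mu> * flow_out U"
      unfolding F using F' \<mu> by (intro variation_peel[OF U(1)]) auto
    moreover have "mean F = mean F' + \<mu> * sum \<pi> U"
      unfolding F mean_add mean_scale mean_indicator[OF U(1)] ..
    ultimately show ?thesis
      using IH by (simp add: algebra_simps)
  qed
qed

lemma sum_w_Cauchy_Schwarz:
  "(\<Sum>v\<in>V. \<Sum>u\<in>V. w v u * (a v u * b v u))\<^sup>2
    \<le> (\<Sum>v\<in>V. \<Sum>u\<in>V. w v u * (a v u)\<^sup>2) * (\<Sum>v\<in>V. \<Sum>u\<in>V. w v u * (b v u)\<^sup>2)"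
  using weighted_Cauchy_Schwarz[of "V \<times> V" "\<lambda>(v, u). w v u" "\<lambda>(v, u). a v u" "\<lambda>(v, u). b v u"] w_nonneg
  by (simp add: sum.cartesian_product case_prod_beta)

lemma sum_w_square_add_le: "(\<Sum>v\<in>V. \<Sum>u\<in>V. w v u * (g v + g u)\<^sup>2) \<le> 4 * mean (\<lambda>v. (g v)\<^sup>2)"
proof -
  have "(\<Sum>v\<in>V. \<Sum>u\<in>V. w v u * (g v + g u)\<^sup>2) \<le> (\<Sum>v\<in>V. \<Sum>u\<in>V. w v u * (2 * (g v)\<^sup>2) + w v u * (2 * (g u)\<^sup>2))"
  proof (intro sum_mono)
    fix v u
    have "(g v + g u)\<^sup>2 \<le> 2 * (g v)\<^sup>2 + 2 * (g u)\<^sup>2"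
      using zero_le_power2[of "g v - g u"] by (simp add: power2_eq_square algebra_simps)
    then show "w v u * (g v + g u)\<^sup>2 \<le> w v u * (2 * (g v)\<^sup>2) + w v u * (2 * (g u)\<^sup>2)"
      unfolding distrib_left[symmetric] by (intro mult_left_mono w_nonneg)
  qed
  also have "\<dots> = mean (\<lambda>v. 2 * (g v)\<^sup>2) + mean (\<lambda>v. 2 * (g v)\<^sup>2)"
    by (simp only: sum.distrib sum_w_fst[of "\<lambda>v. 2 * (g v)\<^sup>2"] sum_w_snd[of "\<lambda>v. 2 * (g v)\<^sup>2"])
  finally show ?thesis
    by (simp add: mean_scale)
qed

lemma variation_square_le:
  assumes g: "\<And>v. v \<in> V \<Longrightarrow> 0 \<le> g v"
  shows "(variation (\<lambda>v. (g v)\<^sup>2))\<^sup>2 \<le> energy g * (4 * mean (\<lambda>v. (g v)\<^sup>2))"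
proof -
  have "\<bar>(g v)\<^sup>2 - (g u)\<^sup>2\<bar> = \<bar>g v - g u\<bar> * (g v + g u)" if "v \<in> V" "u \<in> V" for v u
  proof -
    have "(g v)\<^sup>2 - (g u)\<^sup>2 = (g v - g u) * (g v + g u)"
      by (simp add: power2_eq_square algebra_simps)
    then show ?thesis
      using g[OF that(1)] g[OF that(2)] by (simp add: abs_mult)
  qed
  then have "variation (\<lambda>v. (g v)\<^sup>2) = (\<Sum>v\<in>V. \<Sum>u\<in>V. w v u * (\<bar>g v - g u\<bar> * (g v + g u)))"
    unfolding variation_def by (intro sum.cong refl) simp
  then have "(variation (\<lambda>v. (g v)\<^sup>2))\<^sup>2 \<le> energy g * (\<Sum>v\<in>V. \<Sum>u\<in>V. w v u * (g v + g u)\<^sup>2)"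
    using sum_w_Cauchy_Schwarz[of "\<lambda>v u. \<bar>g v - g u\<bar>" "\<lambda>v u. g v + g u"] by (simp add: energy_def)
  also have "\<dots> \<le> energy g * (4 * mean (\<lambda>v. (g v)\<^sup>2))"
    by (intro mult_left_mono sum_w_square_add_le energy_nonneg)
  finally show ?thesis .
qed

lemma Cheeger:
  assumes g: "\<And>v. v \<in> V \<Longrightarrow> 0 \<le> g v" and \<psi>: "0 \<le> \<psi>"
    and U: "\<And>U. \<lbrakk>U \<subseteq> {v \<in> V. 0 < g v}; U \<noteq> {}\<rbrakk> \<Longrightarrow> \<psi> * sum \<pi> U \<le> flow_out U"
  shows "\<psi>\<^sup>2 * mean (\<lambda>v. (g v)\<^sup>2) \<le> energy g"
proof -
  define N where "N = mean (\<lambda>v. (g v)\<^sup>2)"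
  have N: "0 \<le> N"
    unfolding N_def by (intro mean_nonneg) simp
  have "2 * \<psi> * N \<le> variation (\<lambda>v. (g v)\<^sup>2)"
    unfolding N_def using U by (intro coarea) (auto simp: zero_less_power2 less_le g dest: g)
  then have "(2 * \<psi> * N)\<^sup>2 \<le> (variation (\<lambda>v. (g v)\<^sup>2))\<^sup>2"
    using \<psi> N by (intro power_mono) auto
  also have "\<dots> \<le> energy g * (4 * N)"
    unfolding N_def by (rule variation_square_le[OF g])
  finally have "N * (\<psi>\<^sup>2 * N) \<le> N * energy g"
    by (simp add: power2_eq_square mult_ac)
  then show ?thesis
    using N energy_nonneg[of g] unfolding N_def[symmetric] by (cases "N = 0") auto
qed

lemma energy_mono:
  assumes "\<And>v u. \<lbrakk>v \<in> V; u \<in> V\<rbrakk> \<Longrightarrow> (g v - g u)\<^sup>2 + (h v - h u)\<^sup>2 \<le> (f v - f u)\<^sup>2"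
  shows "energy g + energy h \<le> energy f"
  unfolding energy_def sum.distrib[symmetric] distrib_left[symmetric]
  using assms by (intro sum_mono mult_left_mono w_nonneg)

lemma energy_positive_negative_parts: "energy (\<lambda>v. max 0 (f v - c)) + energy (\<lambda>v. max 0 (c - f v)) \<le> energy f"
proof (rule energy_mono)
  fix v u
  have "(max 0 x - max 0 y)\<^sup>2 + (max 0 (- x) - max 0 (- y))\<^sup>2 \<le> (x - y)\<^sup>2" for x y :: real
  proof (cases "0 \<le> x"; cases "0 \<le> y")
    assume xy: "0 \<le> x" "\<not> 0 \<le> y"
    then have "x * y \<le> 0"
      by (simp add: mult_nonneg_nonpos)
    then show ?thesis
      using xy by (simp add: power2_eq_square algebra_simps max_def)
  next
    assume xy: "\<not> 0 \<le> x" "0 \<le> y"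
    then have "x * y \<le> 0"
      by (simp add: mult_nonpos_nonneg)
    then show ?thesis
      using xy by (simp add: power2_eq_square algebra_simps max_def)
  qed (auto simp: max_def power2_eq_square algebra_simps)
  from this[of "f v - c" "f u - c"]
  show "(max 0 (f v - c) - max 0 (f u - c))\<^sup>2 + (max 0 (c - f v) - max 0 (c - f u))\<^sup>2 \<le> (f v - f u)\<^sup>2"
    by simp
qed

lemma Markov_level:
  assumes "\<And>v. v \<in> V \<Longrightarrow> 0 \<le> f v" "0 < c"
  shows "sum \<pi> {v \<in> V. c < f v} \<le> mean f / c"
proof -
  have "c * sum \<pi> {v \<in> V. c < f v} = (\<Sum>v\<in>{v \<in> V. c < f v}. \<pi> v * c)"
    by (simp add: sum_distrib_left mult.commute)
  also have "\<dots> \<le> (\<Sum>v\<in>{v \<in> V. c < f v}. \<pi> v * f v)"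
    by (intro sum_mono mult_left_mono \<pi>_nonneg) auto
  also have "\<dots> \<le> mean f"
    unfolding mean_def using finite_vertices assms(1) \<pi>_nonneg by (intro sum_mono2) auto
  finally show ?thesis
    using assms(2) by (simp add: field_simps)
qed

lemma median_exists:
  fixes f :: "'a \<Rightarrow> real"
  obtains c where "sum \<pi> {v \<in> V. c < f v} \<le> 1 / 2" "sum \<pi> {v \<in> V. f v < c} \<le> 1 / 2"
proof -
  define X where "X = {x \<in> f ` V. 1 / 2 \<le> sum \<pi> {v \<in> V. f v \<le> x}}"
  define c where "c = Min X"
  have "V \<noteq> {}"
    using sum_\<pi> by auto
  moreover have "{v \<in> V. f v \<le> Max (f ` V)} = V"
    using finite_vertices by auto
  ultimately have "Max (f ` V) \<in> X"
    using finite_vertices sum_\<pi> by (simp add: X_def)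
  moreover have "finite X"
    using finite_vertices by (simp add: X_def)
  ultimately have X: "finite X" "c \<in> X"
    using Min_in[of X] unfolding c_def by blast+
  have "{v \<in> V. c < f v} = V - {v \<in> V. f v \<le> c}"
    by auto
  then have "sum \<pi> {v \<in> V. c < f v} = 1 - sum \<pi> {v \<in> V. f v \<le> c}"
    using finite_vertices sum_\<pi> by (simp add: sum_diff)
  then have upper: "sum \<pi> {v \<in> V. c < f v} \<le> 1 / 2"
    using X(2) by (simp add: X_def)
  have lower: "sum \<pi> {v \<in> V. f v < c} \<le> 1 / 2"
  proof (cases "{v \<in> V. f v < c} = {}")
    case False
    define y where "y = Max (f ` {v \<in> V. f v < c})"
    have y: "y \<in> f ` {v \<in> V. f v < c}"
      unfolding y_def using finite_vertices False by (intro Max_in) auto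
    then have "y \<notin> X"
      using Min_le[OF X(1), of y] by (auto simp: c_def)
    moreover have "sum \<pi> {v \<in> V. f v < c} \<le> sum \<pi> {v \<in> V. f v \<le> y}"
      using finite_vertices by (intro sum_\<pi>_mono) (auto simp: y_def intro: Max_ge)
    ultimately show ?thesis
      using y by (auto simp: X_def)
  qed (simp only: sum.empty)
  show thesis
    using upper lower by (rule that)
qed

lemma variance:
  assumes "mean f = 1"
  shows "mean (\<lambda>v. (f v - c)\<^sup>2) = mean (\<lambda>v. (f v)\<^sup>2) - 1 + (1 - c)\<^sup>2"
proof -
  have "mean (\<lambda>v. (f v - c)\<^sup>2) = mean (\<lambda>v. ((f v)\<^sup>2 + c\<^sup>2) - 2 * c * f v)"
    by (simp add: power2_eq_square algebra_simps)
  also have "\<dots> = mean (\<lambda>v. (f v)\<^sup>2) + c\<^sup>2 - 2 * c * 1"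
    by (simp only: mean_diff mean_add mean_scale mean_const assms)
  finally show ?thesis
    by (simp add: power2_eq_square algebra_simps)
qed

lemma mean_square_truncate_ge:
  assumes f: "\<And>v. 0 \<le> f v" and c_nonneg: "0 \<le> c"
  shows "mean (\<lambda>v. (f v)\<^sup>2) - 2 * c * mean f \<le> mean (\<lambda>v. (max 0 (f v - c))\<^sup>2)"
proof -
  have "(f v)\<^sup>2 - 2 * c * f v \<le> (max 0 (f v - c))\<^sup>2" for v
  proof (cases "c \<le> f v")
    case False
    then have "f v * (f v - 2 * c) \<le> 0"
      using f[of v] c_nonneg by (intro mult_nonneg_nonpos) auto
    then show ?thesis
      using False by (simp add: power2_eq_square algebra_simps)
  qed (simp add: power2_eq_square algebra_simps)
  then have "mean (\<lambda>v. (f v)\<^sup>2 - 2 * c * f v) \<le> mean (\<lambda>v. (max 0 (f v - c))\<^sup>2)"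
    by (rule mean_mono)
  then show ?thesis
    by (simp only: mean_diff mean_scale)
qed

lemma mean_product_ge:
  assumes "mean f = 1" "mean g = 1" and dev: "mean (\<lambda>v. (f v - 1)\<^sup>2) \<le> \<epsilon>" "mean (\<lambda>v. (g v - 1)\<^sup>2) \<le> \<epsilon>"
  shows "1 - \<epsilon> \<le> mean (\<lambda>v. f v * g v)"
proof -
  have "mean (\<lambda>v. f v * g v) = mean (\<lambda>v. (f v + g v - 1) + (f v - 1) * (g v - 1))"
    by (simp add: algebra_simps)
  also have "\<dots> = 1 + mean (\<lambda>v. (f v - 1) * (g v - 1))"
    by (simp only: mean_add mean_diff mean_const assms(1,2))
  finally have product: "mean (\<lambda>v. f v * g v) = 1 + mean (\<lambda>v. (f v - 1) * (g v - 1))" .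
  have "0 \<le> ((f v - 1)\<^sup>2 + (g v - 1)\<^sup>2) + 2 * ((f v - 1) * (g v - 1))" for v
    using zero_le_power2[of "(f v - 1) + (g v - 1)"] by (simp add: power2_eq_square algebra_simps)
  then have "0 \<le> mean (\<lambda>v. ((f v - 1)\<^sup>2 + (g v - 1)\<^sup>2) + 2 * ((f v - 1) * (g v - 1)))"
    by (intro mean_nonneg)
  then have "0 \<le> (mean (\<lambda>v. (f v - 1)\<^sup>2) + mean (\<lambda>v. (g v - 1)\<^sup>2)) + 2 * mean (\<lambda>v. (f v - 1) * (g v - 1))"
    by (simp only: mean_scale mean_add)
  then show ?thesis
    using dev unfolding product by linarith
qed

definition point_density :: "'a \<Rightarrow> 'a \<Rightarrow> real" where
  "point_density c v = (1 / \<pi> c) * of_bool (v = c)"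

lemma point_density_nonneg: "0 \<le> point_density c v"
  using \<pi>_nonneg by (simp add: point_density_def)

lemma mean_point_density_mult:
  assumes "c \<in> V"
  shows "mean (\<lambda>v. point_density c v * g v) = g c"
proof -
  have "mean (\<lambda>v. point_density c v * g v) = (\<Sum>v\<in>V. if v = c then g c else 0)"
    unfolding mean_def using \<pi>_pos[OF assms] by (intro sum.cong refl) (auto simp: point_density_def)
  then show ?thesis
    using finite_vertices assms by simp
qed

lemma mean_point_density: "c \<in> V \<Longrightarrow> mean (point_density c) = 1"
  using mean_point_density_mult[of c "\<lambda>_. 1"] by simp

end

lemma inverse_growth:
  fixes y y' \<delta> :: real
  assumes "0 < y" "0 < y'" "0 \<le> \<delta>" "y' \<le> y - \<delta> * y\<^sup>2"
  shows "1 / y + \<delta> \<le> 1 / y'"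
proof -
  have "(1 / y + \<delta>) * y' \<le> (1 / y + \<delta>) * (y - \<delta> * y\<^sup>2)"
    using assms by (intro mult_left_mono) auto
  also have "\<dots> = 1 - (\<delta> * y)\<^sup>2"
    using assms(1) by (simp add: field_simps power2_eq_square)
  also have "\<dots> \<le> 1"
    by simp
  finally show ?thesis
    using assms(2) by (simp add: pos_le_divide_eq)
qed

lemma exp_minus_4_le: "exp (- 4 :: real) \<le> 1 / 28"
proof -
  have "(5 / 2 :: real) ^ 4 \<le> exp 1 ^ 4"
    using exp_lower_Taylor_quadratic[of 1] by (intro power_mono) auto
  also have "exp 1 ^ 4 = exp (4 :: real)"
    by (simp flip: exp_of_nat_mult)
  finally have "28 \<le> exp (4 :: real)"
    by (simp add: power_divide)
  then show ?thesis
    by (simp add: exp_minus field_simps)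
qed

locale expanding_network = network +
  fixes \<kappa> :: real
  assumes \<kappa>_pos: "0 < \<kappa>"
    and expansion: "\<lbrakk>U \<subseteq> V; U \<noteq> {}; sum \<pi> U \<le> 1 / 2\<rbrakk> \<Longrightarrow> \<kappa> * (1 + ln (1 / sum \<pi> U)) * sum \<pi> U \<le> flow_out U"
begin

lemma expansion_small:
  assumes "U \<subseteq> V" "U \<noteq> {}" "sum \<pi> U \<le> p" "p \<le> 1 / 2"
  shows "\<kappa> * (1 + ln (1 / p)) * sum \<pi> U \<le> flow_out U"
proof -
  have pos: "0 < sum \<pi> U"
    using assms(1,2) \<pi>_pos finite_subset[OF assms(1) finite_vertices] by (intro sum_pos) auto
  then have "ln (1 / p) \<le> ln (1 / sum \<pi> U)"
    using assms(3) by (simp add: ln_div)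
  then have "\<kappa> * (1 + ln (1 / p)) * sum \<pi> U \<le> \<kappa> * (1 + ln (1 / sum \<pi> U)) * sum \<pi> U"
    using \<kappa>_pos pos by (intro mult_right_mono mult_left_mono) auto
  also have "\<dots> \<le> flow_out U"
    using assms by (intro expansion) auto
  finally show ?thesis .
qed

lemma expansion_within_half:
  assumes "U \<subseteq> W" "U \<noteq> {}" "W \<subseteq> V" "sum \<pi> W \<le> 1 / 2"
  shows "\<kappa> * sum \<pi> U \<le> flow_out U"
proof -
  have "\<kappa> * (1 + ln (1 / (1 / 2))) * sum \<pi> U \<le> flow_out U"
    using assms sum_\<pi>_mono[of U W] by (intro expansion_small) auto
  moreover have "\<kappa> * sum \<pi> U \<le> \<kappa> * (1 + ln (1 / (1 / 2))) * sum \<pi> U"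
    using \<kappa>_pos mult_left_mono[of 1 "1 + ln 2" \<kappa>] by (intro mult_right_mono sum_nonneg \<pi>_nonneg) auto
  ultimately show ?thesis
    by linarith
qed

text \<open>Truncating at a quarter of the second moment leaves at least half of it on a set of measure at most
  \<open>4 / mean f\<^sup>2\<close>, where the expansion is better the larger the second moment is.\<close>

lemma early_decay:
  assumes f: "\<And>v. 0 \<le> f v" "mean f = 1" and Q: "8 \<le> mean (\<lambda>v. (f v)\<^sup>2)"
  shows "mean (\<lambda>v. (lazy f v)\<^sup>2) \<le> mean (\<lambda>v. (f v)\<^sup>2) * (1 - (\<kappa> * (1 + ln (mean (\<lambda>v. (f v)\<^sup>2) / 4)))\<^sup>2 / 8)"
proof -
  define Q where "Q = mean (\<lambda>v. (f v)\<^sup>2)"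
  define c where "c = Q / 4"
  define g where "g v = max 0 (f v - c)" for v
  define \<psi> where "\<psi> = \<kappa> * (1 + ln c)"
  have c_ge_2: "2 \<le> c"
    using Q by (simp add: c_def Q_def)
  have "\<psi>\<^sup>2 * mean (\<lambda>v. (g v)\<^sup>2) \<le> energy g"
  proof (rule Cheeger)
    fix U assume U: "U \<subseteq> {v \<in> V. 0 < g v}" "U \<noteq> {}"
    then have level: "U \<subseteq> {v \<in> V. c < f v}"
      by (auto simp: g_def split: if_splits)
    then have "sum \<pi> U \<le> sum \<pi> {v \<in> V. c < f v}"
      by (intro sum_\<pi>_mono) auto
    also have "\<dots> \<le> 1 / c"
      using Markov_level[of f c] f c_ge_2 by simp
    finally have "\<kappa> * (1 + ln (1 / (1 / c))) * sum \<pi> U \<le> flow_out U"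
      using level U(2) c_ge_2 by (intro expansion_small) (auto simp: field_simps)
    then show "\<psi> * sum \<pi> U \<le> flow_out U"
      by (simp add: \<psi>_def)
  qed (use \<kappa>_pos c_ge_2 in \<open>auto simp: g_def \<psi>_def\<close>)
  moreover have "energy g \<le> energy f"
    using energy_positive_negative_parts[of f c] energy_nonneg[of "\<lambda>v. max 0 (c - f v)"]
    by (simp add: g_def[abs_def])
  moreover have "Q / 2 \<le> mean (\<lambda>v. (g v)\<^sup>2)"
    using mean_square_truncate_ge[of f c] f c_ge_2 unfolding g_def Q_def[symmetric] by (simp add: c_def)
  ultimately have "\<psi>\<^sup>2 * (Q / 2) \<le> energy f"
    using mult_left_mono[of "Q / 2" "mean (\<lambda>v. (g v)\<^sup>2)" "\<psi>\<^sup>2"] by simp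
  then have "mean (\<lambda>v. (lazy f v)\<^sup>2) \<le> Q - \<psi>\<^sup>2 * (Q / 2) / 4"
    using lazy_contraction[of f] unfolding Q_def[symmetric] by linarith
  also have "\<dots> = Q * (1 - \<psi>\<^sup>2 / 8)"
    by (simp add: algebra_simps)
  finally show ?thesis
    unfolding \<psi>_def c_def Q_def .
qed

lemma late_decay:
  assumes f: "mean f = 1"
  shows "mean (\<lambda>v. (lazy f v)\<^sup>2) - 1 \<le> (mean (\<lambda>v. (f v)\<^sup>2) - 1) * (1 - \<kappa>\<^sup>2 / 4)"
proof -
  obtain c where median: "sum \<pi> {v \<in> V. c < f v} \<le> 1 / 2" "sum \<pi> {v \<in> V. f v < c} \<le> 1 / 2"
    by (rule median_exists)
  define g where "g v = max 0 (f v - c)" for v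
  define h where "h v = max 0 (c - f v)" for v
  have "\<kappa>\<^sup>2 * mean (\<lambda>v. (g v)\<^sup>2) \<le> energy g"
  proof (rule Cheeger)
    show "\<kappa> * sum \<pi> U \<le> flow_out U" if "U \<subseteq> {v \<in> V. 0 < g v}" "U \<noteq> {}" for U
      using that by (intro expansion_within_half[OF _ _ _ median(1)]) (auto simp: g_def split: if_splits)
  qed (use \<kappa>_pos in \<open>auto simp: g_def\<close>)
  moreover have "\<kappa>\<^sup>2 * mean (\<lambda>v. (h v)\<^sup>2) \<le> energy h"
  proof (rule Cheeger)
    show "\<kappa> * sum \<pi> U \<le> flow_out U" if "U \<subseteq> {v \<in> V. 0 < h v}" "U \<noteq> {}" for U
      using that by (intro expansion_within_half[OF _ _ _ median(2)]) (auto simp: h_def split: if_splits)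
  qed (use \<kappa>_pos in \<open>auto simp: h_def\<close>)
  moreover have "energy g + energy h \<le> energy f"
    unfolding g_def h_def by (rule energy_positive_negative_parts)
  moreover have "mean (\<lambda>v. (g v)\<^sup>2) + mean (\<lambda>v. (h v)\<^sup>2) = mean (\<lambda>v. (f v - c)\<^sup>2)"
    unfolding mean_add[symmetric]
    by (rule arg_cong[where f = mean], rule ext) (auto simp: g_def h_def max_def power2_eq_square algebra_simps)
  then have "\<kappa>\<^sup>2 * mean (\<lambda>v. (f v - c)\<^sup>2) = \<kappa>\<^sup>2 * mean (\<lambda>v. (g v)\<^sup>2) + \<kappa>\<^sup>2 * mean (\<lambda>v. (h v)\<^sup>2)"
    by (simp only: distrib_left[symmetric])
  moreover have "\<kappa>\<^sup>2 * (mean (\<lambda>v. (f v)\<^sup>2) - 1) \<le> \<kappa>\<^sup>2 * mean (\<lambda>v. (f v - c)\<^sup>2)"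
    unfolding variance[OF f] by (intro mult_left_mono) auto
  ultimately have "\<kappa>\<^sup>2 * (mean (\<lambda>v. (f v)\<^sup>2) - 1) \<le> energy f"
    by linarith
  then show ?thesis
    using lazy_contraction[of f] by (simp add: algebra_simps)
qed

definition second_moment :: "('a \<Rightarrow> real) \<Rightarrow> nat \<Rightarrow> real" where
  "second_moment f t = mean (\<lambda>v. ((lazy ^^ t) f v)\<^sup>2)"

lemma second_moment_antimono: "s \<le> t \<Longrightarrow> second_moment f t \<le> second_moment f s"
proof (rule lift_Suc_antimono_le)
  show "second_moment f (Suc t) \<le> second_moment f t" for t
    using lazy_contraction[of "(lazy ^^ t) f"] energy_nonneg[of "(lazy ^^ t) f"]
    by (simp add: second_moment_def)
qed

lemma second_moment_ge_1:
  assumes "mean f = 1"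
  shows "1 \<le> second_moment f t"
proof -
  have "0 \<le> mean (\<lambda>v. ((lazy ^^ t) f v - 1)\<^sup>2)"
    by (intro mean_nonneg) simp
  then show ?thesis
    using variance[of "(lazy ^^ t) f" 1] assms by (simp add: mean_lazy_pow second_moment_def)
qed

text \<open>While the second moment \<open>Q\<close> exceeds \<open>8\<close>, \<open>early_decay\<close> makes \<open>1 / (1 + ln (Q / 4))\<close> grow linearly.\<close>

lemma second_moment_early:
  assumes f: "\<And>v. 0 \<le> f v" "mean f = 1" and t: "8 \<le> real t * \<kappa>\<^sup>2"
  shows "second_moment f t < 8"
proof (rule ccontr)
  let ?Q = "second_moment f"
  define y where "y s = 1 + ln (?Q s / 4)" for s
  assume "\<not> ?Q t < 8"
  then have Q: "8 \<le> ?Q s" if "s \<le> t" for s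
    using second_moment_antimono[OF that, of f] by linarith
  have y: "1 < y s" if "s \<le> t" for s
    using Q[OF that] by (simp add: y_def)
  have "s \<le> t \<Longrightarrow> real s * (\<kappa>\<^sup>2 / 8) \<le> 1 / y s" for s
  proof (induction s)
    case 0
    then show ?case
      using y[of 0] by simp
  next
    case (Suc s)
    have pos: "0 < ?Q s" "0 < ?Q (Suc s)"
      using second_moment_ge_1[OF f(2)] by (meson less_le_trans zero_less_one)+
    have "?Q (Suc s) \<le> ?Q s * (1 - (\<kappa> * y s)\<^sup>2 / 8)"
      using early_decay[of "(lazy ^^ s) f"] Q[of s] Suc.prems f lazy_pow_nonneg[OF f(1)]
      by (simp add: second_moment_def y_def mean_lazy_pow)
    then have "?Q (Suc s) / ?Q s - 1 \<le> - ((\<kappa> * y s)\<^sup>2 / 8)"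
      using pos by (simp add: field_simps)
    moreover have "ln (?Q (Suc s) / ?Q s) \<le> ?Q (Suc s) / ?Q s - 1"
      using pos by (intro ln_le_minus_one) simp
    moreover have "y (Suc s) = y s + ln (?Q (Suc s) / ?Q s)"
      using pos by (simp add: y_def ln_div)
    ultimately have "y (Suc s) \<le> y s - \<kappa>\<^sup>2 / 8 * (y s)\<^sup>2"
      by (simp add: power_mult_distrib)
    then have "1 / y s + \<kappa>\<^sup>2 / 8 \<le> 1 / y (Suc s)"
      using y[of s] y[of "Suc s"] Suc.prems by (intro inverse_growth) auto
    then show ?case
      using Suc by (simp add: algebra_simps add_divide_distrib)
  qed
  then have "1 \<le> 1 / y t"
    using t by fastforce
  then show False
    using y[of t] by simp
qed

lemma second_moment_late:
  assumes f: "mean f = 1" and t: "second_moment f t \<le> 8"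
  shows "second_moment f (t + s) - 1 \<le> 7 * exp (- (real s * \<kappa>\<^sup>2 / 4))"
proof (induction s)
  case 0
  then show ?case
    using t by simp
next
  case (Suc s)
  have "second_moment f (t + Suc s) - 1 \<le> (second_moment f (t + s) - 1) * (1 - \<kappa>\<^sup>2 / 4)"
    using late_decay[of "(lazy ^^ (t + s)) f"] f by (simp add: second_moment_def mean_lazy_pow)
  also have "\<dots> \<le> (second_moment f (t + s) - 1) * exp (- (\<kappa>\<^sup>2 / 4))"
    using second_moment_ge_1[OF f, of "t + s"] exp_ge_add_one_self[of "- (\<kappa>\<^sup>2 / 4)"]
    by (intro mult_left_mono) auto
  also have "\<dots> \<le> 7 * exp (- (real s * \<kappa>\<^sup>2 / 4)) * exp (- (\<kappa>\<^sup>2 / 4))"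
    using Suc by (intro mult_right_mono) auto
  also have "\<dots> = 7 * exp (- (real (Suc s) * \<kappa>\<^sup>2 / 4))"
    by (simp add: mult_exp_exp algebra_simps add_divide_distrib)
  finally show ?case .
qed

definition mixing_steps :: nat where
  "mixing_steps = nat \<lceil>8 / \<kappa>\<^sup>2\<rceil> + nat \<lceil>16 / \<kappa>\<^sup>2\<rceil>"

lemma density_mixes:
  assumes f: "\<And>v. 0 \<le> f v" "mean f = 1"
  shows "mean (\<lambda>v. ((lazy ^^ mixing_steps) f v - 1)\<^sup>2) \<le> 1 / 4"
proof -
  define t s where "t = nat \<lceil>8 / \<kappa>\<^sup>2\<rceil>" and "s = nat \<lceil>16 / \<kappa>\<^sup>2\<rceil>"
  have ts: "8 \<le> real t * \<kappa>\<^sup>2" "16 \<le> real s * \<kappa>\<^sup>2"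
    using \<kappa>_pos real_nat_ceiling_ge[of "8 / \<kappa>\<^sup>2"] real_nat_ceiling_ge[of "16 / \<kappa>\<^sup>2"]
    unfolding t_def[symmetric] s_def[symmetric] by (simp_all add: pos_divide_le_eq)
  have "second_moment f (t + s) - 1 \<le> 7 * exp (- (real s * \<kappa>\<^sup>2 / 4))"
    using second_moment_early[OF f ts(1)] by (intro second_moment_late f(2)) simp
  also have "\<dots> \<le> 7 * exp (- 4)"
    using ts(2) by simp
  also have "\<dots> \<le> 1 / 4"
    using exp_minus_4_le by simp
  finally have "second_moment f mixing_steps - 1 \<le> 1 / 4"
    by (simp add: mixing_steps_def t_def s_def)
  then show ?thesis
    using variance[of "(lazy ^^ mixing_steps) f" 1] f(2) by (simp add: second_moment_def mean_lazy_pow)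
qed

theorem transition_lower_bound:
  assumes a: "a \<in> V" and b: "b \<in> V"
  shows "3 / 4 * \<pi> b \<le> (lazy ^^ (2 * mixing_steps)) (\<lambda>v. of_bool (v = b)) a"
proof -
  define f where "f c = (lazy ^^ mixing_steps) (point_density c)" for c
  have f: "mean (f c) = 1" "mean (\<lambda>v. (f c v - 1)\<^sup>2) \<le> 1 / 4" if "c \<in> V" for c
    using that density_mixes[OF point_density_nonneg] by (simp_all add: f_def mean_lazy_pow mean_point_density)
  have "3 / 4 \<le> mean (\<lambda>v. f a v * f b v)"
    using mean_product_ge[OF f(1)[OF a] f(1)[OF b] f(2)[OF a] f(2)[OF b]] by simp
  also have "\<dots> = mean (\<lambda>v. point_density a v * (lazy ^^ mixing_steps) (f b) v)"
    unfolding lazy_pow_self_adjoint by (simp add: f_def)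
  also have "\<dots> = (lazy ^^ (2 * mixing_steps)) (point_density b) a"
    unfolding mean_point_density_mult[OF a] by (simp add: f_def mult_2 funpow_add)
  also have "\<dots> = (1 / \<pi> b) * (lazy ^^ (2 * mixing_steps)) (\<lambda>v. of_bool (v = b)) a"
    unfolding point_density_def[abs_def] lazy_pow_scale ..
  finally show ?thesis
    using \<pi>_pos[OF b] by (simp add: field_simps)
qed

end

section \<open>Random walks on finite graphs\<close>

lemma card_2_eq_doubleton: "\<lbrakk>card e = 2; v \<in> e; u \<in> e; v \<noteq> u\<rbrakk> \<Longrightarrow> e = {v, u}"
  by (auto simp: card_2_iff)

lemma pmf_bind_finite:
  assumes "finite A" "set_pmf M \<subseteq> A"
  shows "pmf (bind_pmf M f) x = (\<Sum>a\<in>A. pmf (f a) x * pmf M a)"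
  unfolding pmf_bind using assms by (intro integral_measure_pmf_real) auto

definition inner_edges :: "'a set set \<Rightarrow> 'a set \<Rightarrow> 'a set set" where
  "inner_edges E U = {e \<in> E. e \<subseteq> U}"

definition edge_weight :: "'a set set \<Rightarrow> 'a \<Rightarrow> 'a \<Rightarrow> real" where
  "edge_weight E v u = of_bool ({v, u} \<in> E) / (2 * card E)"

locale finite_graph =
  fixes V :: "'a set" and E :: "'a set set"
  assumes finite_V: "finite V" and edge: "e \<in> E \<Longrightarrow> e \<subseteq> V \<and> card e = 2" and E_ne: "E \<noteq> {}"
begin

definition incident :: "'a \<Rightarrow> 'a set set" where
  "incident v = {e \<in> E. v \<in> e}"

lemma finite_E: "finite E"
  by (rule finite_subset[of _ "Pow V"]) (use edge finite_V in auto)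

lemma card_E_pos: "0 < card E"
  using finite_E E_ne by (simp add: card_gt_0_iff)

lemma finite_edge: "e \<in> E \<Longrightarrow> finite e"
  using edge finite_V by (meson finite_subset)

lemma finite_incident: "finite (incident v)"
  using finite_E by (simp add: incident_def)

lemma edge_weight_refl: "edge_weight E v v = 0"
  using edge[of "{v, v}"] by (auto simp: edge_weight_def)

lemma edge_weight_sym: "edge_weight E u v = edge_weight E v u"
  by (simp add: edge_weight_def insert_commute)

lemma card_neighbours: "card {u \<in> V. {v, u} \<in> E} = card (incident v)"
proof (rule bij_betw_same_card[of "\<lambda>u. {v, u}"], rule bij_betw_imageI)
  show "inj_on (\<lambda>u. {v, u}) {u \<in> V. {v, u} \<in> E}"
    by (auto simp: inj_on_def doubleton_eq_iff)
  have "e \<in> (\<lambda>u. {v, u}) ` {u \<in> V. {v, u} \<in> E}" if e: "e \<in> E" "v \<in> e" for e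
  proof -
    obtain u where "e = {v, u}"
      using edge[OF e(1)] e(2) unfolding card_2_iff by auto
    then show ?thesis
      using e edge[OF e(1)] by auto
  qed
  then show "(\<lambda>u. {v, u}) ` {u \<in> V. {v, u} \<in> E} = incident v"
    by (auto simp: incident_def)
qed

lemma sum_edge_weight: "(\<Sum>u\<in>V. edge_weight E v u) = card (incident v) / (2 * card E)"
proof -
  have "(\<Sum>u\<in>V. edge_weight E v u) = real (card {u \<in> V. {v, u} \<in> E}) / (2 * card E)"
    using finite_V by (simp add: edge_weight_def Int_def flip: sum_divide_distrib)
  then show ?thesis
    by (simp only: card_neighbours)
qed

lemma sum_edge_weight_inner:
  assumes "U \<subseteq> V"
  shows "(\<Sum>v\<in>U. \<Sum>u\<in>U. edge_weight E v u) = card (inner_edges E U) / card E"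
proof -
  have U: "finite U"
    using assms finite_V by (rule finite_subset)
  have "(\<Sum>v\<in>U. \<Sum>u\<in>U. of_bool ({v, u} \<in> E)) = (\<Sum>(v, u)\<in>U \<times> U. of_bool ({v, u} \<in> E) :: nat)"
    by (rule sum.cartesian_product)
  also have "\<dots> = card {(v, u). {v, u} \<in> inner_edges E U}"
    using U by (auto simp: case_prod_beta inner_edges_def intro!: arg_cong[where f = card])
  also have "\<dots> = 2 * card (inner_edges E U)"
    using finite_E edge by (intro card_doubleton_pairs) (auto simp: inner_edges_def)
  finally have "real (\<Sum>v\<in>U. \<Sum>u\<in>U. of_bool ({v, u} \<in> E)) = real (2 * card (inner_edges E U))"
    by (rule arg_cong)
  then show ?thesis
    using card_E_pos by (simp add: edge_weight_def flip: sum_divide_distrib)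
qed

lemma card_common_edges: "card {e \<in> incident v. u \<in> e}
    = (if u = v then card (incident v) else of_bool ({v, u} \<in> E))"
proof (cases "u = v")
  case True
  have "{e \<in> incident v. v \<in> e} = incident v"
    by (auto simp: incident_def)
  then show ?thesis
    using True by simp
next
  case False
  have "{e \<in> incident v. u \<in> e} = E \<inter> {{v, u}}"
    using False edge card_2_eq_doubleton[of _ v u] by (auto simp: incident_def)
  then show ?thesis
    using False by simp
qed

lemma edge_ne: "e \<in> E \<Longrightarrow> e \<noteq> {}"
  using edge by fastforce

lemma pmf_of_edge: "e \<in> E \<Longrightarrow> pmf (pmf_of_set e) x = of_bool (x \<in> e) / 2"
  using finite_edge edge_ne edge[of e] by (simp add: indicator_def)

lemma set_pmf_of_edge: "e \<in> E \<Longrightarrow> set_pmf (pmf_of_set e) = e"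
  using finite_edge edge_ne by (simp add: set_pmf_of_set)

end

locale covered_graph = finite_graph +
  assumes cover: "v \<in> V \<Longrightarrow> incident v \<noteq> {}"
begin

sublocale network V "edge_weight E"
proof
  have "inner_edges E V = E"
    using edge by (auto simp: inner_edges_def)
  then show "(\<Sum>v\<in>V. \<Sum>u\<in>V. edge_weight E v u) = 1"
    using sum_edge_weight_inner[of V] card_E_pos by simp
  show "0 < (\<Sum>u\<in>V. edge_weight E v u)" if "v \<in> V" for v
    using cover[OF that] finite_incident[of v] card_E_pos by (simp add: sum_edge_weight card_gt_0_iff)
  show "finite V"
    by (rule finite_V)
  show "edge_weight E u v = edge_weight E v u" for u v
    by (rule edge_weight_sym)
  show "0 \<le> edge_weight E u v" for u v
    by (simp add: edge_weight_def)
qed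

lemma \<pi>_eq: "\<pi> v = card (incident v) / (2 * card E)"
  by (simp add: \<pi>_def sum_edge_weight)

definition start :: "'a pmf" where
  "start = bind_pmf (pmf_of_set E) pmf_of_set"

definition step :: "'a \<Rightarrow> 'a pmf" where
  "step v = bind_pmf (pmf_of_set (incident v)) pmf_of_set"

lemma pmf_start: "pmf start v = \<pi> v"
proof -
  have "pmf start v = (\<Sum>e\<in>E. of_bool (v \<in> e) / 2) / card E"
    unfolding start_def pmf_bind_pmf_of_set[OF E_ne finite_E] by (simp add: pmf_of_edge)
  also have "(\<Sum>e\<in>E. of_bool (v \<in> e) / 2) = real (card (incident v)) / 2"
    using finite_E by (simp add: incident_def Int_def flip: sum_divide_distrib)
  finally show ?thesis
    by (simp add: \<pi>_eq)
qed

lemma pmf_step: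
  assumes v: "v \<in> V"
  shows "pmf (step v) u = (of_bool (u = v) + edge_weight E v u / \<pi> v) / 2"
proof -
  have pos: "0 < card (incident v)"
    using cover[OF v] finite_incident by (simp add: card_gt_0_iff)
  have "pmf (step v) u = (\<Sum>e\<in>incident v. of_bool (u \<in> e) / 2) / card (incident v)"
    unfolding step_def pmf_bind_pmf_of_set[OF cover[OF v] finite_incident]
    by (simp add: pmf_of_edge incident_def)
  also have "(\<Sum>e\<in>incident v. of_bool (u \<in> e) / 2) = real (card {e \<in> incident v. u \<in> e}) / 2"
    using finite_incident by (simp add: Int_def flip: sum_divide_distrib)
  also have "real (card {e \<in> incident v. u \<in> e}) / 2 / card (incident v)
      = (of_bool (u = v) + edge_weight E v u / \<pi> v) / 2"
    unfolding card_common_edges using pos card_E_pos edge_weight_refl[of v] by (auto simp: \<pi>_eq edge_weight_def)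
  finally show ?thesis .
qed

lemma set_start: "set_pmf start = V"
proof -
  have "set_pmf start = (\<Union>e\<in>E. set_pmf (pmf_of_set e))"
    by (simp add: start_def set_bind_pmf E_ne finite_E)
  also have "\<dots> = \<Union>E"
    by (simp add: set_pmf_of_edge)
  also have "\<dots> = V"
    using edge cover by (fastforce simp: incident_def)
  finally show ?thesis .
qed

lemma step_cases:
  assumes v: "v \<in> V" and u: "u \<in> set_pmf (step v)"
  shows "u \<in> V \<and> (u = v \<or> {v, u} \<in> E)"
proof -
  have "set_pmf (step v) = (\<Union>e\<in>incident v. set_pmf (pmf_of_set e))"
    by (simp add: step_def set_bind_pmf cover[OF v] finite_incident)
  then obtain e where e: "e \<in> incident v" "u \<in> set_pmf (pmf_of_set e)"
    using u by blast
  then have "e \<in> E" "v \<in> e" "u \<in> e"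
    by (auto simp: incident_def set_pmf_of_edge)
  then show ?thesis
    using edge[of e] card_2_eq_doubleton[of e v u] by auto
qed

lemma pmf_bind_start: "pmf (bind_pmf start f) x = (\<Sum>v\<in>V. pmf (f v) x * \<pi> v)"
  using pmf_bind_finite[OF finite_V, of start f x] set_start by (simp add: pmf_start)

lemma start_stationary: "bind_pmf start step = start"
proof (rule pmf_eqI)
  fix u
  show "pmf (bind_pmf start step) u = pmf start u"
  proof (cases "u \<in> V")
    case True
    have "pmf (bind_pmf start step) u = (\<Sum>v\<in>V. (of_bool (v = u) * \<pi> v + edge_weight E u v) / 2)"
      unfolding pmf_bind_start
    proof (intro sum.cong refl)
      fix v assume "v \<in> V"
      then show "pmf (step v) u * \<pi> v = (of_bool (v = u) * \<pi> v + edge_weight E u v) / 2"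
        using \<pi>_pos[of v] edge_weight_sym[of u v] by (simp add: pmf_step field_simps)
    qed
    also have "\<dots> = ((\<Sum>v\<in>V. of_bool (v = u) * \<pi> v) + \<pi> u) / 2"
      by (simp only: sum_divide_distrib[symmetric] sum.distrib \<pi>_def[of u, symmetric])
    also have "(\<Sum>v\<in>V. of_bool (v = u) * \<pi> v) = (\<Sum>v\<in>V. if v = u then \<pi> v else 0)"
      by (intro sum.cong refl) simp
    also have "\<dots> = \<pi> u"
      using True finite_V by simp
    finally show ?thesis
      by (simp add: pmf_start)
  next
    case False
    then have "u \<notin> set_pmf start" "u \<notin> set_pmf (bind_pmf start step)"
      using set_start step_cases by (auto simp: set_bind_pmf)
    then show ?thesis
      by (metis pmf_eq_0_set_pmf)
  qed
qed

primrec walk :: "nat \<Rightarrow> 'a \<Rightarrow> 'a list pmf" where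
  "walk 0 v = return_pmf [v]"
| "walk (Suc T) v = bind_pmf (step v) (\<lambda>u. map_pmf ((#) v) (walk T u))"

lemma map_hd_walk: "map_pmf hd (walk T v) = return_pmf v"
  by (cases T) (simp_all add: map_bind_pmf map_pmf_comp)

lemma walk_support:
  "v \<in> V \<Longrightarrow> xs \<in> set_pmf (walk T v) \<Longrightarrow> length xs = Suc T \<and> hd xs = v \<and> set xs \<subseteq> V \<and>
     (\<forall>s<T. xs ! s = xs ! Suc s \<or> {xs ! s, xs ! Suc s} \<in> E)"
proof (induction T arbitrary: v xs)
  case (Suc T)
  then obtain u ys where u: "u \<in> set_pmf (step v)" "ys \<in> set_pmf (walk T u)" "xs = v # ys"
    by (auto simp: set_bind_pmf)
  have uV: "u \<in> V" "u = v \<or> {v, u} \<in> E"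
    using step_cases[OF Suc.prems(1) u(1)] by auto
  note IH = Suc.IH[OF uV(1) u(2)]
  have "ys ! 0 = u"
    using IH by (cases ys) auto
  then have "xs ! s = xs ! Suc s \<or> {xs ! s, xs ! Suc s} \<in> E" if "s < Suc T" for s
    using that uV(2) IH u(3) by (cases s) auto
  then show ?case
    using IH u(3) Suc.prems(1) by auto
qed simp

lemma finite_walk_support: "v \<in> V \<Longrightarrow> finite (set_pmf (walk T v))"
  by (rule finite_subset[OF _ finite_lists_length_eq[OF finite_V, of "Suc T"]]) (use walk_support in blast)

lemma pmf_walk_last: "v \<in> V \<Longrightarrow> pmf (map_pmf last (walk T v)) b = (lazy ^^ T) (\<lambda>x. of_bool (x = b)) v"
proof (induction T arbitrary: v)
  case 0
  then show ?case
    by (simp add: indicator_def)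
next
  case (Suc T)
  let ?f = "(lazy ^^ T) (\<lambda>x. of_bool (x = b))"
  have "map_pmf last (walk (Suc T) v) = bind_pmf (step v) (\<lambda>u. map_pmf last (walk T u))"
    unfolding walk.simps map_bind_pmf
  proof (intro bind_pmf_cong refl)
    fix u assume "u \<in> set_pmf (step v)"
    then have "u \<in> V"
      using step_cases[OF Suc.prems] by blast
    then have "xs \<noteq> []" if "xs \<in> set_pmf (walk T u)" for xs
      using walk_support[OF _ that] by auto
    then show "map_pmf last (map_pmf ((#) v) (walk T u)) = map_pmf last (walk T u)"
      unfolding map_pmf_comp by (intro map_pmf_cong) auto
  qed
  then have "pmf (map_pmf last (walk (Suc T) v)) b = (\<Sum>u\<in>V. pmf (map_pmf last (walk T u)) b * pmf (step v) u)"
    using step_cases[OF Suc.prems] pmf_bind_finite[OF finite_V] by (metis subsetI)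
  also have "\<dots> = (\<Sum>u\<in>V. (if u = v then ?f v / 2 else 0) + (edge_weight E v u * ?f u) / \<pi> v / 2)"
    using Suc by (intro sum.cong refl) (auto simp: pmf_step algebra_simps add_divide_distrib)
  also have "\<dots> = lazy ?f v"
    using finite_V Suc.prems
    by (simp add: sum.distrib lazy_def sum_divide_distrib[symmetric] add_divide_distrib)
  finally show ?case
    by simp
qed

definition stationary_walk :: "nat \<Rightarrow> 'a list pmf" where
  "stationary_walk T = bind_pmf start (walk T)"

lemma length_stationary_walk: "xs \<in> set_pmf (stationary_walk T) \<Longrightarrow> length xs = Suc T"
  using walk_support set_start by (auto simp: stationary_walk_def set_bind_pmf)

lemma drop_stationary_walk: "s \<le> T \<Longrightarrow> map_pmf (drop s) (stationary_walk T) = stationary_walk (T - s)"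
proof (induction s arbitrary: T)
  case (Suc s)
  then obtain T' where T': "T = Suc T'" "s \<le> T'"
    by (cases T) auto
  have "map_pmf (drop (Suc s)) (stationary_walk T)
      = bind_pmf (bind_pmf start step) (\<lambda>u. map_pmf (drop s) (walk T' u))"
    by (simp add: T' stationary_walk_def map_bind_pmf map_pmf_comp bind_assoc_pmf)
  also have "\<dots> = map_pmf (drop s) (stationary_walk T')"
    by (simp add: start_stationary stationary_walk_def map_bind_pmf)
  finally show ?case
    using Suc.IH[OF T'(2)] T'(1) by simp
qed simp

lemma stationary_walk_nth:
  assumes "s \<le> T"
  shows "map_pmf (\<lambda>xs. xs ! s) (stationary_walk T) = start"
proof -
  have "map_pmf (\<lambda>xs. xs ! s) (stationary_walk T) = map_pmf hd (map_pmf (drop s) (stationary_walk T))"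
    unfolding map_pmf_comp using assms length_stationary_walk
    by (intro map_pmf_cong refl) (auto simp: hd_drop_conv_nth)
  also have "\<dots> = map_pmf hd (stationary_walk (T - s))"
    by (simp only: drop_stationary_walk[OF assms])
  also have "\<dots> = start"
    unfolding stationary_walk_def map_bind_pmf map_hd_walk by (rule bind_return_pmf')
  finally show ?thesis .
qed

definition stationary_step :: "'a set pmf" where
  "stationary_step = bind_pmf start (\<lambda>v. map_pmf (\<lambda>u. {v, u}) (step v))"

lemma stationary_walk_step:
  assumes "s < T"
  shows "map_pmf (\<lambda>xs. {xs ! s, xs ! Suc s}) (stationary_walk T) = stationary_step"
proof -
  let ?first = "\<lambda>ys. {hd ys, hd (tl ys)}"
  obtain T' where T': "T - s = Suc T'"
    using assms by (cases "T - s") auto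
  have "map_pmf (\<lambda>xs. {xs ! s, xs ! Suc s}) (stationary_walk T)
      = map_pmf ?first (map_pmf (drop s) (stationary_walk T))"
    unfolding map_pmf_comp using assms length_stationary_walk
    by (intro map_pmf_cong refl) (simp add: hd_drop_conv_nth tl_drop nth_tl)
  also have "\<dots> = map_pmf ?first (stationary_walk (Suc T'))"
    using drop_stationary_walk[of s T] assms T' by simp
  also have "\<dots> = bind_pmf start (\<lambda>v. bind_pmf (step v) (\<lambda>u. map_pmf (\<lambda>x. {v, x}) (map_pmf hd (walk T' u))))"
    by (simp add: stationary_walk_def map_bind_pmf map_pmf_comp)
  also have "\<dots> = stationary_step"
    unfolding map_hd_walk map_return_pmf by (simp add: stationary_step_def map_pmf_def)
  finally show ?thesis .
qed

lemma pmf_stationary_step: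
  assumes e: "e \<in> E"
  shows "pmf stationary_step e = 1 / (2 * card E)"
proof -
  obtain x y where xy: "e = {x, y}" "x \<noteq> y"
    using edge[OF e] unfolding card_2_iff by auto
  have V: "x \<in> V" "y \<in> V"
    using edge[OF e] xy by auto
  have "pmf (map_pmf (\<lambda>u. {v, u}) (step v)) e * \<pi> v = (if v = x \<or> v = y then 1 / (4 * card E) else 0)"
    if v: "v \<in> V" for v
  proof -
    have "(\<lambda>u. {v, u}) -` {e} = (if v = x then {y} else if v = y then {x} else {})"
      using xy by (auto simp: doubleton_eq_iff)
    then have "pmf (map_pmf (\<lambda>u. {v, u}) (step v)) e
        = (if v = x then pmf (step v) y else if v = y then pmf (step v) x else 0)"
      unfolding pmf_map by (auto simp: measure_pmf_single)
    moreover have "pmf (step x) y * \<pi> x = 1 / (4 * card E)" "pmf (step y) x * \<pi> y = 1 / (4 * card E)"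
      using V xy e \<pi>_pos[OF V(1)] \<pi>_pos[OF V(2)] by (auto simp: pmf_step edge_weight_def insert_commute)
    ultimately show ?thesis
      by auto
  qed
  then have "pmf stationary_step e = (\<Sum>v\<in>V. if v = x \<or> v = y then 1 / (4 * card E) else 0)"
    unfolding stationary_step_def pmf_bind_start by (intro sum.cong refl)
  also have "\<dots> = (\<Sum>v\<in>{x, y}. 1 / (4 * card E))"
    using V finite_V by (intro sum.mono_neutral_cong_right) auto
  also have "\<dots> = 1 / (2 * card E)"
    using xy by simp
  finally show ?thesis .
qed

lemma prob_same_vertex:
  assumes "s \<le> T" "t \<le> T"
  shows "measure_pmf.prob (pair_pmf (stationary_walk T) (stationary_walk T)) {(x, y). x ! s = y ! t}
    \<le> card V / (2 * card E)"
proof -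
  let ?W = "stationary_walk T"
  have "measure_pmf.prob (pair_pmf ?W ?W) {(x, y). x ! s = y ! t} =
      measure_pmf.prob (map_pmf (\<lambda>(x, y). (x ! s, y ! t)) (pair_pmf ?W ?W)) {(u, v). u = v}"
    unfolding measure_map_pmf by (intro arg_cong2[where f = measure] refl) auto
  also have "\<dots> = measure_pmf.prob (pair_pmf start start) {(u, v). u = v}"
    by (simp only: map_pair stationary_walk_nth[OF assms(1)] stationary_walk_nth[OF assms(2)])
  also have "\<dots> = measure_pmf.prob (pair_pmf start start) ((\<lambda>v. (v, v)) ` V)"
    by (subst (1 2) measure_Int_set_pmf[symmetric]) (auto simp: set_start intro!: arg_cong2[where f = measure])
  also have "\<dots> = (\<Sum>v\<in>V. (\<pi> v)\<^sup>2)"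
    using finite_V
    by (subst measure_measure_pmf_finite) (auto simp: sum.reindex inj_on_def pmf_pair pmf_start power2_eq_square)
  also have "\<dots> \<le> (\<Sum>v\<in>V. card V / (2 * card E) * \<pi> v)"
  proof (intro sum_mono)
    fix v
    have "card (incident v) \<le> card V"
      unfolding card_neighbours[symmetric] using finite_V by (intro card_mono) auto
    then have "\<pi> v \<le> card V / (2 * card E)"
      by (simp add: \<pi>_eq divide_right_mono)
    then show "(\<pi> v)\<^sup>2 \<le> card V / (2 * card E) * \<pi> v"
      unfolding power2_eq_square by (intro mult_right_mono \<pi>_nonneg)
  qed
  also have "\<dots> = card V / (2 * card E)"
    by (simp only: sum_distrib_left[symmetric] sum_\<pi> mult_1_right)
  finally show ?thesis .
qed

lemma prob_related_edges:
  fixes \<zeta> :: real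
  assumes "s < T" "t < T" and R: "\<And>e. e \<in> E \<Longrightarrow> card {f \<in> E. R e f} \<le> \<zeta>"
  shows "measure_pmf.prob (pair_pmf (stationary_walk T) (stationary_walk T))
    {(x, y). {x ! s, x ! Suc s} \<in> E \<and> {y ! t, y ! Suc t} \<in> E \<and> R {x ! s, x ! Suc s} {y ! t, y ! Suc t}}
    \<le> \<zeta> / (4 * card E)"
proof -
  let ?W = "stationary_walk T" and ?J = "stationary_step" and ?X = "SIGMA e:E. {f \<in> E. R e f}"
  have "measure_pmf.prob (pair_pmf ?W ?W)
      {(x, y). {x ! s, x ! Suc s} \<in> E \<and> {y ! t, y ! Suc t} \<in> E \<and> R {x ! s, x ! Suc s} {y ! t, y ! Suc t}} =
      measure_pmf.prob (map_pmf (\<lambda>(x, y). ({x ! s, x ! Suc s}, {y ! t, y ! Suc t})) (pair_pmf ?W ?W)) ?X"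
    unfolding measure_map_pmf by (intro arg_cong2[where f = measure] refl) auto
  also have "\<dots> = measure_pmf.prob (pair_pmf ?J ?J) ?X"
    using map_pair[of "\<lambda>x. {x ! s, x ! Suc s}" "\<lambda>y. {y ! t, y ! Suc t}" ?W ?W]
    by (simp only: stationary_walk_step[OF assms(1)] stationary_walk_step[OF assms(2)])
  also have "\<dots> = (\<Sum>z\<in>?X. pmf (pair_pmf ?J ?J) z)"
    using finite_E by (intro measure_measure_pmf_finite) auto
  also have "\<dots> = (\<Sum>z\<in>?X. 1 / (2 * card E) * (1 / (2 * card E)))"
    by (intro sum.cong refl)
      (auto simp only: mem_Sigma_iff mem_Collect_eq pmf_pair pmf_stationary_step split: prod.splits)
  also have "\<dots> = real (card ?X) * (1 / (2 * card E) * (1 / (2 * card E)))"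
    by simp
  also have "real (card ?X) = (\<Sum>e\<in>E. real (card {f \<in> E. R e f}))"
    using finite_E by simp
  also have "\<dots> * (1 / (2 * card E) * (1 / (2 * card E))) \<le> (\<Sum>e\<in>E. \<zeta>) * (1 / (2 * card E) * (1 / (2 * card E)))"
    using R by (intro mult_right_mono sum_mono) auto
  also have "\<dots> = \<zeta> / (4 * card E)"
    using card_E_pos by simp
  finally show ?thesis .
qed

definition conflicts :: "nat \<Rightarrow> ('a set \<Rightarrow> 'a set \<Rightarrow> bool) \<Rightarrow> ('a list \<times> 'a list) set" where
  "conflicts T R = (\<Union>s\<in>{..T}. \<Union>t\<in>{..T}. {(x, y). x ! s = y ! t}) \<union>
     (\<Union>s\<in>{..<T}. \<Union>t\<in>{..<T}.
        {(x, y). {x ! s, x ! Suc s} \<in> E \<and> {y ! t, y ! Suc t} \<in> E \<and> R {x ! s, x ! Suc s} {y ! t, y ! Suc t}})"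

lemma prob_conflicts:
  fixes \<zeta> :: real
  assumes R: "\<And>e. e \<in> E \<Longrightarrow> card {f \<in> E. R e f} \<le> \<zeta>"
  shows "measure_pmf.prob (pair_pmf (stationary_walk T) (stationary_walk T)) (conflicts T R)
    \<le> real ((T + 1)\<^sup>2) * (card V / (2 * card E)) + real (T\<^sup>2) * (\<zeta> / (4 * card E))"
proof -
  let ?P = "measure_pmf.prob (pair_pmf (stationary_walk T) (stationary_walk T))"
  let ?X = "\<lambda>s t. {(x, y). x ! s = y ! t} :: ('a list \<times> 'a list) set"
  let ?Y = "\<lambda>s t. {(x, y). {x ! s, x ! Suc s} \<in> E \<and> {y ! t, y ! Suc t} \<in> E
      \<and> R {x ! s, x ! Suc s} {y ! t, y ! Suc t}}"
  have "?P (conflicts T R) \<le> ?P (\<Union>s\<in>{..T}. \<Union>t\<in>{..T}. ?X s t) + ?P (\<Union>s\<in>{..<T}. \<Union>t\<in>{..<T}. ?Y s t)"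
    unfolding conflicts_def by (intro measure_Un_le) auto
  also have "?P (\<Union>s\<in>{..T}. \<Union>t\<in>{..T}. ?X s t) \<le> (\<Sum>s\<in>{..T}. \<Sum>t\<in>{..T}. ?P (?X s t))"
    by (intro order_trans[OF measure_UNION_le] sum_mono measure_UNION_le) auto
  also have "\<dots> \<le> (\<Sum>s\<in>{..T}. \<Sum>t\<in>{..T}. card V / (2 * card E))"
    by (intro sum_mono prob_same_vertex) auto
  also have "\<dots> = real ((T + 1)\<^sup>2) * (card V / (2 * card E))"
    unfolding sum_constant card_atMost by (simp add: power2_eq_square field_simps)
  also have "?P (\<Union>s\<in>{..<T}. \<Union>t\<in>{..<T}. ?Y s t) \<le> (\<Sum>s\<in>{..<T}. \<Sum>t\<in>{..<T}. ?P (?Y s t))"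
    by (intro order_trans[OF measure_UNION_le] sum_mono measure_UNION_le) auto
  also have "\<dots> \<le> (\<Sum>s\<in>{..<T}. \<Sum>t\<in>{..<T}. \<zeta> / (4 * card E))"
    using R by (intro sum_mono prob_related_edges) auto
  also have "\<dots> = real (T\<^sup>2) * (\<zeta> / (4 * card E))"
    by (simp add: power2_eq_square)
  finally show ?thesis
    by (simp add: add.commute)
qed

end

section \<open>Systems of random bridges\<close>

lemma prob_le_of_pmf_le:
  assumes "finite (set_pmf M)" "\<And>x. pmf M x \<le> c * pmf N x" "0 \<le> c"
  shows "measure_pmf.prob M X \<le> c * measure_pmf.prob N X"
proof -
  have fin: "finite (X \<inter> set_pmf M)"
    using assms(1) by simp
  have "measure_pmf.prob M X = measure_pmf.prob M (X \<inter> set_pmf M)"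
    by (simp only: measure_Int_set_pmf)
  also have "\<dots> = sum (pmf M) (X \<inter> set_pmf M)"
    by (rule measure_measure_pmf_finite[OF fin])
  also have "\<dots> \<le> (\<Sum>x\<in>X \<inter> set_pmf M. c * pmf N x)"
    by (intro sum_mono assms)
  also have "\<dots> = c * measure_pmf.prob N (X \<inter> set_pmf M)"
    by (simp only: sum_distrib_left[symmetric] measure_measure_pmf_finite[OF fin])
  also have "\<dots> \<le> c * measure_pmf.prob N X"
    by (intro mult_left_mono assms measure_pmf.finite_measure_mono) auto
  finally show ?thesis .
qed

lemma prob_less_1_witness:
  assumes "measure_pmf.prob M X < 1"
  obtains z where "z \<in> set_pmf M" "z \<notin> X"
proof -
  have "\<not> set_pmf M \<subseteq> X"
  proof
    assume "set_pmf M \<subseteq> X"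
    then have "AE x in M. x \<in> X"
      by (auto simp: AE_measure_pmf_iff)
    then show False
      using assms measure_pmf.prob_eq_1[of X M] by simp
  qed
  then show thesis
    using that by blast
qed

lemma Pi_pmf_two_components:
  assumes "finite I" "x \<in> I" "y \<in> I" "x \<noteq> y"
  shows "map_pmf (\<lambda>f. (f x, f y)) (Pi_pmf I d p) = pair_pmf (p x) (p y)"
proof -
  have I: "I = insert x (I - {x})"
    using assms by auto
  have "map_pmf (\<lambda>f. (f x, f y)) (Pi_pmf I d p) =
      map_pmf (\<lambda>f. (f x, f y)) (map_pmf (\<lambda>(u, f). f(x := u)) (pair_pmf (p x) (Pi_pmf (I - {x}) d p)))"
    by (subst I, subst Pi_pmf_insert) (use assms in auto)
  also have "\<dots> = map_pmf (apsnd (\<lambda>f. f y)) (pair_pmf (p x) (Pi_pmf (I - {x}) d p))"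
    unfolding map_pmf_comp using assms(4) by (intro map_pmf_cong) (auto simp: apsnd_def)
  also have "\<dots> = pair_pmf (p x) (p y)"
    unfolding pair_map_pmf2[symmetric] using assms by (simp add: Pi_pmf_component)
  finally show ?thesis .
qed

lemma pair_pmf_bind_product:
  defines "n q r B \<equiv> bind_pmf q (\<lambda>x. bind_pmf r (\<lambda>y. B x y))"
  shows "bind_pmf (pair_pmf (pair_pmf q q) (pair_pmf r r)) (\<lambda>((x, x'), (y, y')). pair_pmf (B x y) (B x' y'))
    = pair_pmf (n q r B) (n q r B)"
proof -
  let ?ret = "\<lambda>x y x' y'. bind_pmf (B x y) (\<lambda>u. bind_pmf (B x' y') (\<lambda>u'. return_pmf (u, u')))"
  have "bind_pmf (pair_pmf (pair_pmf q q) (pair_pmf r r)) (\<lambda>((x, x'), (y, y')). pair_pmf (B x y) (B x' y'))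
      = bind_pmf q (\<lambda>x. bind_pmf q (\<lambda>x'. bind_pmf r (\<lambda>y. bind_pmf r (\<lambda>y'. ?ret x y x' y'))))"
    by (simp add: pair_pmf_def bind_assoc_pmf bind_return_pmf)
  also have "\<dots> = bind_pmf q (\<lambda>x. bind_pmf r (\<lambda>y. bind_pmf q (\<lambda>x'. bind_pmf r (\<lambda>y'. ?ret x y x' y'))))"
    by (subst bind_commute_pmf[of q r]) (rule refl)
  also have "\<dots> = bind_pmf q (\<lambda>x. bind_pmf r (\<lambda>y. bind_pmf q (\<lambda>x'. bind_pmf (B x y) (\<lambda>u.
      bind_pmf r (\<lambda>y'. bind_pmf (B x' y') (\<lambda>u'. return_pmf (u, u')))))))"
    by (intro bind_pmf_cong refl bind_commute_pmf)
  also have "\<dots> = bind_pmf q (\<lambda>x. bind_pmf r (\<lambda>y. bind_pmf (B x y) (\<lambda>u. bind_pmf q (\<lambda>x'.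
      bind_pmf r (\<lambda>y'. bind_pmf (B x' y') (\<lambda>u'. return_pmf (u, u')))))))"
    by (intro bind_pmf_cong refl bind_commute_pmf)
  also have "\<dots> = pair_pmf (n q r B) (n q r B)"
    by (simp add: n_def pair_pmf_def bind_assoc_pmf)
  finally show ?thesis .
qed

lemma walk_edges_remdups_adj:
  "e \<in> set (walk_edges (remdups_adj xs)) \<Longrightarrow> \<exists>s. Suc s < length xs \<and> xs ! s \<noteq> xs ! Suc s \<and> e = {xs ! s, xs ! Suc s}"
proof (induction xs rule: remdups_adj.induct)
  case (3 x y xs)
  show ?case
  proof (cases "x = y")
    case True
    then have "remdups_adj (x # y # xs) = remdups_adj (x # xs)"
      by simp
    then obtain s where "Suc s < length (x # xs)" "(x # xs) ! s \<noteq> (x # xs) ! Suc s"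
      "e = {(x # xs) ! s, (x # xs) ! Suc s}"
      using 3 True by auto
    then show ?thesis
      using True by (intro exI[of _ "Suc s"]) simp
  next
    case False
    obtain zs where "remdups_adj (y # xs) = y # zs"
      by (metis remdups_adj_Cons_alt)
    then have "walk_edges (remdups_adj (x # y # xs)) = {x, y} # walk_edges (remdups_adj (y # xs))"
      using False by simp
    then consider "e = {x, y}" | "e \<in> set (walk_edges (remdups_adj (y # xs)))"
      using 3(3) by auto
    then show ?thesis
    proof cases
      assume "e = {x, y}"
      then show ?thesis
        using False by (intro exI[of _ 0]) simp
    next
      assume "e \<in> set (walk_edges (remdups_adj (y # xs)))"
      then obtain s where "Suc s < length (y # xs)" "(y # xs) ! s \<noteq> (y # xs) ! Suc s"
        "e = {(y # xs) ! s, (y # xs) ! Suc s}"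
        using 3(2) False by auto
      then show ?thesis
        by (intro exI[of _ "Suc s"]) simp
    qed
  qed
qed auto

lemma bipartite_walk_parity:
  assumes "\<And>e. e \<in> set (walk_edges xs) \<Longrightarrow> card e = 2 \<and> card (e \<inter> A) = 1" "xs \<noteq> []"
  shows "even (length xs) \<longleftrightarrow> (hd xs \<in> A) \<noteq> (last xs \<in> A)"
  using assms
proof (induction xs rule: walk_edges.induct)
  case (1 x y xs)
  have "card {x, y} = 2" "card ({x, y} \<inter> A) = 1"
    using 1(2)[of "{x, y}"] by auto
  then have "(x \<in> A) \<noteq> (y \<in> A)"
    by (cases "x \<in> A"; cases "y \<in> A") auto
  moreover have "even (length (y # xs)) \<longleftrightarrow> (hd (y # xs) \<in> A) \<noteq> (last (y # xs) \<in> A)"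
    using 1 by auto
  ultimately show ?case
    by auto
qed auto

locale bipartite_expander = covered_graph V E + expanding_network V "edge_weight E" \<kappa>
  for V :: "'a set" and E and \<kappa> +
  fixes A :: "'a set"
  assumes bipartite: "e \<in> E \<Longrightarrow> card (e \<inter> A) = 1"
begin

abbreviation steps :: nat where
  "steps \<equiv> 2 * mixing_steps"

definition bridge :: "'a \<Rightarrow> 'a \<Rightarrow> 'a list pmf" where
  "bridge a b = cond_pmf (walk steps a) {xs. last xs = b}"

definition endpoint :: "'a set \<Rightarrow> 'a pmf" where
  "endpoint S = map_pmf (\<lambda>e. SOME v. v \<in> e \<inter> S) (pmf_of_set E)"

definition bridge_law :: "'a list pmf" where
  "bridge_law = bind_pmf (endpoint A) (\<lambda>a. bind_pmf (endpoint (- A)) (bridge a))"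

lemma edge_meets_sides:
  assumes "e \<in> E"
  shows "e \<inter> A \<noteq> {}" "e \<inter> - A \<noteq> {}"
proof -
  show "e \<inter> A \<noteq> {}"
    using bipartite[OF assms] by auto
  have "e \<inter> A \<noteq> e"
    using bipartite[OF assms] edge[OF assms] by auto
  then show "e \<inter> - A \<noteq> {}"
    by blast
qed

lemma endpoint:
  assumes S: "\<And>e. e \<in> E \<Longrightarrow> e \<inter> S \<noteq> {}"
  shows "pmf (endpoint S) v \<le> 2 * \<pi> v" and "set_pmf (endpoint S) \<subseteq> V \<inter> S"
proof -
  define pick where "pick e = (SOME v. v \<in> e \<inter> S)" for e
  have endpoint_eq: "endpoint S = map_pmf pick (pmf_of_set E)"
    by (simp add: endpoint_def pick_def[abs_def])
  have pick: "pick e \<in> e \<inter> S" if "e \<in> E" for e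
    unfolding pick_def using S[OF that] by (meson ex_in_conv someI_ex)
  have "pmf (endpoint S) v = card (E \<inter> pick -` {v}) / card E"
    unfolding endpoint_eq pmf_map by (simp add: measure_pmf_of_set[OF E_ne finite_E])
  moreover have "card (E \<inter> pick -` {v}) \<le> card (incident v)"
    using pick by (intro card_mono finite_incident) (auto simp: incident_def)
  ultimately show "pmf (endpoint S) v \<le> 2 * \<pi> v"
    by (simp add: \<pi>_eq divide_right_mono)
  have "set_pmf (endpoint S) = pick ` E"
    by (simp add: endpoint_eq set_pmf_of_set[OF E_ne finite_E])
  moreover have "pick e \<in> V \<inter> S" if "e \<in> E" for e
    using pick[OF that] edge[OF that] by blast
  ultimately show "set_pmf (endpoint S) \<subseteq> V \<inter> S"
    by auto
qed

lemmas endpoint_A = endpoint[OF edge_meets_sides(1)]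
  and endpoint_Compl_A = endpoint[OF edge_meets_sides(2)]

lemma prob_walk_last:
  assumes "a \<in> V" "b \<in> V"
  shows "3 / 4 * \<pi> b \<le> measure_pmf.prob (walk steps a) {xs. last xs = b}"
proof -
  have "last -` {b} = {xs. last xs = b}"
    by auto
  then show ?thesis
    using pmf_walk_last[OF assms(1), of steps b] transition_lower_bound[OF assms] by (simp add: pmf_map)
qed

lemma bridge_possible:
  assumes "a \<in> V" "b \<in> V"
  shows "set_pmf (walk steps a) \<inter> {xs. last xs = b} \<noteq> {}"
proof
  assume "set_pmf (walk steps a) \<inter> {xs. last xs = b} = {}"
  then have "measure_pmf.prob (walk steps a) {xs. last xs = b} = 0"
    by (subst measure_pmf_zero_iff) auto
  then show False
    using prob_walk_last[OF assms] \<pi>_pos[OF assms(2)] by simp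
qed

lemma set_bridge: "a \<in> V \<Longrightarrow> b \<in> V \<Longrightarrow> set_pmf (bridge a b) = set_pmf (walk steps a) \<inter> {xs. last xs = b}"
  unfolding bridge_def by (rule set_cond_pmf[OF bridge_possible])

lemma pmf_bridge_le:
  assumes "a \<in> V" "b \<in> V"
  shows "pmf (bridge a b) xs * \<pi> b \<le> 4 / 3 * (of_bool (last xs = b) * pmf (walk steps a) xs)"
proof -
  define p where "p = measure_pmf.prob (walk steps a) {xs. last xs = b}"
  have "3 / 4 * \<pi> b \<le> p" "0 < \<pi> b"
    using prob_walk_last[OF assms] \<pi>_pos[OF assms(2)] by (auto simp: p_def)
  moreover from this have "0 < p"
    by linarith
  ultimately have "\<pi> b / p \<le> 4 / 3"
    by (simp add: pos_divide_le_eq)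
  then have "of_bool (last xs = b) * pmf (walk steps a) xs * (\<pi> b / p)
      \<le> of_bool (last xs = b) * pmf (walk steps a) xs * (4 / 3)"
    by (intro mult_left_mono) auto
  then show ?thesis
    unfolding bridge_def pmf_cond[OF bridge_possible[OF assms]] p_def[symmetric] by (auto simp: mult_ac)
qed

lemma pmf_bind_bridge_le:
  assumes a: "a \<in> V"
  shows "pmf (bind_pmf (endpoint (- A)) (bridge a)) xs \<le> 8 / 3 * pmf (walk steps a) xs"
proof -
  have "pmf (bind_pmf (endpoint (- A)) (bridge a)) xs = (\<Sum>b\<in>V. pmf (bridge a b) xs * pmf (endpoint (- A)) b)"
    using endpoint_Compl_A(2) by (intro pmf_bind_finite finite_V) auto
  also have "\<dots> \<le> (\<Sum>b\<in>V. pmf (bridge a b) xs * (2 * \<pi> b))"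
    by (intro sum_mono mult_left_mono endpoint_Compl_A(1)) auto
  also have "\<dots> \<le> (\<Sum>b\<in>V. if b = last xs then 8 / 3 * pmf (walk steps a) xs else 0)"
  proof (intro sum_mono)
    fix b assume "b \<in> V"
    then show "pmf (bridge a b) xs * (2 * \<pi> b) \<le> (if b = last xs then 8 / 3 * pmf (walk steps a) xs else 0)"
      using pmf_bridge_le[OF a, of b xs] by (auto simp: mult_ac split: if_splits)
  qed
  also have "\<dots> \<le> 8 / 3 * pmf (walk steps a) xs"
    using finite_V by simp
  finally show ?thesis .
qed

lemma pmf_bridge_law_le: "pmf bridge_law xs \<le> 6 * pmf (stationary_walk steps) xs"
proof -
  have "pmf bridge_law xs = (\<Sum>a\<in>V. pmf (bind_pmf (endpoint (- A)) (bridge a)) xs * pmf (endpoint A) a)"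
    unfolding bridge_law_def using endpoint_A(2) by (intro pmf_bind_finite finite_V) auto
  also have "\<dots> \<le> (\<Sum>a\<in>V. (8 / 3 * pmf (walk steps a) xs) * (2 * \<pi> a))"
    using \<pi>_nonneg by (intro sum_mono mult_mono pmf_bind_bridge_le endpoint_A(1)) auto
  also have "\<dots> \<le> (\<Sum>a\<in>V. 6 * (pmf (walk steps a) xs * \<pi> a))"
    using \<pi>_nonneg by (intro sum_mono) (simp add: mult_nonneg_nonneg)
  also have "\<dots> = 6 * pmf (stationary_walk steps) xs"
    by (simp add: stationary_walk_def pmf_bind_start sum_distrib_left)
  finally show ?thesis .
qed

lemma finite_bridge_law: "finite (set_pmf bridge_law)"
proof (rule finite_subset)
  show "set_pmf bridge_law \<subseteq> (\<Union>a\<in>V. set_pmf (walk steps a))"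
  proof
    fix xs assume "xs \<in> set_pmf bridge_law"
    then obtain a b where "a \<in> set_pmf (endpoint A)" "b \<in> set_pmf (endpoint (- A))" "xs \<in> set_pmf (bridge a b)"
      by (auto simp: bridge_law_def set_bind_pmf)
    then show "xs \<in> (\<Union>a\<in>V. set_pmf (walk steps a))"
      using endpoint_A(2) endpoint_Compl_A(2) set_bridge[of a b] by blast
  qed
  show "finite (\<Union>a\<in>V. set_pmf (walk steps a))"
    using finite_V finite_walk_support by blast
qed

lemma prob_bridge_pair_le:
  "measure_pmf.prob (pair_pmf bridge_law bridge_law) X
    \<le> 36 * measure_pmf.prob (pair_pmf (stationary_walk steps) (stationary_walk steps)) X"
proof (rule prob_le_of_pmf_le)
  fix z :: "'a list \<times> 'a list"
  have "pmf bridge_law (fst z) * pmf bridge_law (snd z)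
      \<le> (6 * pmf (stationary_walk steps) (fst z)) * (6 * pmf (stationary_walk steps) (snd z))"
    by (intro mult_mono pmf_bridge_law_le) auto
  then show "pmf (pair_pmf bridge_law bridge_law) z
      \<le> 36 * pmf (pair_pmf (stationary_walk steps) (stationary_walk steps)) z"
    using pmf_pair[of _ _ "fst z" "snd z"] by simp
qed (use finite_bridge_law in auto)

text \<open>Independent end points on either side, joined by bridges that are conditionally independent given them. For an
  independent pair of edges of \<open>K\<^sub>3\<^sub>,\<^sub>3\<close> the two bridges involve disjoint sets of end points, hence are independent.\<close>

definition bridge_system :: "((nat \<Rightarrow> 'a) \<times> (nat \<Rightarrow> 'a) \<times> (nat \<times> nat \<Rightarrow> 'a list)) pmf" where
  "bridge_system = bind_pmf (pair_pmf (Pi_pmf {..<3} undefined (\<lambda>_. endpoint A))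
      (Pi_pmf {..<3} undefined (\<lambda>_. endpoint (- A))))
     (\<lambda>(a, b). map_pmf (\<lambda>w. (a, b, w)) (Pi_pmf ({..<3} \<times> {..<3}) [] (\<lambda>(i, j). bridge (a i) (b j))))"

lemma bridge_system_pair:
  assumes "((i, j), (k, l)) \<in> independent_pairs"
  shows "map_pmf (\<lambda>(a, b, w). (w (i, j), w (k, l))) bridge_system = pair_pmf bridge_law bridge_law"
proof -
  have idx: "i < 3" "j < 3" "k < 3" "l < 3" "i \<noteq> k" "j \<noteq> l"
    using assms by (auto simp: independent_pairs_def)
  let ?q = "endpoint A" and ?r = "endpoint (- A)"
  let ?PA = "Pi_pmf {..<3::nat} undefined (\<lambda>_. ?q)" and ?PB = "Pi_pmf {..<3::nat} undefined (\<lambda>_. ?r)"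
  have "map_pmf (\<lambda>(a, b, w). (w (i, j), w (k, l))) bridge_system = bind_pmf (pair_pmf ?PA ?PB) (\<lambda>(a, b).
      map_pmf (\<lambda>w. (w (i, j), w (k, l))) (Pi_pmf ({..<3} \<times> {..<3}) [] (\<lambda>(i, j). bridge (a i) (b j))))"
    unfolding bridge_system_def map_bind_pmf by (intro bind_pmf_cong refl) (auto simp: map_pmf_comp)
  also have "\<dots> = bind_pmf (pair_pmf ?PA ?PB) (\<lambda>(a, b). pair_pmf (bridge (a i) (b j)) (bridge (a k) (b l)))"
    using idx by (intro bind_pmf_cong refl) (auto simp: Pi_pmf_two_components)
  also have "\<dots> = bind_pmf (map_pmf (\<lambda>(a, b). ((a i, a k), (b j, b l))) (pair_pmf ?PA ?PB))
      (\<lambda>((x, x'), (y, y')). pair_pmf (bridge x y) (bridge x' y'))"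
    unfolding bind_map_pmf by (intro bind_pmf_cong refl) auto
  also have "map_pmf (\<lambda>(a, b). ((a i, a k), (b j, b l))) (pair_pmf ?PA ?PB)
      = pair_pmf (pair_pmf ?q ?q) (pair_pmf ?r ?r)"
    using map_pair[of "\<lambda>a. (a i, a k)" "\<lambda>b. (b j, b l)" ?PA ?PB] idx by (simp add: Pi_pmf_two_components)
  also have "bind_pmf (pair_pmf (pair_pmf ?q ?q) (pair_pmf ?r ?r))
      (\<lambda>((x, x'), (y, y')). pair_pmf (bridge x y) (bridge x' y'))
      = pair_pmf bridge_law bridge_law"
    unfolding bridge_law_def by (rule pair_pmf_bind_product)
  finally show ?thesis .
qed

lemma bridge_system_support:
  assumes "(a, b, w) \<in> set_pmf bridge_system" "i < 3" "j < 3"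
  shows "a i \<in> V \<inter> A" "b j \<in> V - A" "w (i, j) \<in> set_pmf (walk steps (a i))" "last (w (i, j)) = b j"
proof -
  have ab: "a i \<in> set_pmf (endpoint A)" "b j \<in> set_pmf (endpoint (- A))"
    and w: "w (i, j) \<in> set_pmf (bridge (a i) (b j))"
    using assms by (auto simp: bridge_system_def set_bind_pmf set_Pi_pmf PiE_dflt_def)
  show side: "a i \<in> V \<inter> A" "b j \<in> V - A"
    using ab endpoint_A(2) endpoint_Compl_A(2) by auto
  show "w (i, j) \<in> set_pmf (walk steps (a i))" "last (w (i, j)) = b j"
    using w set_bridge side by auto
qed

lemma bridge_system_without_conflicts:
  fixes \<zeta> :: real
  assumes R: "\<And>e. e \<in> E \<Longrightarrow> card {f \<in> E. R e f} \<le> \<zeta>" and \<zeta>: "0 \<le> \<zeta>"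
    and m: "648 * (real ((steps + 1)\<^sup>2) * card V + real (steps\<^sup>2) * \<zeta>) \<le> card E"
  obtains a b w where "(a, b, w) \<in> set_pmf bridge_system"
    "\<And>i j k l. ((i, j), (k, l)) \<in> independent_pairs \<Longrightarrow> (w (i, j), w (k, l)) \<notin> conflicts steps R"
proof -
  let ?B = "\<lambda>((i, j), (k, l)). {(a :: nat \<Rightarrow> 'a, b :: nat \<Rightarrow> 'a, w). (w (i, j), w (k, l)) \<in> conflicts steps R}"
  define \<beta> where "\<beta> = 36 * (real ((steps + 1)\<^sup>2) * (card V / (2 * card E)) + real (steps\<^sup>2) * (\<zeta> / (4 * card E)))"
  have "measure_pmf.prob bridge_system (?B q) \<le> \<beta>" if q: "q \<in> independent_pairs" for q
  proof -
    obtain i j k l where ijkl: "q = ((i, j), (k, l))"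
      by (metis surj_pair)
    have "measure_pmf.prob bridge_system (?B q)
        = measure_pmf.prob (map_pmf (\<lambda>(a, b, w). (w (i, j), w (k, l))) bridge_system) (conflicts steps R)"
      unfolding measure_map_pmf ijkl by (intro arg_cong2[where f = measure] refl) auto
    also have "\<dots> = measure_pmf.prob (pair_pmf bridge_law bridge_law) (conflicts steps R)"
      using q unfolding ijkl by (subst bridge_system_pair) auto
    also have "\<dots> \<le> 36 * measure_pmf.prob (pair_pmf (stationary_walk steps) (stationary_walk steps))
        (conflicts steps R)"
      by (rule prob_bridge_pair_le)
    also have "\<dots> \<le> \<beta>"
      unfolding \<beta>_def by (intro mult_left_mono prob_conflicts R) auto
    finally show ?thesis .
  qed
  then have "measure_pmf.prob bridge_system (\<Union>q\<in>independent_pairs. ?B q) \<le> (\<Sum>q\<in>independent_pairs. \<beta>)"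
    using finite_independent_pairs by (intro order_trans[OF measure_UNION_le] sum_mono) auto
  also have "\<dots> = 18 * \<beta>"
    by (simp add: card_independent_pairs)
  also have "\<dots> < 1"
  proof -
    define M x y where "M = real (card E)" and "x = real ((steps + 1)\<^sup>2) * card V" and "y = real (steps\<^sup>2) * \<zeta>"
    have "0 < M" "0 \<le> x" "0 \<le> y" "648 * (x + y) \<le> M"
      using card_E_pos \<zeta> m by (auto simp: M_def x_def y_def)
    moreover have "18 * \<beta> = 648 * (x / 2 + y / 4) / M"
      using card_E_pos by (simp add: \<beta>_def M_def x_def y_def field_simps)
    ultimately show ?thesis
      by (simp add: pos_divide_less_eq)
  qed
  finally obtain z where z: "z \<in> set_pmf bridge_system" "z \<notin> (\<Union>q\<in>independent_pairs. ?B q)"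
    by (rule prob_less_1_witness)
  obtain a b w where "z = (a, b, w)"
    by (rule prod_cases3)
  then show thesis
    using z by (intro that[of a b w]) fastforce+
qed

lemma reduced_walk_edge:
  assumes v: "v \<in> V" "xs \<in> set_pmf (walk T v)" and e: "e \<in> set (walk_edges (remdups_adj xs))"
  obtains s where "s < T" "e = {xs ! s, xs ! Suc s}" "e \<in> E"
proof -
  obtain s where "Suc s < length xs" "xs ! s \<noteq> xs ! Suc s" "e = {xs ! s, xs ! Suc s}"
    using walk_edges_remdups_adj[OF e] by blast
  then show thesis
    using walk_support[OF v] by (intro that[of s]) auto
qed

lemma reduced_bridge:
  assumes ab: "a \<in> V \<inter> A" "b \<in> V - A" and xs: "xs \<in> set_pmf (walk T a)" "last xs = b"
  defines "w \<equiv> remdups_adj xs"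
  shows "w \<noteq> []" "hd w = a" "last w = b" "set (walk_edges w) \<subseteq> E" "even (length w)"
proof -
  have a: "a \<in> V"
    using ab(1) by simp
  have "xs \<noteq> []" "hd xs = a"
    using walk_support[OF a xs(1)] by auto
  then show ends: "w \<noteq> []" "hd w = a" "last w = b"
    using xs(2) by (auto simp: w_def)
  show edges: "set (walk_edges w) \<subseteq> E"
    unfolding w_def using reduced_walk_edge[OF a xs(1)] by blast
  have "even (length w) \<longleftrightarrow> (hd w \<in> A) \<noteq> (last w \<in> A)"
    using edges edge bipartite by (intro bipartite_walk_parity ends(1)) blast
  then show "even (length w)"
    using ends ab by simp
qed

lemma reduced_walks_without_conflicts:
  assumes xs: "v \<in> V" "xs \<in> set_pmf (walk T v)" and ys: "u \<in> V" "ys \<in> set_pmf (walk T u)"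
    and "(xs, ys) \<notin> conflicts T R"
  shows "set (remdups_adj xs) \<inter> set (remdups_adj ys) = {}"
    and "\<lbrakk>e \<in> set (walk_edges (remdups_adj xs)); f \<in> set (walk_edges (remdups_adj ys))\<rbrakk> \<Longrightarrow> \<not> R e f"
proof -
  have "xs ! s \<noteq> ys ! t" if "s \<le> T" "t \<le> T" for s t
    using assms(5) that unfolding conflicts_def by auto
  moreover have "length xs = Suc T" "length ys = Suc T"
    using walk_support[OF xs] walk_support[OF ys] by simp_all
  ultimately show "set (remdups_adj xs) \<inter> set (remdups_adj ys) = {}"
    by (auto simp: in_set_conv_nth less_Suc_eq_le) metis
  assume e: "e \<in> set (walk_edges (remdups_adj xs))" and f: "f \<in> set (walk_edges (remdups_adj ys))"
  obtain s where "s < T" "e = {xs ! s, xs ! Suc s}" "e \<in> E"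
    by (rule reduced_walk_edge[OF xs e])
  moreover obtain t where "t < T" "f = {ys ! t, ys ! Suc t}" "f \<in> E"
    by (rule reduced_walk_edge[OF ys f])
  ultimately show "\<not> R e f"
    using assms(5) unfolding conflicts_def by blast
qed

theorem unrelated_walk_system:
  fixes \<zeta> :: real
  assumes R: "\<And>e. e \<in> E \<Longrightarrow> card {f \<in> E. R e f} \<le> \<zeta>" and \<zeta>: "0 \<le> \<zeta>"
    and m: "648 * (real ((steps + 1)\<^sup>2) * card V + real (steps\<^sup>2) * \<zeta>) \<le> card E"
  obtains a b w where "K33_walk_system E a b w"
    "\<And>i j k l e f. \<lbrakk>((i, j), (k, l)) \<in> independent_pairs; e \<in> set (walk_edges (w i j));
        f \<in> set (walk_edges (w k l))\<rbrakk>
      \<Longrightarrow> \<not> R e f"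
proof -
  obtain a b w where abw: "(a, b, w) \<in> set_pmf bridge_system"
    and free: "\<And>i j k l. ((i, j), (k, l)) \<in> independent_pairs \<Longrightarrow> (w (i, j), w (k, l)) \<notin> conflicts steps R"
    by (rule bridge_system_without_conflicts[OF R \<zeta> m]) (assumption | rule that)+
  note supp = bridge_system_support[OF abw]
  define W where "W i j = remdups_adj (w (i, j))" for i j
  have walks: "W i j \<noteq> [] \<and> hd (W i j) = a i \<and> last (W i j) = b j \<and> even (length (W i j))
      \<and> set (walk_edges (W i j)) \<subseteq> E" if ij: "i < 3" "j < 3" for i j
    using reduced_bridge[OF supp[OF ij]] by (simp add: W_def)
  have unrelated: "set (W i j) \<inter> set (W k l) = {}"
      "\<lbrakk>e \<in> set (walk_edges (W i j)); f \<in> set (walk_edges (W k l))\<rbrakk> \<Longrightarrow> \<not> R e f"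
    if q: "((i, j), (k, l)) \<in> independent_pairs" for i j k l e f
  proof -
    have ijkl: "i < 3" "j < 3" "k < 3" "l < 3"
      using q by (auto simp: independent_pairs_def)
    note sep = reduced_walks_without_conflicts[OF _ supp(3)[OF ijkl(1,2)] _ supp(3)[OF ijkl(3,4)] free[OF q]]
    have "a i \<in> V" "a k \<in> V"
      using supp(1) ijkl by auto
    then show "set (W i j) \<inter> set (W k l) = {}"
        "\<lbrakk>e \<in> set (walk_edges (W i j)); f \<in> set (walk_edges (W k l))\<rbrakk> \<Longrightarrow> \<not> R e f"
      unfolding W_def by (rule sep(1), rule sep(2))
  qed
  show thesis
  proof (rule that)
    show "K33_walk_system E a b W"
      unfolding K33_walk_system_def using walks unrelated(1) by blast
  qed (rule unrelated(2))
qed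

end

section \<open>Dense cores\<close>

definition cut :: "'a set set \<Rightarrow> 'a set \<Rightarrow> 'a set set" where
  "cut E A = {e \<in> E. card (e \<inter> A) = 1}"



lemma cut_cong: "(\<And>e. e \<in> E \<Longrightarrow> e \<inter> A = e \<inter> B) \<Longrightarrow> cut E A = cut E B"
  unfolding cut_def by (intro Collect_cong conj_cong refl) simp

lemma finite_cut: "finite E \<Longrightarrow> finite (cut E A)"
  by (simp add: cut_def)

lemma card_star_le_cuts:
  assumes "finite X" and X: "\<And>e. e \<in> X \<Longrightarrow> x \<in> e \<and> card e = 2"
  shows "card X \<le> card (cut X (A - {x})) + card (cut X (insert x A))"
proof -
  have "X \<subseteq> cut X (A - {x}) \<union> cut X (insert x A)"
  proof
    fix e assume e: "e \<in> X"
    then have "card (e - {x}) = 1"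
      using X by simp
    then obtain u where "e - {x} = {u}"
      by (auto simp: card_1_singleton_iff)
    then have u: "u \<noteq> x" "e = {x, u}"
      using X[OF e] by auto
    show "e \<in> cut X (A - {x}) \<union> cut X (insert x A)"
    proof (cases "u \<in> A")
      case True
      then have "e \<inter> (A - {x}) = {u}"
        using u by auto
      then show ?thesis
        using e by (simp add: cut_def)
    next
      case False
      then have "e \<inter> insert x A = {x}"
        using u by auto
      then show ?thesis
        using e by (simp add: cut_def)
    qed
  qed
  then have "card X \<le> card (cut X (A - {x}) \<union> cut X (insert x A))"
    using assms(1) by (intro card_mono) (auto simp: finite_cut)
  also have "\<dots> \<le> card (cut X (A - {x})) + card (cut X (insert x A))"
    by (rule card_Un_le)
  finally show ?thesis .
qed

lemma large_cut_exists:
  assumes "finite V" "finite E" "\<And>e. e \<in> E \<Longrightarrow> e \<subseteq> V \<and> card e = 2"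
  shows "\<exists>A. card E \<le> 2 * card (cut E A)"
  using assms
proof (induction V arbitrary: E rule: finite_induct)
  case empty
  then have "E = {}"
    by fastforce
  then show ?case
    by simp
next
  case (insert x V)
  define X where "X = {e \<in> E. x \<in> e}"
  have fin: "finite (E - X)" "finite X"
    using insert.prems(1) by (auto simp: X_def)
  have "\<exists>A. card (E - X) \<le> 2 * card (cut (E - X) A)"
    using insert.prems fin by (intro insert.IH) (auto simp: X_def)
  then obtain A where A: "card (E - X) \<le> 2 * card (cut (E - X) A)"
    by blast
  have cut: "card (cut E B) = card (cut (E - X) A) + card (cut X B)" if "B - {x} = A - {x}" for B
  proof -
    have "cut (E - X) B = cut (E - X) A"
      using that by (intro cut_cong) (auto simp: X_def)
    moreover have "cut E B = cut (E - X) B \<union> cut X B"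
      by (auto simp: cut_def X_def)
    moreover have "cut (E - X) B \<inter> cut X B = {}"
      by (auto simp: cut_def)
    ultimately show ?thesis
      using fin by (simp add: card_Un_disjoint finite_cut)
  qed
  have star: "card X \<le> card (cut X (A - {x})) + card (cut X (insert x A))"
    using fin(2) insert.prems(2) by (intro card_star_le_cuts) (auto simp: X_def)
  have "card E \<le> card (E - X) + card X"
    by (metis card_Un_le Diff_partition X_def Collect_subset Un_commute)
  then show ?case
    using A star cut[of "A - {x}"] cut[of "insert x A"]
    by (cases "card (cut X (insert x A)) \<le> card (cut X (A - {x}))")
      (intro exI[of _ "A - {x}"] exI[of _ "insert x A"]; simp)+
qed

lemma densest_subset:
  fixes \<Phi> :: "nat \<Rightarrow> real"
  assumes V: "finite V" "V \<noteq> {}" and pos: "\<And>n. 1 \<le> n \<Longrightarrow> 0 < \<Phi> n"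
  obtains W where "W \<subseteq> V" "W \<noteq> {}"
    "\<And>U. \<lbrakk>U \<subseteq> V; U \<noteq> {}\<rbrakk> \<Longrightarrow> card (inner_edges E U) * \<Phi> (card W) \<le> card (inner_edges E W) * \<Phi> (card U)"
proof -
  define \<S> where "\<S> = {U. U \<subseteq> V \<and> U \<noteq> {}}"
  define \<phi> where "\<phi> U = card (inner_edges E U) / \<Phi> (card U)" for U
  have fin: "finite (\<phi> ` \<S>)" and "\<phi> ` \<S> \<noteq> {}"
    using V by (auto simp: \<S>_def)
  then have "Max (\<phi> ` \<S>) \<in> \<phi> ` \<S>"
    by (rule Max_in)
  then obtain W where W: "W \<in> \<S>" "\<phi> W = Max (\<phi> ` \<S>)"
    by auto
  have \<Phi>: "0 < \<Phi> (card U)" if "U \<in> \<S>" for U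
  proof -
    have "finite U" "U \<noteq> {}"
      using that V(1) finite_subset by (auto simp: \<S>_def)
    then show ?thesis
      by (intro pos) (simp add: Suc_le_eq card_gt_0_iff)
  qed
  show thesis
  proof (rule that[of W])
    show "W \<subseteq> V" "W \<noteq> {}"
      using W by (auto simp: \<S>_def)
    fix U assume "U \<subseteq> V" "U \<noteq> {}"
    then have U: "U \<in> \<S>"
      by (simp add: \<S>_def)
    then have "\<phi> U \<le> \<phi> W"
      using Max_ge[OF fin, of "\<phi> U"] W(2) by simp
    then show "card (inner_edges E U) * \<Phi> (card W) \<le> card (inner_edges E W) * \<Phi> (card U)"
      using \<Phi>[OF U] \<Phi>[OF W(1)] by (simp add: \<phi>_def field_simps)
  qed
qed

locale dense_core = finite_graph +
  assumes dense: "\<lbrakk>U \<subseteq> V; U \<noteq> {}\<rbrakk> \<Longrightarrow> card (inner_edges E U) / card E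
      \<le> card U / card V * ((1 + ln (card U)) / (1 + ln (card V)))"
begin

lemma card_V_ge_2: "2 \<le> card V"
proof -
  obtain e where "e \<in> E"
    using E_ne by blast
  then show ?thesis
    using edge[of e] card_mono[OF finite_V, of e] by simp
qed

definition \<Lambda> :: real where
  "\<Lambda> = 1 + ln (card V)"

lemma \<Lambda>_ge_1: "1 \<le> \<Lambda>"
  using card_V_ge_2 by (simp add: \<Lambda>_def)

lemma card_subset_bounds:
  assumes "U \<subseteq> V" "U \<noteq> {}"
  shows "0 < card U" "card U \<le> card V" "0 \<le> ln (card V / card U)" "ln (card V / card U) \<le> \<Lambda>"
    "1 + ln (card U) = \<Lambda> - ln (card V / card U)"
proof -
  show pos: "0 < card U"
    using finite_subset[OF assms(1) finite_V] assms(2) by (simp add: card_gt_0_iff)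
  show card_le: "card U \<le> card V"
    using card_mono[OF finite_V assms(1)] .
  have ln: "ln (card V / card U) = ln (card V) - ln (card U)"
    using pos card_le by (simp add: ln_div)
  have "0 \<le> ln (card U)" "ln (card U) \<le> ln (card V)"
    using pos card_le by auto
  then show "0 \<le> ln (card V / card U)" "ln (card V / card U) \<le> \<Lambda>" "1 + ln (card U) = \<Lambda> - ln (card V / card U)"
    using ln by (auto simp: \<Lambda>_def)
qed

lemma card_inner_edges_le:
  assumes U: "U \<subseteq> V" "U \<noteq> {}"
  shows "card (inner_edges E U) / card E \<le> card U / card V * (1 - ln (card V / card U) / \<Lambda>)"
proof -
  have "(1 + ln (card U)) / \<Lambda> = 1 - ln (card V / card U) / \<Lambda>"
    unfolding card_subset_bounds(5)[OF U] using \<Lambda>_ge_1 by (simp add: diff_divide_distrib)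
  then show ?thesis
    using dense[OF U] by (simp add: \<Lambda>_def)
qed

lemma degree_ge:
  assumes v: "v \<in> V"
  shows "card E \<le> card (incident v) * card V"
proof -
  let ?U = "V - {v}"
  have card_U: "card ?U = card V - 1"
    using v by simp
  moreover have "0 < card V - 1"
    using card_V_ge_2 by simp
  ultimately have U: "?U \<subseteq> V" "?U \<noteq> {}"
    by (metis Diff_subset, metis card.empty less_irrefl)
  have "inner_edges E ?U = E - incident v"
    using edge by (auto simp: inner_edges_def incident_def)
  then have "real (card (inner_edges E ?U)) = real (card E) - real (card (incident v))"
    using finite_E card_mono[OF finite_E, of "incident v"] finite_incident
    by (simp add: card_Diff_subset of_nat_diff incident_def)
  then have "1 - card (incident v) / card E = card (inner_edges E ?U) / card E"
    using card_E_pos by (simp add: diff_divide_distrib)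
  also have "\<dots> \<le> card ?U / card V * (1 - ln (card V / card ?U) / \<Lambda>)"
    by (rule card_inner_edges_le[OF U])
  also have "\<dots> \<le> card ?U / card V * 1"
    using card_subset_bounds(3)[OF U] \<Lambda>_ge_1 by (intro mult_left_mono) auto
  also have "\<dots> = 1 - 1 / card V"
    using card_U card_V_ge_2 by (simp add: of_nat_diff diff_divide_distrib)
  finally have "1 / real (card V) \<le> card (incident v) / card E"
    by linarith
  then have "real (card E) \<le> real (card (incident v) * card V)"
    using card_E_pos card_V_ge_2 by (simp add: field_simps)
  then show ?thesis
    using of_nat_le_iff by blast
qed

sublocale covered_graph
proof
  show "incident v \<noteq> {}" if "v \<in> V" for v
  proof
    assume "incident v = {}"
    then show False
      using degree_ge[OF that] card_E_pos by simp
  qed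
qed

lemma sum_\<pi>_ge:
  assumes "U \<subseteq> V"
  shows "card U / (2 * card V) \<le> sum \<pi> U"
proof -
  have "1 / (2 * card V) \<le> \<pi> v" if "v \<in> U" for v
  proof -
    have "real (card E) \<le> real (card (incident v) * card V)"
      using degree_ge[of v] that assms unfolding of_nat_le_iff by blast
    then show ?thesis
      using card_E_pos card_V_ge_2 by (simp add: \<pi>_eq field_simps)
  qed
  then have "(\<Sum>v\<in>U. 1 / (2 * card V)) \<le> sum \<pi> U"
    by (rule sum_mono)
  then show ?thesis
    by simp
qed

lemma sum_\<pi>_eq_inner_plus_flow:
  assumes U: "U \<subseteq> V"
  shows "sum \<pi> U = card (inner_edges E U) / card E + flow_out U"
proof -
  have "sum \<pi> U = (\<Sum>v\<in>U. (\<Sum>u\<in>U. edge_weight E v u) + (\<Sum>u\<in>V - U. edge_weight E v u))"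
    unfolding \<pi>_def using U finite_V by (intro sum.cong refl) (simp add: sum.subset_diff)
  then show ?thesis
    by (simp add: sum.distrib sum_edge_weight_inner[OF U] flow_out_def)
qed

lemma flow_out_compl:
  assumes "U \<subseteq> V"
  shows "flow_out (V - U) = flow_out U"
proof -
  have "flow_out (V - U) = (\<Sum>v\<in>V - U. \<Sum>u\<in>U. edge_weight E v u)"
    using assms by (simp add: flow_out_def double_diff)
  also have "\<dots> = (\<Sum>u\<in>U. \<Sum>v\<in>V - U. edge_weight E v u)"
    by (rule sum.swap)
  also have "\<dots> = flow_out U"
    unfolding flow_out_def by (intro sum.cong refl edge_weight_sym)
  finally show ?thesis .
qed

lemma sum_\<pi>_compl: "U \<subseteq> V \<Longrightarrow> sum \<pi> (V - U) = 1 - sum \<pi> U"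
  using finite_V sum_\<pi> by (simp add: sum_diff)

lemma flow_out_ge:
  assumes U: "U \<subseteq> V" "U \<noteq> {}" "U \<noteq> V"
  shows "sum \<pi> U * ln (card V / card U) \<le> 3 * \<Lambda> * flow_out U"
proof -
  let ?W = "V - U"
  have W: "?W \<subseteq> V" "?W \<noteq> {}"
    using U by auto
  define x l i where "x = card U / card V" and "l = ln (card V / card U)" and "i = card (inner_edges E U) / card E"
  define y r j where "y = card ?W / card V" and "r = ln (card V / card ?W)"
    and "j = card (inner_edges E ?W) / card E"
  define out where "out = flow_out U"
  have "card ?W + card U = card V"
    using U(1) finite_subset[OF U(1) finite_V] card_mono[OF finite_V U(1)] by (simp add: card_Diff_subset)
  then have xy: "x + y = 1"
    using card_V_ge_2 unfolding x_def y_def by (simp flip: add_divide_distrib of_nat_add)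
  have \<Lambda>: "0 < \<Lambda>"
    using \<Lambda>_ge_1 by simp
  have nonneg: "0 \<le> x" "0 \<le> y" "0 \<le> l" "0 \<le> r" "l \<le> \<Lambda>"
    using card_subset_bounds(3,4)[OF U(1,2)] card_subset_bounds(3)[OF W] by (auto simp: x_def y_def l_def r_def)
  have "i \<le> x * (1 - l / \<Lambda>)"
    unfolding i_def x_def l_def by (rule card_inner_edges_le[OF U(1,2)])
  then have i: "i \<le> x - x * l / \<Lambda>"
    by (simp add: algebra_simps)
  have "j \<le> y * (1 - r / \<Lambda>)"
    unfolding j_def y_def r_def by (rule card_inner_edges_le[OF W])
  also have "\<dots> \<le> y"
    using nonneg \<Lambda> by (simp add: mult_left_le)
  finally have j: "j \<le> y" .
  have "(i + out) + (j + out) = 1"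
    using sum_\<pi>_eq_inner_plus_flow[OF U(1)] sum_\<pi>_eq_inner_plus_flow[OF W(1)]
      flow_out_compl[OF U(1)] sum_\<pi>_compl[OF U(1)]
    by (simp add: i_def j_def out_def)
  then have flow: "x * l / \<Lambda> \<le> 2 * out"
    using i j xy by linarith
  moreover have "0 \<le> x * l / \<Lambda>"
    using nonneg \<Lambda> by simp
  ultimately have inner_le: "i \<le> x" and out: "0 \<le> out"
    using i by linarith+
  have "sum \<pi> U * l = i * l + out * l"
    using sum_\<pi>_eq_inner_plus_flow[OF U(1)] by (simp add: i_def out_def distrib_right)
  also have "\<dots> \<le> x * l + out * \<Lambda>"
    using inner_le out nonneg by (intro add_mono mult_right_mono mult_left_mono) auto
  also have "\<dots> \<le> 3 * \<Lambda> * out"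
    using flow \<Lambda> by (simp add: pos_divide_le_eq algebra_simps)
  finally show ?thesis
    by (simp add: l_def out_def)
qed

lemma expansion_of_small_set:
  assumes U: "U \<subseteq> V" "U \<noteq> {}" "3 * card U \<le> 2 * card V"
  shows "(1 + ln (1 / sum \<pi> U)) * sum \<pi> U \<le> 40 * \<Lambda> * flow_out U"
proof -
  define p l where "p = sum \<pi> U" and "l = ln (card V / card U)"
  have n: "0 < real (card V)" "0 < real (card U)"
    using card_V_ge_2 card_subset_bounds(1)[OF U(1,2)] by auto
  have p_ge: "card U / (2 * card V) \<le> p"
    unfolding p_def by (rule sum_\<pi>_ge[OF U(1)])
  moreover have "0 < card U / (2 * card V)"
    using n by simp
  ultimately have p: "0 < p"
    by linarith
  have "3 / 2 \<le> card V / card U"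
    using U(3) n by (simp add: field_simps flip: of_nat_mult)
  then have "ln (3 / 2) \<le> l"
    unfolding l_def by (intro ln_mono) (use n in auto)
  moreover have "ln (2 / 3 :: real) \<le> 2 / 3 - 1"
    by (intro ln_le_minus_one) simp
  moreover have "ln (3 / 2 :: real) = - ln (2 / 3)"
    by (simp add: ln_div)
  ultimately have l: "1 / 3 \<le> l"
    by linarith
  have "1 / p \<le> 2 * (card V / card U)"
    using p_ge p n by (simp add: field_simps)
  then have "ln (1 / p) \<le> ln (2 * (card V / card U))"
    using p by (intro ln_mono) auto
  also have "\<dots> = ln 2 + l"
    unfolding l_def using n by (intro ln_mult_pos) auto
  also have "ln (2::real) \<le> 1"
    using ln_le_minus_one[of "2::real"] by simp
  finally have "1 + ln (1 / p) \<le> 40 / 3 * l"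
    using l by linarith
  then have "(1 + ln (1 / p)) * p \<le> 40 / 3 * l * p"
    using p by (intro mult_right_mono) auto
  also have "\<dots> = 40 / 3 * (p * l)"
    by simp
  also have "\<dots> \<le> 40 / 3 * (3 * \<Lambda> * flow_out U)"
    unfolding p_def l_def using U n by (intro mult_left_mono flow_out_ge) auto
  finally show ?thesis
    by (simp add: p_def)
qed

lemma expansion_of_large_set:
  assumes U: "U \<subseteq> V" "sum \<pi> U \<le> 1 / 2" "2 * card V < 3 * card U"
  shows "(1 + ln (1 / sum \<pi> U)) * sum \<pi> U \<le> 40 * \<Lambda> * flow_out U"
proof -
  let ?W = "V - U"
  define p where "p = sum \<pi> U"
  have "U \<noteq> V"
    using U(2) sum_\<pi> by auto
  moreover have "U \<noteq> {}"
    using U(3) by auto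
  ultimately have W: "?W \<subseteq> V" "?W \<noteq> {}" "?W \<noteq> V"
    using U(1) by auto
  have pos: "0 < real (card V)" "0 < real (card U)" "0 < card ?W"
    using card_V_ge_2 U(3) card_subset_bounds(1)[OF W(1,2)] by auto
  have "1 / 3 \<le> card U / (2 * card V)"
    using U(3) pos by (simp add: field_simps)
  then have third: "1 / 3 \<le> p"
    using sum_\<pi>_ge[OF U(1)] unfolding p_def by linarith
  have "card ?W + card U = card V"
    using U(1) finite_subset[OF U(1) finite_V] card_mono[OF finite_V U(1)] by (simp add: card_Diff_subset)
  then have "3 * real (card ?W) \<le> card V"
    using U(3) by linarith
  then have "3 \<le> card V / card ?W"
    using pos(3) by (simp add: field_simps)
  then have "ln 3 \<le> ln (card V / card ?W)"
    by (intro ln_mono) (use pos in auto)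
  moreover have "1 \<le> ln (3::real)"
    using ln_ge_iff[of 3 1] exp_le by simp
  ultimately have ln_W: "1 \<le> ln (card V / card ?W)"
    by linarith
  have "p \<le> sum \<pi> ?W"
    using sum_\<pi>_compl[OF U(1)] U(2) by (simp add: p_def)
  then have "p \<le> sum \<pi> ?W * ln (card V / card ?W)"
    using third mult_left_mono[OF ln_W, of "sum \<pi> ?W"] by linarith
  also have "\<dots> \<le> 3 * \<Lambda> * flow_out U"
    using flow_out_ge[OF W] flow_out_compl[OF U(1)] by simp
  finally have flow: "p \<le> 3 * \<Lambda> * flow_out U" .
  have "1 / p \<le> 3"
    using third by (simp add: field_simps)
  moreover have "ln (1 / p) \<le> 1 / p - 1"
    using third by (intro ln_le_minus_one) simp
  ultimately have "(1 + ln (1 / p)) * p \<le> 3 * p"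
    using third by (intro mult_right_mono) auto
  also have "\<dots> \<le> 40 * \<Lambda> * flow_out U"
    using flow third by linarith
  finally show ?thesis
    unfolding p_def .
qed

lemma expanding_core: "expanding_network V (edge_weight E) (1 / (40 * \<Lambda>))"
proof unfold_locales
  show "0 < 1 / (40 * \<Lambda>)"
    using \<Lambda>_ge_1 by simp
  fix U assume U: "U \<subseteq> V" "U \<noteq> {}" "sum \<pi> U \<le> 1 / 2"
  have "(1 + ln (1 / sum \<pi> U)) * sum \<pi> U \<le> 40 * \<Lambda> * flow_out U"
    using expansion_of_small_set[OF U(1,2)] expansion_of_large_set[OF U(1,3)] by linarith
  then show "1 / (40 * \<Lambda>) * (1 + ln (1 / sum \<pi> U)) * sum \<pi> U \<le> flow_out U"
    using \<Lambda>_ge_1 by (simp add: field_simps)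
qed

lemma mixing_steps_le: "real (2 * expanding_network.mixing_steps (1 / (40 * \<Lambda>))) + 1 \<le> 76805 * \<Lambda>\<^sup>2"
proof -
  have ceiling: "real (nat \<lceil>x\<rceil>) \<le> x + 1" if "0 \<le> x" for x
    using that by linarith
  have "real (expanding_network.mixing_steps (1 / (40 * \<Lambda>)))
      \<le> (8 / (1 / (40 * \<Lambda>))\<^sup>2 + 1) + (16 / (1 / (40 * \<Lambda>))\<^sup>2 + 1)"
    unfolding expanding_network.mixing_steps_def[OF expanding_core] of_nat_add
    by (intro add_mono ceiling) auto
  also have "\<dots> = 38400 * \<Lambda>\<^sup>2 + 2"
    by (simp add: power2_eq_square)
  finally have "real (expanding_network.mixing_steps (1 / (40 * \<Lambda>))) \<le> 38400 * \<Lambda>\<^sup>2 + 2" .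
  moreover have "1 \<le> \<Lambda>\<^sup>2"
    using \<Lambda>_ge_1 by (simp add: one_le_power)
  ultimately show ?thesis
    by simp
qed

end

definition polylog_size :: "nat \<Rightarrow> nat \<Rightarrow> real" where
  "polylog_size q n = real n * (1 + ln (real n)) ^ q"

lemma polylog_size_pos: "1 \<le> n \<Longrightarrow> 0 < polylog_size q n"
  by (auto simp: polylog_size_def intro!: mult_pos_pos zero_less_power add_pos_nonneg)

lemma polylog_size_ratio_le:
  assumes "1 \<le> m" "m \<le> n" "1 \<le> q"
  shows "polylog_size q m / polylog_size q n \<le> m / n * ((1 + ln (real m)) / (1 + ln (real n)))"
proof -
  define r where "r = (1 + ln (real m)) / (1 + ln (real n))"
  have "0 \<le> ln (real m)" "ln (real m) \<le> ln (real n)"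
    using assms(1,2) by simp_all
  then have "0 \<le> r" "r \<le> 1"
    by (simp_all add: r_def)
  then have "real m / real n * r ^ q \<le> real m / real n * r ^ 1"
    using assms(3) by (intro mult_left_mono power_decreasing) auto
  then show ?thesis
    by (simp add: polylog_size_def r_def power_divide)
qed

text \<open>A vertex set maximising the number of inner edges relative to \<open>polylog_size\<close> spans a dense core.\<close>

lemma dense_core_exists:
  assumes "finite_graph V E" "1 \<le> q"
  obtains W where "W \<subseteq> V" "dense_core W (inner_edges E W)"
    "card E * polylog_size q (card W) \<le> card (inner_edges E W) * polylog_size q (card V)"
proof -
  interpret finite_graph V E
    by fact
  have inner_V: "inner_edges E V = E"
    using edge by (auto simp: inner_edges_def)
  have "V \<noteq> {}"
    using E_ne edge edge_ne by blast
  then obtain W where W: "W \<subseteq> V" "W \<noteq> {}" and max: "\<And>U. \<lbrakk>U \<subseteq> V; U \<noteq> {}\<rbrakk> \<Longrightarrow>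
      card (inner_edges E U) * polylog_size q (card W) \<le> card (inner_edges E W) * polylog_size q (card U)"
    by (rule densest_subset[OF finite_V, where E = E and \<Phi> = "polylog_size q"]) (auto intro: polylog_size_pos)
  define F where "F = inner_edges E W"
  have card_ge_1: "1 \<le> card U" if "U \<subseteq> V" "U \<noteq> {}" for U
    using that finite_subset[OF that(1) finite_V] by (simp add: Suc_le_eq card_gt_0_iff)
  have EW: "card E * polylog_size q (card W) \<le> card F * polylog_size q (card V)"
    using max[OF order_refl \<open>V \<noteq> {}\<close>] by (simp add: inner_V F_def)
  moreover have "0 < card E * polylog_size q (card W)"
    using card_E_pos polylog_size_pos[OF card_ge_1[OF W]] by simp
  ultimately have F: "0 < card F"
    by (metis less_le_not_le linorder_neqE_nat mult_zero_left not_less0 of_nat_0)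
  have "dense_core W F"
  proof
    show "finite W"
      using W(1) finite_V by (rule finite_subset)
    show "e \<subseteq> W \<and> card e = 2" if "e \<in> F" for e
      using that edge by (auto simp: F_def inner_edges_def)
    show "F \<noteq> {}"
      using F by auto
    fix U assume U: "U \<subseteq> W" "U \<noteq> {}"
    then have UV: "U \<subseteq> V"
      using W(1) by blast
    have "inner_edges F U = inner_edges E U"
      using U(1) by (auto simp: F_def inner_edges_def)
    then have "card (inner_edges F U) * polylog_size q (card W) \<le> card F * polylog_size q (card U)"
      using max[OF UV U(2)] by (simp add: F_def)
    then have "card (inner_edges F U) / card F \<le> polylog_size q (card U) / polylog_size q (card W)"
      using F polylog_size_pos[OF card_ge_1[OF W], of q] by (simp add: field_simps)
    also have "\<dots> \<le> card U / card W * ((1 + ln (card U)) / (1 + ln (card W)))"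
      using card_ge_1[OF UV U(2)] card_mono[OF finite_subset[OF W(1) finite_V] U(1)] assms(2)
      by (intro polylog_size_ratio_le) auto
    finally show "card (inner_edges F U) / card F \<le> card U / card W * ((1 + ln (card U)) / (1 + ln (card W)))" .
  qed
  then show thesis
    using W(1) EW unfolding F_def by (intro that)
qed

lemma polylog_bound_from_dense_cores:
  assumes "finite_graph V E" "1 \<le> q"
    and core: "\<And>W. \<lbrakk>W \<subseteq> V; dense_core W (inner_edges E W)\<rbrakk> \<Longrightarrow> card (inner_edges E W) \<le> K * polylog_size q (card W)"
  shows "card E \<le> K * polylog_size q (card V)"
proof -
  interpret finite_graph V E
    by fact
  obtain W where W: "W \<subseteq> V" "dense_core W (inner_edges E W)"
    and EW: "card E * polylog_size q (card W) \<le> card (inner_edges E W) * polylog_size q (card V)"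
    by (rule dense_core_exists[OF assms(1,2)])
  have "1 \<le> card W"
    using dense_core.card_V_ge_2[OF W(2)] by simp
  moreover have "1 \<le> card V"
    using \<open>1 \<le> card W\<close> card_mono[OF finite_V W(1)] by simp
  ultimately have pos: "0 < polylog_size q (card W)" "0 < polylog_size q (card V)"
    by (auto intro: polylog_size_pos)
  have "card (inner_edges E W) * polylog_size q (card V) \<le> K * polylog_size q (card W) * polylog_size q (card V)"
    using core[OF W] pos(2) by (intro mult_right_mono) auto
  then have "card E * polylog_size q (card W) \<le> (K * polylog_size q (card V)) * polylog_size q (card W)"
    using EW by (simp add: mult_ac)
  then show ?thesis
    using pos(1) by simp
qed

section \<open>The edge bound\<close>

context simple_tg
begin

lemma finite_graph: "\<lbrakk>F \<subseteq> E; F \<noteq> {}\<rbrakk> \<Longrightarrow> finite_graph V F"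
  using finite_V edgeD(1,2) by unfold_locales auto

lemma card_dense_bipartite_core_le:
  fixes \<zeta> :: real
  assumes core: "dense_core V E" and bipartite: "\<And>e. e \<in> E \<Longrightarrow> card (e \<inter> A) = 1"
    and \<zeta>: "\<And>e. e \<in> E \<Longrightarrow> card {f \<in> E. edges_disjoint curve e f} \<le> \<zeta>"
  shows "card E \<le> 648 * 76805\<^sup>2 * (1 + ln (card V)) ^ 4 * (card V + \<zeta>)"
proof (rule ccontr)
  assume large: "\<not> ?thesis"
  interpret dense_core V E
    by (rule core)
  interpret bipartite_expander V E "1 / (40 * \<Lambda>)" A
    by (intro bipartite_expander.intro expanding_core bipartite_expander_axioms.intro covered_graph_axioms
      bipartite)
  obtain e where "e \<in> E"
    using E_ne by blast
  then have \<zeta>_nonneg: "0 \<le> \<zeta>"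
    using \<zeta>[of e] by linarith
  have "(real steps + 1)\<^sup>2 \<le> (76805 * \<Lambda>\<^sup>2)\<^sup>2"
    using mixing_steps_le by (intro power_mono) auto
  then have steps: "real ((steps + 1)\<^sup>2) \<le> 76805\<^sup>2 * \<Lambda> ^ 4"
    by (simp add: power_mult_distrib add.commute flip: power_mult)
  moreover have "real (steps\<^sup>2) \<le> real ((steps + 1)\<^sup>2)"
    unfolding of_nat_le_iff by (intro power_mono) auto
  ultimately have "648 * (real ((steps + 1)\<^sup>2) * card V + real (steps\<^sup>2) * \<zeta>)
      \<le> 648 * (76805\<^sup>2 * \<Lambda> ^ 4 * card V + 76805\<^sup>2 * \<Lambda> ^ 4 * \<zeta>)"
    using \<zeta>_nonneg by (intro mult_left_mono add_mono mult_right_mono) auto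
  also have "\<dots> = 648 * 76805\<^sup>2 * \<Lambda> ^ 4 * (card V + \<zeta>)"
    by (simp add: algebra_simps)
  also have "\<dots> \<le> card E"
    using large unfolding \<Lambda>_def by linarith
  finally have many_edges: "648 * (real ((steps + 1)\<^sup>2) * card V + real (steps\<^sup>2) * \<zeta>) \<le> card E" .
  obtain a b w where w: "K33_walk_system E a b w"
    "\<And>i j k l e f. \<lbrakk>((i, j), (k, l)) \<in> independent_pairs; e \<in> set (walk_edges (w i j));
        f \<in> set (walk_edges (w k l))\<rbrakk>
      \<Longrightarrow> \<not> edges_disjoint curve e f"
    by (rule unrelated_walk_system[OF \<zeta> \<zeta>_nonneg many_edges]) (assumption | rule that)+
  show False
    using K33_walk_system_disjoint_edges[OF w(1)] w(2) by blast
qed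

lemma clique_free_disjoint_edges:
  assumes "\<not> has_k1_crossing_family k E curve" "F \<subseteq> E" "e \<in> F"
  shows "clique_free crossing k {f \<in> F. edges_disjoint curve e f}"
  unfolding clique_free_def
proof (rule notI, elim exE conjE)
  fix X assume X: "X \<subseteq> {f \<in> F. edges_disjoint curve e f}" "card X = k" "pairwise crossing X"
  have "\<forall>f\<in>X. edges_disjoint curve f e"
    using X(1) by (auto simp: edges_disjoint_def)
  then have "has_k1_crossing_family k E curve"
    unfolding has_k1_crossing_family_def using X assms(2,3)
    by (intro exI[of _ X] exI[of _ e]) (auto simp: pairwise_def)
  then show False
    using assms(1) by blast
qed

lemma card_cut_le_if_no_k1_family:
  fixes C :: real
  assumes no: "\<not> has_k1_crossing_family (k + 2) E curve" and cut: "cut E A \<noteq> {}"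
    and clique: "\<And>V E curve. \<lbrakk>simple_tg V E curve; clique_free (edges_cross curve) (k + 2) E\<rbrakk> \<Longrightarrow>
      real (card E) \<le> C * (1 + ln (card V)) ^ k * card V"
  shows "card (cut E A) \<le> 648 * 76805\<^sup>2 * (1 + C) * polylog_size (k + 4) (card V)"
proof (rule polylog_bound_from_dense_cores)
  show "finite_graph V (cut E A)"
    using cut by (intro finite_graph) (auto simp: cut_def)
  fix W assume W: "W \<subseteq> V" and core: "dense_core W (inner_edges (cut E A) W)"
  define F where "F = inner_edges (cut E A) W"
  define L where "L = 1 + ln (real (card W))"
  have FE: "F \<subseteq> E" "\<Union>F \<subseteq> W"
    by (auto simp: F_def inner_edges_def cut_def)
  interpret H: simple_tg W F curve
    by (rule subgraph[OF FE(1) W FE(2)])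
  have L: "1 \<le> L"
    using dense_core.card_V_ge_2[OF core] by (simp add: L_def)
  have disjoint: "card {f \<in> F. edges_disjoint curve e f} \<le> C * L ^ k * card W" if e: "e \<in> F" for e
  proof -
    have "simple_tg W {f \<in> F. edges_disjoint curve e f} curve"
      using FE(2) by (intro H.subgraph) auto
    then show ?thesis
      unfolding L_def by (rule clique) (rule clique_free_disjoint_edges[OF no FE(1) e])
  qed
  have "card F \<le> 648 * 76805\<^sup>2 * L ^ 4 * (card W + C * L ^ k * card W)"
    unfolding L_def
  proof (rule H.card_dense_bipartite_core_le)
    show "dense_core W F"
      using core by (simp add: F_def)
    show "card (e \<inter> A) = 1" if "e \<in> F" for e
      using that by (simp add: F_def inner_edges_def cut_def)
  qed (use disjoint in \<open>simp add: L_def\<close>)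
  also have "\<dots> \<le> 648 * 76805\<^sup>2 * L ^ 4 * (L ^ k * card W + C * L ^ k * card W)"
    using L mult_right_mono[OF one_le_power[OF L, of k], of "real (card W)"]
    by (intro mult_left_mono add_right_mono) auto
  also have "\<dots> = 648 * 76805\<^sup>2 * (1 + C) * polylog_size (k + 4) (card W)"
    by (simp add: polylog_size_def L_def power_add algebra_simps)
  finally show "card (inner_edges (cut E A) W) \<le> 648 * 76805\<^sup>2 * (1 + C) * polylog_size (k + 4) (card W)"
    unfolding F_def .
qed simp

end

theorem few_edges_without_k1_family:
  "\<exists>C\<ge>0. \<forall>V E curve. simple_topological_graph V E curve \<longrightarrow> V \<noteq> {} \<longrightarrow> \<not> has_k1_crossing_family (k + 2) E curve \<longrightarrow>
    real (card E) \<le> C * polylog_size (k + 4) (card V)"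
proof -
  obtain C where C: "1 \<le> C"
    and clique: "\<And>V E curve. \<lbrakk>simple_tg V E curve; clique_free (edges_cross curve) (k + 2) E\<rbrakk> \<Longrightarrow>
      real (card E) \<le> C * (1 + ln (card V)) ^ k * card V"
    using few_edges_without_crossing_clique[of k] by blast
  define K where "K = 648 * 76805\<^sup>2 * (1 + C)"
  have "real (card E) \<le> 2 * K * polylog_size (k + 4) (card V)"
    if stg: "simple_topological_graph V E curve" and V: "V \<noteq> {}" and no: "\<not> has_k1_crossing_family (k + 2) E curve"
    for V E curve
  proof -
    interpret simple_tg V E curve
      by unfold_locales (rule stg)
    have "\<exists>A. card E \<le> 2 * card (cut E A)"
      using finite_V finite_E edgeD(1,2) by (intro large_cut_exists) auto
    then obtain A where A: "card E \<le> 2 * card (cut E A)"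
      by blast
    have "0 < polylog_size (k + 4) (card V)"
      using V finite_V by (intro polylog_size_pos) (simp add: Suc_le_eq card_gt_0_iff)
    then have "card (cut E A) \<le> K * polylog_size (k + 4) (card V)"
      using card_cut_le_if_no_k1_family[OF no _ clique, of A] C unfolding K_def by (cases "cut E A = {}") auto
    then show ?thesis
      using A by linarith
  qed
  moreover have "0 \<le> 2 * K"
    using C by (simp add: K_def)
  ultimately show ?thesis
    by blast
qed

lemma one_plus_ln_le:
  assumes "2 \<le> n"
  shows "1 + ln (real n) \<le> 3 * ln (real n)"
proof -
  have "2 / 3 \<le> ln (2::real)"
    by (rule ln2_ge_two_thirds)
  also have "ln 2 \<le> ln (real n)"
    using assms by simp
  finally show ?thesis
    by simp
qed

lemma polylog_size_le_ln_power:
  assumes "2 \<le> n" "q \<le> r"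
  shows "polylog_size q n \<le> 3 ^ r * real n * ln (real n) ^ r"
proof -
  have "(1 + ln (real n)) ^ q \<le> (1 + ln (real n)) ^ r"
    using assms by (intro power_increasing) auto
  also have "\<dots> \<le> (3 * ln (real n)) ^ r"
    using assms(1) one_plus_ln_le by (intro power_mono) auto
  finally have "real n * (1 + ln (real n)) ^ q \<le> real n * (3 * ln (real n)) ^ r"
    by (rule mult_left_mono) simp
  then show ?thesis
    by (simp add: polylog_size_def power_mult_distrib mult_ac)
qed

lemma polylog_edge_bound:
  assumes "2 \<le> k" "k + 2 \<le> q"
  shows "\<exists>C::real. \<forall>V E curve. simple_topological_graph V E curve \<and> card V \<ge> 2 \<and> \<not> has_k1_crossing_family k E curve
    \<longrightarrow> real (card E) \<le> C * real (card V) * ln (real (card V)) ^ q"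
proof -
  have "k - 2 + 2 = k" "k - 2 + 4 = k + 2"
    using assms(1) by simp_all
  then obtain C where C: "0 \<le> C" and bound: "\<And>V E curve.
      \<lbrakk>simple_topological_graph V E curve; V \<noteq> {}; \<not> has_k1_crossing_family k E curve\<rbrakk> \<Longrightarrow>
      real (card E) \<le> C * polylog_size (k + 2) (card V)"
    using few_edges_without_k1_family[of "k - 2"] by auto
  have "real (card E) \<le> C * 3 ^ q * real (card V) * ln (real (card V)) ^ q"
    if "simple_topological_graph V E curve" "card V \<ge> 2" "\<not> has_k1_crossing_family k E curve" for V E curve
  proof -
    have "V \<noteq> {}"
      using that(2) by auto
    then have "real (card E) \<le> C * polylog_size (k + 2) (card V)"
      using bound that by blast
    also have "\<dots> \<le> C * (3 ^ q * real (card V) * ln (real (card V)) ^ q)"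
      using C that(2) assms(2) by (intro mult_left_mono polylog_size_le_ln_power) auto
    finally show ?thesis
      by (simp add: mult_ac)
  qed
  then show ?thesis
    by blast
qed

theorem theorem12:
  shows "(\<forall>k::nat. k > 4 \<longrightarrow> (\<exists>C::real. \<forall>V E curve.
            simple_topological_graph V E curve \<and> card V \<ge> 2 \<and> \<not> has_k1_crossing_family k E curve
            \<longrightarrow> real (card E) \<le> C * real (card V) * ln (real (card V)) ^ (2 * k + 2)))
       \<and> (\<forall>k::nat. k \<in> {2, 3, 4} \<longrightarrow> (\<exists>C::real. \<forall>V E curve.
            simple_topological_graph V E curve \<and> card V \<ge> 2 \<and> \<not> has_k1_crossing_family k E curve
            \<longrightarrow> real (card E) \<le> C * real (card V) * ln (real (card V)) ^ 6))"
  by (intro conjI allI impI polylog_edge_bound) auto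

end
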